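(* Let $(\mathcal M,g)$ be a three charge microstate geometry. There is a constant $C>0$, depending only on the parameters of the geometry, such that for every smooth solution $u$ of the wave equation $\Box_g u=0$ on $\mathcal M$ with compactly supported initial data on $\Sigma_0$ and for all $t\ge 0$, $$\int_{\Sigma_t}|\partial u|^2\,\mathrm{dvol}_{\underline g}\ \le\ C\int_{\Sigma_0}\left(|\partial u|^2+|\partial\Phi u|^2+|\partial\Psi u|^2\right)\mathrm{dvol}_{\underline g}.$$
   Context: Three charge microstate geometry: fix $Q_1,Q_2,R_z>0$ and an integer $\tilde n\ge 1$. Put $a=\sqrt{Q_1Q_2}/R_z$, $\tilde\gamma_1=-a\tilde n$, $\tilde\gamma_2=a(\tilde n+1)$, $Q_p=a^2\tilde n(\tilde n+1)$, $\eta=\frac{Q_1Q_2}{Q_1Q_2+Q_1Q_p+Q_2Q_p}$, $f=r^2+(\tilde\gamma_1+\tilde\gamma_2)\eta(\tilde\gamma_1\sin^2\theta+\tilde\gamma_2\cos^2\theta)$, and $h$ by $hf=\sqrt{(f+Q_1)(f+Q_2)}$ (i.e. $h^2=(1+Q_1/f)(1+Q_2/f)$). The manifold $\mathcal M$ is diffeomorphic to $\mathbb R\times\mathbb S^3\times\mathbb R^2$, with coordinates $t\in\mathbb R$, $r\ge0$, $\theta\in[0,\pi/2]$, $\phi,\psi$ periodic with period $2\pi$, $z$ periodic with period $2\pi R_z$, and metric $$\begin{aligned}g=&-\tfrac1h(dt^2-dz^2)+\tfrac{Q_p}{hf}(dt-dz)^2+hf\Big(\tfrac{dr^2}{r^2+(\tilde\gamma_1+\tilde\gamma_2)^2\eta}+d\theta^2\Big)\\&+h\Big(r^2+\tilde\gamma_1(\tilde\gamma_1+\tilde\gamma_2)\eta-\tfrac{(\tilde\gamma_1^2-\tilde\gamma_2^2)\eta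 Q_1Q_2\cos^2\theta}{h^2f^2}\Big)\cos^2\theta\,d\psi^2\\&+h\Big(r^2+\tilde\gamma_2(\tilde\gamma_1+\tilde\gamma_2)\eta+\tfrac{(\tilde\gamma_1^2-\tilde\gamma_2^2)\eta Q_1Q_2\sin^2\theta}{h^2f^2}\Big)\sin^2\theta\,d\phi^2\\&+\tfrac{Q_p(\tilde\gamma_1+\tilde\gamma_2)^2\eta^2}{hf}(\cos^2\theta\,d\psi+\sin^2\theta\,d\phi)^2-\tfrac{2\sqrt{Q_1Q_2}}{hf}(\tilde\gamma_1\cos^2\theta\,d\psi+\tilde\gamma_2\sin^2\theta\,d\phi)(dt-dz)\\&-\tfrac{2(\tilde\gamma_1+\tilde\gamma_2)\eta\sqrt{Q_1Q_2}}{hf}(\cos^2\theta\,d\psi+\sin^2\theta\,d\phi)\,dz.\end{aligned}$$ The loci $r=0$, $\theta=0$, $\theta=\pi/2$ (and $f=0$) are only apparent singularities; $g$ extends smoothly across them to a globally hyperbolic Lorentzian metric. Notation: $T=\partial_t$, $\Phi=\partial_\phi$, $\Psi=\partial_\psi$ are coordinate (Killing) vector fields. $\Sigma_{t_1}=\{t=t_1\}$ (spacelike), with induced metric $\underline g$ and volume form $\mathrm{dvol}_{\underline g}$. At each point, with $\{X_1,\dots,X_5\}$ a $\underline g$-orthonormal basis of the tangent space of $\Sigma_t$, $|\partial u|^2:=|Tu|^2+\sum_{A=1}^5|X_Au|^2$. *)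

theory Defs
  imports "HOL-Analysis.Analysis"
begin

section \<open>Smooth functions on a Euclidean space\<close>

primrec Ck :: "nat \<Rightarrow> ('a::euclidean_space \<Rightarrow> real) \<Rightarrow> bool" where
  "Ck 0 F \<longleftrightarrow> continuous_on UNIV F"
| "Ck (Suc k) F \<longleftrightarrow> (\<forall>x. F differentiable (at x)) \<and>
     (\<forall>v. Ck k (\<lambda>x. frechet_derivative F (at x) v))"

definition smooth :: "('a::euclidean_space \<Rightarrow> real) \<Rightarrow> bool" where
  "smooth F \<longleftrightarrow> (\<forall>k. Ck k F)"

section \<open>Coordinates\<close>

text \<open>
  The coordinates on a slice are \<open>(r, \<theta>, \<phi>, \<psi>, z)\<close>.  Spacetime coordinates are
  indexed by \<open>spatial option\<close>, where \<open>None\<close> is the index of \<open>t\<close>.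
\<close>

datatype spatial = Rad | Theta | Phi | Psi | Zed

instance spatial :: finite
proof
  have "(UNIV :: spatial set) = {Rad, Theta, Phi, Psi, Zed}"
    using spatial.exhaust by auto
  then show "finite (UNIV :: spatial set)"
    by (metis finite.emptyI finite_insert)
qed

type_synonym slice_coords = "real ^ spatial"
type_synonym coords = "real ^ (spatial option)"

abbreviation tC :: "coords \<Rightarrow> real" where "tC p \<equiv> p $ None"
abbreviation rC :: "coords \<Rightarrow> real" where "rC p \<equiv> p $ Some Rad"
abbreviation thC :: "coords \<Rightarrow> real" where "thC p \<equiv> p $ Some Theta"
abbreviation phC :: "coords \<Rightarrow> real" where "phC p \<equiv> p $ Some Phi"
abbreviation psC :: "coords \<Rightarrow> real" where "psC p \<equiv> p $ Some Psi"
abbreviation zC :: "coords \<Rightarrow> real" where "zC p \<equiv> p $ Some Zed"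

text \<open>
  \<open>on_slice s x\<close> is the point of the slice \<open>t = s\<close> with spatial coordinates \<open>x\<close>;
  \<open>on_slice 0\<close> is also the inclusion of tangent vectors of a slice.
\<close>

definition on_slice :: "real \<Rightarrow> slice_coords \<Rightarrow> coords" where
  "on_slice s x = (\<chi> i. case i of None \<Rightarrow> s | Some j \<Rightarrow> x $ j)"

definition dirderiv :: "coords \<Rightarrow> (coords \<Rightarrow> real) \<Rightarrow> coords \<Rightarrow> real" where
  "dirderiv v U p = frechet_derivative U (at p) v"

definition pd :: "spatial option \<Rightarrow> (coords \<Rightarrow> real) \<Rightarrow> coords \<Rightarrow> real" where
  "pd i U p = dirderiv (axis i 1) U p"

section \<open>The manifold\<close>

text \<open>
  The manifold \<open>\<real> \<times> \<real>\<^sup>2 \<times> \<S>\<^sup>3\<close>, realised as a closed submanifold of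
  \<open>\<real> \<times> \<complex> \<times> \<complex>\<^sup>2\<close>.  Its smooth functions are thus the restrictions of the smooth
  functions on the ambient space.
\<close>

type_synonym ambient = "real \<times> complex \<times> complex \<times> complex"

definition \<M> :: "ambient set" where
  "\<M> = UNIV \<times> UNIV \<times> sphere 0 1"

definition smooth_on_\<M> :: "(ambient \<Rightarrow> real) \<Rightarrow> bool" where
  "smooth_on_\<M> u \<longleftrightarrow> (\<exists>F. smooth F \<and> (\<forall>m\<in>\<M>. u m = F m))"

definition T_deriv :: "(ambient \<Rightarrow> real) \<Rightarrow> ambient \<Rightarrow> real" where
  "T_deriv u m = deriv (\<lambda>s. u (s, snd m)) (fst m)"

definition compactly_supported_data :: "(ambient \<Rightarrow> real) \<Rightarrow> bool" where
  "compactly_supported_data u \<longleftrightarrow>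
     (\<exists>K. compact K \<and> (\<forall>m\<in>\<M> - K. fst m = 0 \<longrightarrow> u m = 0 \<and> T_deriv u m = 0))"

section \<open>Three charge microstate geometries\<close>

locale three_charge_microstate =
  fixes Q1 Q2 Rz :: real and n :: nat
  assumes Q1_pos: "Q1 > 0" and Q2_pos: "Q2 > 0" and Rz_pos: "Rz > 0" and n_ge_1: "n \<ge> 1"
begin

definition aa :: real where "aa = sqrt (Q1 * Q2) / Rz"
definition \<gamma>1 :: real where "\<gamma>1 = - aa * real n"
definition \<gamma>2 :: real where "\<gamma>2 = aa * (real n + 1)"
definition Qp :: real where "Qp = aa\<^sup>2 * real n * (real n + 1)"
definition \<eta> :: real where "\<eta> = (Q1 * Q2) / (Q1 * Q2 + Q1 * Qp + Q2 * Qp)"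

definition f :: "coords \<Rightarrow> real" where
  "f p = (rC p)\<^sup>2 + (\<gamma>1 + \<gamma>2) * \<eta> * (\<gamma>1 * (sin (thC p))\<^sup>2 + \<gamma>2 * (cos (thC p))\<^sup>2)"

text \<open>
  The product \<open>hf\<close> is regular, while \<open>f\<close> can vanish and change sign, and \<open>h\<close> with it.
\<close>

definition hf :: "coords \<Rightarrow> real" where
  "hf p = sqrt ((f p + Q1) * (f p + Q2))"

definition h :: "coords \<Rightarrow> real" where
  "h p = hf p / f p"

text \<open>The line element at \<open>p\<close>, as a quadratic form in the tangent vector \<open>v\<close>.\<close>

definition line_element :: "coords \<Rightarrow> coords \<Rightarrow> real" where
  "line_element p v =
    (let r = rC p; c2 = (cos (thC p))\<^sup>2; s2 = (sin (thC p))\<^sup>2; h = h p; hf = hf p;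
         dt = tC v; dr = rC v; d\<theta> = thC v; d\<phi> = phC v; d\<psi> = psC v; dz = zC v
     in - (1 / h) * (dt\<^sup>2 - dz\<^sup>2) + Qp / hf * (dt - dz)\<^sup>2
        + hf * (dr\<^sup>2 / (r\<^sup>2 + (\<gamma>1 + \<gamma>2)\<^sup>2 * \<eta>) + d\<theta>\<^sup>2)
        + h * (r\<^sup>2 + \<gamma>1 * (\<gamma>1 + \<gamma>2) * \<eta>
               - (\<gamma>1\<^sup>2 - \<gamma>2\<^sup>2) * \<eta> * Q1 * Q2 * c2 / hf\<^sup>2) * c2 * d\<psi>\<^sup>2
        + h * (r\<^sup>2 + \<gamma>2 * (\<gamma>1 + \<gamma>2) * \<eta>
               + (\<gamma>1\<^sup>2 - \<gamma>2\<^sup>2) * \<eta> * Q1 * Q2 * s2 / hf\<^sup>2) * s2 * d\<phi>\<^sup>2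
        + Qp * (\<gamma>1 + \<gamma>2)\<^sup>2 * \<eta>\<^sup>2 / hf * (c2 * d\<psi> + s2 * d\<phi>)\<^sup>2
        - 2 * sqrt (Q1 * Q2) / hf * (\<gamma>1 * c2 * d\<psi> + \<gamma>2 * s2 * d\<phi>) * (dt - dz)
        - 2 * (\<gamma>1 + \<gamma>2) * \<eta> * sqrt (Q1 * Q2) / hf * (c2 * d\<psi> + s2 * d\<phi>) * dz)"

definition g :: "coords \<Rightarrow> coords \<Rightarrow> coords \<Rightarrow> real" where
  "g p v w = (line_element p (v + w) - line_element p v - line_element p w) / 2"

definition g_matrix :: "coords \<Rightarrow> real ^ (spatial option) ^ (spatial option)" where
  "g_matrix p = (\<chi> i j. g p (axis i 1) (axis j 1))"

text \<open>
  The coordinates away from the apparent singularities \<open>r = 0\<close>, \<open>\<theta> = 0\<close>, \<open>\<theta> = \<pi>/2\<close>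
  and \<open>f = 0\<close>.  The points thus omitted from the manifold form a closed null set with
  empty interior.
\<close>

definition regular :: "coords set" where
  "regular = {p. rC p > 0 \<and> 0 < thC p \<and> thC p < pi / 2 \<and> f p \<noteq> 0}"

text \<open>
  The coordinates as functions into the manifold.  The angular shifts by multiples of
  \<open>z / Rz\<close> encode the smooth structure at \<open>r = 0\<close>: for \<open>r \<rightarrow> 0\<close> it is
  \<open>Rz \<partial>\<^sub>z - n \<partial>\<^sub>\<phi> + (n + 1) \<partial>\<^sub>\<psi>\<close>, and not \<open>\<partial>\<^sub>z\<close>, whose norm with respect to
  \<open>g\<close> tends to zero, and \<open>\<phi> + n z / Rz\<close> and \<open>\<psi> - (n + 1) z / Rz\<close> are constant along
  the orbits of this field, which therefore are the circles \<open>|w| = r\<close> in the plane factor.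
\<close>

definition chart :: "coords \<Rightarrow> ambient" where
  "chart p =
    (tC p,
     of_real (rC p) * cis (zC p / Rz),
     of_real (sin (thC p)) * cis (phC p + real n * zC p / Rz),
     of_real (cos (thC p)) * cis (psC p - (real n + 1) * zC p / Rz))"

definition box :: "(coords \<Rightarrow> real) \<Rightarrow> coords \<Rightarrow> real" where
  "box U p = 1 / sqrt \<bar>det (g_matrix p)\<bar> *
     (\<Sum>i\<in>UNIV. pd i (\<lambda>q. \<Sum>j\<in>UNIV.
        sqrt \<bar>det (g_matrix q)\<bar> * matrix_inv (g_matrix q) $ i $ j * pd j U q) p)"

text \<open>
  The metric and \<open>u\<close> being smooth on the whole manifold, the wave equation holds
  everywhere as soon as it holds on the dense set of regular points.
\<close>

definition smooth_wave_solution :: "(ambient \<Rightarrow> real) \<Rightarrow> bool" where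
  "smooth_wave_solution u \<longleftrightarrow>
     smooth_on_\<M> u \<and> (\<forall>p\<in>regular. box (u \<circ> chart) p = 0)"

definition g_bar :: "coords \<Rightarrow> slice_coords \<Rightarrow> slice_coords \<Rightarrow> real" where
  "g_bar p v w = g p (on_slice 0 v) (on_slice 0 w)"

definition orthonormal_frame :: "coords \<Rightarrow> (nat \<Rightarrow> slice_coords) \<Rightarrow> bool" where
  "orthonormal_frame p X \<longleftrightarrow>
     (\<forall>A\<in>{1..5}. \<forall>B\<in>{1..5}. g_bar p (X A) (X B) = (if A = B then 1 else 0))"

text \<open>\<open>|\<partial>U|\<^sup>2\<close>; the value does not depend on the choice of the orthonormal frame.\<close>

definition grad_sq :: "(coords \<Rightarrow> real) \<Rightarrow> coords \<Rightarrow> real" where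
  "grad_sq U p =
    (let X = (SOME X. orthonormal_frame p X)
     in \<bar>pd None U p\<bar>\<^sup>2 + (\<Sum>A\<in>{1..5}. \<bar>dirderiv (on_slice 0 (X A)) U p\<bar>\<^sup>2))"

definition dvol_density :: "coords \<Rightarrow> real" where
  "dvol_density p =
     sqrt (det ((\<chi> i j. g_bar p (axis i 1) (axis j 1)) :: real ^ spatial ^ spatial))"

definition slice_domain :: "slice_coords set" where
  "slice_domain =
    {x. on_slice 0 x \<in> regular \<and> x $ Phi \<in> {0..<2 * pi} \<and> x $ Psi \<in> {0..<2 * pi} \<and>
        x $ Zed \<in> {0..<2 * pi * Rz}}"

text \<open>The integral over the slice \<open>t = s\<close> of a nonnegative function given in coordinates.\<close>

definition slice_integral :: "real \<Rightarrow> (coords \<Rightarrow> real) \<Rightarrow> ennreal" where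
  "slice_integral s F =
     (\<integral>\<^sup>+x\<in>slice_domain. ennreal (F (on_slice s x) * dvol_density (on_slice s x)) \<partial>lborel)"

end

end

theory Submission
  imports Defs
begin

text \<open>
  The Killing field \<open>V = T + Z\<close> is null everywhere, so its energy density \<open>eV\<close> is nonnegative and its energy
  does not grow, but it degenerates in one direction.  In this direction lie \<open>T\<close>, \<open>\<Phi>\<close> and \<open>\<Psi>\<close>, up to fields
  that \<open>eV\<close> controls, so on a bounded range of \<open>r\<close> all derivatives of \<open>u\<close> are controlled by \<open>eV\<close> together
  with \<open>|\<Phi> u|\<^sup>2 + |\<Psi> u|\<^sup>2\<close>.  For large \<open>r\<close> the field \<open>T\<close> is timelike, and the conserved, though not positive,
  \<open>T\<close>-energy bounds the remaining part.  Finally \<open>\<Phi> u\<close> and \<open>\<Psi> u\<close> solve the wave equation as well; their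
  weighted \<open>L\<^sup>2\<close> norms are bounded by a Hardy inequality in \<open>r\<close> and their own \<open>V\<close>-energies.  The Hardy inequality
  needs no decay beyond the finiteness of these norms, which the \<open>T\<close>-energy provides qualitatively.

  All this takes place in the coordinates.  Cutoffs in \<open>ln r\<close> and \<open>ln tan \<theta>\<close> keep away from the axes, and a
  cutoff in \<open>r\<close> that moves inwards faster than the energy replaces finite speed of propagation.
\<close>

lemma frechet_derivative_eqI:
  "(F has_derivative F') (at x) \<Longrightarrow> frechet_derivative F (at x) = F'"
  using frechet_derivative_at by metis

lemma has_derivative_frechet:
  "F differentiable (at x) \<Longrightarrow> (F has_derivative frechet_derivative F (at x)) (at x)"
  by (simp add: frechet_derivative_works)

lemma frechet_derivative_add:
  fixes F G :: "'a::real_normed_vector \<Rightarrow> 'b::real_normed_vector"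
  assumes "F differentiable (at x)" "G differentiable (at x)"
  shows "frechet_derivative (\<lambda>y. F y + G y) (at x) v
    = frechet_derivative F (at x) v + frechet_derivative G (at x) v"
  by (subst frechet_derivative_eqI[OF has_derivative_add[OF assms[THEN has_derivative_frechet]]]) simp

lemma frechet_derivative_mult:
  fixes F G :: "'a::real_normed_vector \<Rightarrow> real"
  assumes "F differentiable (at x)" "G differentiable (at x)"
  shows "frechet_derivative (\<lambda>y. F y * G y) (at x) v
    = F x * frechet_derivative G (at x) v + frechet_derivative F (at x) v * G x"
  by (subst frechet_derivative_eqI[OF has_derivative_mult[OF assms[THEN has_derivative_frechet]]]) simp

lemma frechet_derivative_sum:
  fixes F :: "'i \<Rightarrow> 'a::real_normed_vector \<Rightarrow> 'b::real_normed_vector"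
  assumes "\<And>i. i \<in> I \<Longrightarrow> F i differentiable (at x)"
  shows "frechet_derivative (\<lambda>y. \<Sum>i\<in>I. F i y) (at x) v = (\<Sum>i\<in>I. frechet_derivative (F i) (at x) v)"
  by (subst frechet_derivative_eqI[OF has_derivative_sum[OF has_derivative_frechet[OF assms]]]) simp_all

lemma frechet_derivative_comp_real:
  fixes F :: "'a::real_normed_vector \<Rightarrow> real"
  assumes "F differentiable (at x)" "(\<phi> has_real_derivative d) (at (F x))"
  shows "(\<lambda>y. \<phi> (F y)) differentiable (at x)"
    and "frechet_derivative (\<lambda>y. \<phi> (F y)) (at x) v = d * frechet_derivative F (at x) v"
proof -
  have "((\<lambda>y. \<phi> (F y)) has_derivative (\<lambda>v. d * frechet_derivative F (at x) v)) (at x)"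
    using has_derivative_compose[OF has_derivative_frechet[OF assms(1)], of \<phi> "(*) d"] assms(2)
    by (simp add: has_field_derivative_def)
  then show "(\<lambda>y. \<phi> (F y)) differentiable (at x)"
    and "frechet_derivative (\<lambda>y. \<phi> (F y)) (at x) v = d * frechet_derivative F (at x) v"
    by (auto simp: differentiable_def dest: frechet_derivative_eqI)
qed

lemma frechet_derivative_linear_cmul:
  "F differentiable (at x) \<Longrightarrow> frechet_derivative F (at x) (c *\<^sub>R v) = c *\<^sub>R frechet_derivative F (at x) v"
  using linear_frechet_derivative linear_cmul by blast

lemma differentiable_along_line:
  fixes F :: "'a::real_normed_vector \<Rightarrow> real"
  assumes "F differentiable (at (x + s *\<^sub>R v))"
  shows "((\<lambda>s. F (x + s *\<^sub>R v)) has_real_derivative frechet_derivative F (at (x + s *\<^sub>R v)) v) (at s)"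
proof -
  have *: "((\<lambda>s. x + s *\<^sub>R v) has_derivative (\<lambda>h. h *\<^sub>R v)) (at s)"
    by (auto intro!: derivative_eq_intros)
  have "((\<lambda>s. F (x + s *\<^sub>R v)) has_derivative
      (\<lambda>h. frechet_derivative F (at (x + s *\<^sub>R v)) (h *\<^sub>R v))) (at s)"
    by (rule has_derivative_compose[OF * has_derivative_frechet[OF assms]])
  then show ?thesis
    by (simp add: has_field_derivative_def frechet_derivative_linear_cmul[OF assms] mult.commute[of _ "frechet_derivative _ _ _"])
qed

section \<open>Calculus of smooth functions\<close>

lemma Ck_continuous: "Ck k F \<Longrightarrow> continuous_on UNIV F"
  by (cases k) (auto simp: continuous_on_eq_continuous_at differentiable_imp_continuous_within)

lemma Ck_SucD: "Ck (Suc k) F \<Longrightarrow> Ck k F"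
proof (induction k arbitrary: F)
  case 0
  then show ?case by (simp add: continuous_on_eq_continuous_at differentiable_imp_continuous_within)
qed auto

lemma Ck_const: "Ck k (\<lambda>_. c)"
  by (induction k arbitrary: c) (auto simp: )

lemma Ck_add: "Ck k F \<Longrightarrow> Ck k G \<Longrightarrow> Ck k (\<lambda>x. F x + G x)"
proof (induction k arbitrary: F G)
  case (Suc k)
  then have "(\<lambda>x. frechet_derivative (\<lambda>y. F y + G y) (at x) v)
     = (\<lambda>x. frechet_derivative F (at x) v + frechet_derivative G (at x) v)" for v
    by (auto simp: frechet_derivative_add)
  with Suc show ?case by auto
qed (auto intro: continuous_intros)

lemma Ck_mult: "Ck k F \<Longrightarrow> Ck k G \<Longrightarrow> Ck k (\<lambda>x. F x * G x)"
proof (induction k arbitrary: F G)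
  case (Suc k)
  then have "(\<lambda>x. frechet_derivative (\<lambda>y. F y * G y) (at x) v)
     = (\<lambda>x. F x * frechet_derivative G (at x) v + frechet_derivative F (at x) v * G x)" for v
    by (auto simp: frechet_derivative_mult)
  moreover have "Ck k (\<lambda>x. F x * frechet_derivative G (at x) v + frechet_derivative F (at x) v * G x)" for v
    by (intro Ck_add Suc.IH Ck_SucD[OF Suc.prems(1)] Ck_SucD[OF Suc.prems(2)]) (use Suc.prems in auto)
  ultimately show ?case using Suc.prems by auto
qed (auto intro: continuous_intros)

lemma Ck_sum: "(\<And>i. i \<in> I \<Longrightarrow> Ck k (F i)) \<Longrightarrow> Ck k (\<lambda>x. \<Sum>i\<in>I. F i x)"
  by (induction I rule: infinite_finite_induct) (auto intro: Ck_const Ck_add)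

lemma Ck_compose:
  fixes G :: "'a::euclidean_space \<Rightarrow> 'b::euclidean_space"
  assumes "\<And>b. b \<in> Basis \<Longrightarrow> Ck k (\<lambda>x. G x \<bullet> b)" "Ck k F"
  shows "Ck k (\<lambda>x. F (G x))"
  using assms
proof (induction k arbitrary: F)
  case 0
  then have "continuous_on UNIV G"
    by (simp add: continuous_on_componentwise[of _ G])
  then show ?case using 0(2) by (auto intro: continuous_on_compose2)
next
  case (Suc k)
  have G: "G differentiable (at x)" for x
    using Suc.prems(1) by (auto simp: differentiable_componentwise_within[of G])
  have *: "frechet_derivative (\<lambda>x. F (G x)) (at x) v =
     (\<Sum>b\<in>Basis. frechet_derivative (\<lambda>x. G x \<bullet> b) (at x) v * frechet_derivative F (at (G x)) b)" for x v
  proof -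
    let ?G' = "frechet_derivative G (at x)" and ?F' = "frechet_derivative F (at (G x))"
    have F: "F differentiable (at (G x))" using Suc.prems by auto
    have "frechet_derivative (\<lambda>x. F (G x)) (at x) = (\<lambda>v. ?F' (?G' v))"
      by (rule frechet_derivative_eqI, rule has_derivative_compose) (use F G in \<open>auto intro: has_derivative_frechet\<close>)
    then have "frechet_derivative (\<lambda>x. F (G x)) (at x) v = ?F' (\<Sum>b\<in>Basis. (?G' v \<bullet> b) *\<^sub>R b)"
      by (simp add: euclidean_representation)
    also have "\<dots> = (\<Sum>b\<in>Basis. (?G' v \<bullet> b) * ?F' b)"
      using linear_frechet_derivative[OF F] by (simp add: linear_sum linear_cmul)
    also have "\<dots> = (\<Sum>b\<in>Basis. frechet_derivative (\<lambda>x. G x \<bullet> b) (at x) v * ?F' b)"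
    proof (intro sum.cong refl)
      fix b :: 'b
      have "frechet_derivative (\<lambda>x. G x \<bullet> b) (at x) = (\<lambda>v. ?G' v \<bullet> b)"
        by (rule frechet_derivative_eqI) (intro has_derivative_inner_left has_derivative_frechet G)
      then show "(?G' v \<bullet> b) * ?F' b = frechet_derivative (\<lambda>x. G x \<bullet> b) (at x) v * ?F' b" by simp
    qed
    finally show ?thesis .
  qed
  have "Ck k (\<lambda>x. \<Sum>b\<in>Basis. frechet_derivative (\<lambda>x. G x \<bullet> b) (at x) v * frechet_derivative F (at (G x)) b)" for v
  proof (rule Ck_sum, rule Ck_mult)
    fix b :: 'b assume b: "b \<in> Basis"
    show "Ck k (\<lambda>x. frechet_derivative (\<lambda>x. G x \<bullet> b) (at x) v)"
      using Suc.prems(1)[OF b] by simp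
    show "Ck k (\<lambda>x. frechet_derivative F (at (G x)) b)"
      by (rule Suc.IH[where F = "\<lambda>y. frechet_derivative F (at y) b"])
        (use Suc.prems(2) Ck_SucD[OF Suc.prems(1)] in auto)
  qed
  moreover have "(\<lambda>x. F (G x)) differentiable (at x)" for x
    by (rule differentiable_compose[where f = F]) (use Suc.prems(2) G in auto)
  ultimately show ?case by (simp add: *)
qed

lemma Ck_bounded_linear: "bounded_linear F \<Longrightarrow> Ck k F"
proof (cases k)
  case 0
  then show "bounded_linear F \<Longrightarrow> Ck k F"
    by (simp add: linear_continuous_on)
next
  case (Suc m)
  assume F: "bounded_linear F"
  then have "frechet_derivative F (at x) = F" for x
    by (intro frechet_derivative_eqI bounded_linear_imp_has_derivative)
  with F Suc show "Ck k F"
    by (auto simp: Ck_const bounded_linear_imp_differentiable)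
qed

lemma Ck_sin_cos: "Ck k (sin :: real \<Rightarrow> real) \<and> Ck k (cos :: real \<Rightarrow> real)"
proof (induction k)
  case 0
  show ?case by (auto intro: continuous_intros)
next
  case (Suc k)
  have ds: "(sin has_derivative (\<lambda>v. v * cos x)) (at x)"
    and dc: "(cos has_derivative (\<lambda>v. v * - sin x)) (at x)" for x :: real
    by (auto intro!: derivative_eq_intros)
  have "Ck k (\<lambda>x. v * cos x)" "Ck k (\<lambda>x. (- v) * sin x)" for v :: real
    by (intro Ck_mult Ck_const conjunct1[OF Suc] conjunct2[OF Suc])+
  then show ?case
    using frechet_derivative_eqI[OF ds] frechet_derivative_eqI[OF dc]
    by (auto simp: differentiable_def intro!: exI ds dc)
qed

lemma second_difference:
  fixes F :: "'a::euclidean_space \<Rightarrow> real"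
  assumes "Ck 2 F" "h > 0"
  shows "\<exists>s t. 0 < s \<and> s < h \<and> 0 < t \<and> t < h \<and>
    F (x + h *\<^sub>R v + h *\<^sub>R w) - F (x + h *\<^sub>R v) - F (x + h *\<^sub>R w) + F x =
    h * h * frechet_derivative (\<lambda>y. frechet_derivative F (at y) v) (at (x + s *\<^sub>R v + t *\<^sub>R w)) w"
proof -
  define Fv where "Fv = (\<lambda>y. frechet_derivative F (at y) v)"
  have dF: "F differentiable (at y)" and dFv: "Fv differentiable (at y)" for y
    using assms by (simp_all add: numeral_2_eq_2 Fv_def)
  have "((\<lambda>s. F (x + h *\<^sub>R w + s *\<^sub>R v) - F (x + s *\<^sub>R v)) has_real_derivative
      (Fv (x + h *\<^sub>R w + s *\<^sub>R v) - Fv (x + s *\<^sub>R v))) (at s)" for s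
    unfolding Fv_def by (intro DERIV_diff differentiable_along_line dF)
  from MVT2[of 0 h "\<lambda>s. F (x + h *\<^sub>R w + s *\<^sub>R v) - F (x + s *\<^sub>R v)", OF assms(2) this]
  obtain s where s: "0 < s" "s < h"
    "F (x + h *\<^sub>R w + h *\<^sub>R v) - F (x + h *\<^sub>R v) - (F (x + h *\<^sub>R w) - F x)
      = h * (Fv (x + h *\<^sub>R w + s *\<^sub>R v) - Fv (x + s *\<^sub>R v))" by auto
  have "((\<lambda>t. Fv ((x + s *\<^sub>R v) + t *\<^sub>R w)) has_real_derivative
      frechet_derivative Fv (at (x + s *\<^sub>R v + t *\<^sub>R w)) w) (at t)" for t
    by (intro differentiable_along_line dFv)
  from MVT2[of 0 h "\<lambda>t. Fv ((x + s *\<^sub>R v) + t *\<^sub>R w)", OF assms(2) this]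
  obtain t where t: "0 < t" "t < h"
    "Fv (x + s *\<^sub>R v + h *\<^sub>R w) - Fv (x + s *\<^sub>R v)
      = h * frechet_derivative Fv (at (x + s *\<^sub>R v + t *\<^sub>R w)) w" by auto
  show ?thesis
    using s t by (intro exI[of _ s] exI[of _ t]) (auto simp: Fv_def algebra_simps)
qed

lemma second_derivative_symmetric:
  fixes F :: "'a::euclidean_space \<Rightarrow> real"
  assumes "Ck 2 F"
  shows "frechet_derivative (\<lambda>y. frechet_derivative F (at y) v) (at x) w
       = frechet_derivative (\<lambda>y. frechet_derivative F (at y) w) (at x) v"
proof -
  define D where "D v w y = frechet_derivative (\<lambda>y. frechet_derivative F (at y) v) (at y) w" for v w and y :: 'a
  define h where "h n = inverse (real (Suc n))" for n :: nat
  have h: "h n > 0" and h': "h n \<noteq> 0" for n by (simp_all add: h_def)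
  have h0: "h \<longlonglongrightarrow> 0" unfolding h_def by (rule LIMSEQ_inverse_real_of_nat)
  have lim: "\<exists>s t. (\<forall>n. h n * h n * D v w (x + s n *\<^sub>R v + t n *\<^sub>R w) =
     F (x + h n *\<^sub>R v + h n *\<^sub>R w) - F (x + h n *\<^sub>R v) - F (x + h n *\<^sub>R w) + F x) \<and>
     (\<lambda>n. D v w (x + s n *\<^sub>R v + t n *\<^sub>R w)) \<longlonglongrightarrow> D v w x" for v w
  proof -
    from second_difference[OF assms h, where x = x and v = v and w = w]
    obtain s t where st: "\<And>n. 0 < s n \<and> s n < h n \<and> 0 < t n \<and> t n < h n \<and>
      F (x + h n *\<^sub>R v + h n *\<^sub>R w) - F (x + h n *\<^sub>R v) - F (x + h n *\<^sub>R w) + F x =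
      h n * h n * D v w (x + s n *\<^sub>R v + t n *\<^sub>R w)" unfolding D_def by metis
    have "s \<longlonglongrightarrow> 0" "t \<longlonglongrightarrow> 0"
      using st by (auto intro!: tendsto_sandwich[OF _ _ tendsto_const h0] eventuallyI less_imp_le)
    then have "(\<lambda>n. x + s n *\<^sub>R v + t n *\<^sub>R w) \<longlonglongrightarrow> x + 0 *\<^sub>R v + 0 *\<^sub>R w"
      by (intro tendsto_intros)
    moreover have "isCont (D v w) x"
    proof -
      have "continuous_on UNIV (D v w)"
        using assms unfolding D_def by (auto simp: numeral_2_eq_2)
      then show ?thesis by (simp add: continuous_on_eq_continuous_at)
    qed
    ultimately have "(\<lambda>n. D v w (x + s n *\<^sub>R v + t n *\<^sub>R w)) \<longlonglongrightarrow> D v w x"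
      using isCont_tendsto_compose[of x "D v w"] by simp
    with st show ?thesis by metis
  qed
  from lim[of v w] obtain s t where 1: "\<And>n. h n * h n * D v w (x + s n *\<^sub>R v + t n *\<^sub>R w) =
     F (x + h n *\<^sub>R v + h n *\<^sub>R w) - F (x + h n *\<^sub>R v) - F (x + h n *\<^sub>R w) + F x"
     "(\<lambda>n. D v w (x + s n *\<^sub>R v + t n *\<^sub>R w)) \<longlonglongrightarrow> D v w x" by blast
  from lim[of w v] obtain s' t' where 2: "\<And>n. h n * h n * D w v (x + s' n *\<^sub>R w + t' n *\<^sub>R v) =
     F (x + h n *\<^sub>R w + h n *\<^sub>R v) - F (x + h n *\<^sub>R w) - F (x + h n *\<^sub>R v) + F x"
     "(\<lambda>n. D w v (x + s' n *\<^sub>R w + t' n *\<^sub>R v)) \<longlonglongrightarrow> D w v x" by blast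
  have "h n * h n * D v w (x + s n *\<^sub>R v + t n *\<^sub>R w) = h n * h n * D w v (x + s' n *\<^sub>R w + t' n *\<^sub>R v)" for n
    unfolding 1(1) 2(1) by (simp add: algebra_simps)
  then have "D v w (x + s n *\<^sub>R v + t n *\<^sub>R w) = D w v (x + s' n *\<^sub>R w + t' n *\<^sub>R v)" for n
    by (simp add: h')
  with 1(2) 2(2) have "D v w x = D w v x"
    by (simp add: LIMSEQ_unique)
  then show ?thesis by (simp add: D_def)
qed

section \<open>Continuously differentiable functions on an open set\<close>

definition C1_on :: "'a::euclidean_space set \<Rightarrow> ('a \<Rightarrow> real) \<Rightarrow> bool" where
  "C1_on S F \<longleftrightarrow> (\<forall>x\<in>S. F differentiable (at x)) \<and>
     (\<forall>v. continuous_on S (\<lambda>x. frechet_derivative F (at x) v))"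

lemma C1_onD: "C1_on S F \<Longrightarrow> x \<in> S \<Longrightarrow> F differentiable (at x)"
  "C1_on S F \<Longrightarrow> continuous_on S (\<lambda>x. frechet_derivative F (at x) v)"
  by (auto simp: C1_on_def)

lemma C1_on_continuous: "C1_on S F \<Longrightarrow> continuous_on S F"
  by (auto simp: C1_on_def differentiable_imp_continuous_within continuous_at_imp_continuous_on)

lemma C1_on_const: "C1_on S (\<lambda>_. c)"
  by (auto simp: C1_on_def)

lemma C1_on_add:
  assumes "C1_on S F" "C1_on S G" shows "C1_on S (\<lambda>x. F x + G x)"
  using assms
  by (auto simp: C1_on_def frechet_derivative_add intro!: continuous_intros cong: continuous_on_cong)

lemma C1_on_mult:
  assumes "C1_on S F" "C1_on S G" shows "C1_on S (\<lambda>x. F x * G x)"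
  using assms C1_on_continuous[OF assms(1)] C1_on_continuous[OF assms(2)]
  by (auto simp: C1_on_def frechet_derivative_mult intro!: continuous_intros cong: continuous_on_cong)

lemma C1_on_sum: "(\<And>i. i \<in> I \<Longrightarrow> C1_on S (F i)) \<Longrightarrow> C1_on S (\<lambda>x. \<Sum>i\<in>I. F i x)"
  by (induction I rule: infinite_finite_induct) (auto intro: C1_on_const C1_on_add)

lemma C1_on_minus: "C1_on S F \<Longrightarrow> C1_on S (\<lambda>x. - F x)"
  using C1_on_mult[OF C1_on_const[of S "-1"]] by simp

lemma C1_on_diff: "C1_on S F \<Longrightarrow> C1_on S G \<Longrightarrow> C1_on S (\<lambda>x. F x - G x)"
  using C1_on_add[OF _ C1_on_minus] by fastforce

lemma C1_on_comp_real:
  assumes F: "C1_on S F" and d: "\<And>x. x \<in> S \<Longrightarrow> (\<phi> has_real_derivative \<phi>' (F x)) (at (F x))"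
    and c: "continuous_on (F ` S) \<phi>'"
  shows "C1_on S (\<lambda>x. \<phi> (F x))"
proof -
  have "continuous_on S (\<lambda>x. \<phi>' (F x))"
    using continuous_on_compose2[OF c C1_on_continuous[OF F]] by auto
  then have "continuous_on S (\<lambda>x. \<phi>' (F x) * frechet_derivative F (at x) v)" for v
    using F by (auto simp: C1_on_def intro!: continuous_intros)
  moreover have "(\<lambda>y. \<phi> (F y)) differentiable (at x)"
    "frechet_derivative (\<lambda>y. \<phi> (F y)) (at x) v = \<phi>' (F x) * frechet_derivative F (at x) v" if "x \<in> S" for x v
    using frechet_derivative_comp_real[where \<phi> = \<phi>, OF C1_onD(1)[OF F that] d[OF that]] by auto
  ultimately show ?thesis
    unfolding C1_on_def by (auto cong: continuous_on_cong)
qed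

lemma C1_on_power: "C1_on S F \<Longrightarrow> C1_on S (\<lambda>x. F x ^ n)"
  by (rule C1_on_comp_real[where \<phi>' = "\<lambda>x. real n * x ^ (n - 1)"])
     (auto intro!: derivative_eq_intros continuous_intros)

lemma C1_on_inverse:
  assumes "C1_on S F" "\<And>x. x \<in> S \<Longrightarrow> F x \<noteq> 0" shows "C1_on S (\<lambda>x. inverse (F x))"
  by (rule C1_on_comp_real[where \<phi>' = "\<lambda>x. - (inverse x ^ 2)"])
     (use assms in \<open>auto intro!: derivative_eq_intros continuous_intros simp: power2_eq_square\<close>)

lemma C1_on_divide:
  assumes "C1_on S F" "C1_on S G" "\<And>x. x \<in> S \<Longrightarrow> G x \<noteq> 0" shows "C1_on S (\<lambda>x. F x / G x)"
  unfolding divide_inverse by (intro C1_on_mult C1_on_inverse assms)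

lemma C1_on_sin: "C1_on S F \<Longrightarrow> C1_on S (\<lambda>x. sin (F x))"
  by (rule C1_on_comp_real[where \<phi>' = cos]) (auto intro!: derivative_eq_intros continuous_intros)

lemma C1_on_cos: "C1_on S F \<Longrightarrow> C1_on S (\<lambda>x. cos (F x))"
  by (rule C1_on_comp_real[where \<phi>' = "\<lambda>x. - sin x"]) (auto intro!: derivative_eq_intros continuous_intros)

lemma C1_on_ln:
  assumes "C1_on S F" "\<And>x. x \<in> S \<Longrightarrow> F x > 0" shows "C1_on S (\<lambda>x. ln (F x))"
  by (rule C1_on_comp_real[where \<phi>' = inverse])
     (use assms in \<open>auto intro!: DERIV_ln continuous_intros simp: image_iff\<close>, force)

lemma Ck_C1_on: "Ck (Suc k) F \<Longrightarrow> C1_on S F"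
  by (auto simp: C1_on_def intro: continuous_on_subset[OF Ck_continuous])

section \<open>The divergence theorem on a box\<close>

lemma integral_cbox_eq_0_if_line_integrals:
  fixes G :: "'a::euclidean_space \<Rightarrow> real"
  assumes cont: "continuous_on (cbox a b) G" and e: "e \<in> Basis"
    and line: "\<And>x. x \<in> cbox a b \<Longrightarrow>
      ((\<lambda>s. G (x + (s - x \<bullet> e) *\<^sub>R e)) has_integral 0) {a \<bullet> e..b \<bullet> e}"
  shows "integral (cbox a b) G = 0"
proof -
  interpret product_sigma_finite "\<lambda>_::'a. lborel :: real measure"
    by standard
  define H where "H x = indicator (cbox a b) x *\<^sub>R G x" for x
  define P where "P I = (\<Pi>\<^sub>M b\<in>I. (lborel :: real measure))" for I :: "'a set"
  define E where "E f = (\<Sum>b\<in>Basis. f b *\<^sub>R b)" for f :: "'a \<Rightarrow> real"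
  have intH: "integrable lborel H"
    unfolding H_def by (rule borel_integrable_compact) (use cont in auto)
  have E_meas: "E \<in> measurable (P Basis) borel"
    unfolding E_def P_def by measurable
  have lb: "lborel = distr (P Basis) borel E"
    unfolding P_def E_def by (rule lborel_eq)
  have ins: "insert e (Basis - {e}) = Basis" using e by auto
  have "integral (cbox a b) G = (\<integral>x. H x \<partial>lborel)"
    using set_borel_integral_eq_integral(2)[of "cbox a b" G] intH
    by (simp add: H_def[abs_def] set_integrable_def set_lebesgue_integral_def)
  also have "\<dots> = (\<integral>f. H (E f) \<partial>(P Basis))"
    using intH by (subst lb) (intro integral_distr E_meas, auto dest: borel_measurable_integrable)
  also have "\<dots> = (\<integral>f. (\<integral>s. H (E (f(e := s))) \<partial>lborel) \<partial>(P (Basis - {e})))"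
  proof -
    have "integrable (P Basis) (\<lambda>f. H (E f))"
    proof -
      have "H \<in> borel_measurable borel"
        using borel_measurable_integrable[OF intH] by simp
      from integrable_distr_eq[OF E_meas this] show ?thesis
        using intH unfolding lb by simp
    qed
    then show ?thesis
      using product_integral_insert[of "Basis - {e}" e "\<lambda>f. H (E f)"] unfolding P_def ins by simp
  qed
  also have "\<dots> = (\<integral>f. 0 \<partial>(P (Basis - {e})))"
  proof (intro Bochner_Integration.integral_cong refl)
    fix f :: "'a \<Rightarrow> real"
    have Eb: "E (f(e := s)) \<bullet> b = (if b = e then s else f b)" if "b \<in> Basis" for s b
      using that unfolding E_def inner_sum_left_Basis[OF that] by simp
    show "(\<integral>s. H (E (f(e := s))) \<partial>lborel) = 0"
    proof (cases "\<exists>s. E (f(e := s)) \<in> cbox a b")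
      case False
      then show ?thesis by (simp add: H_def)
    next
      case True
      then obtain s0 where s0: "E (f(e := s0)) \<in> cbox a b" ..
      define x where "x = E (f(e := s0))"
      have x: "x \<in> cbox a b" "x \<bullet> e = s0" using s0 Eb[OF e] by (auto simp: x_def)
      have Ex: "E (f(e := s)) = x + (s - x \<bullet> e) *\<^sub>R e" for s
        by (rule euclidean_eqI) (use e in \<open>auto simp: x(2) Eb inner_simps inner_Basis x_def\<close>)
      have mem: "E (f(e := s)) \<in> cbox a b \<longleftrightarrow> s \<in> {a \<bullet> e..b \<bullet> e}" for s
        using x e by (auto simp: mem_box Eb x_def split: if_splits)
      have "continuous_on {a \<bullet> e..b \<bullet> e} (\<lambda>s. G (E (f(e := s))))"
      proof (rule continuous_on_compose2[OF cont])
        show "continuous_on {a \<bullet> e..b \<bullet> e} (\<lambda>s. E (f(e := s)))"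
          unfolding Ex by (intro continuous_intros)
      qed (use mem in blast)
      then have int: "set_integrable lborel {a \<bullet> e..b \<bullet> e} (\<lambda>s. G (E (f(e := s))))"
        unfolding set_integrable_def by (rule borel_integrable_compact[OF compact_Icc])
      have "(\<integral>s. H (E (f(e := s))) \<partial>lborel)
          = (LINT s : {a \<bullet> e..b \<bullet> e} | lborel. G (E (f(e := s))))"
        unfolding set_lebesgue_integral_def H_def using mem
        by (intro Bochner_Integration.integral_cong refl) (auto simp: indicator_def)
      also have "\<dots> = integral {a \<bullet> e..b \<bullet> e} (\<lambda>s. G (E (f(e := s))))"
        by (rule set_borel_integral_eq_integral(2)[OF int])
      also have "\<dots> = 0"
        using line[OF x(1)] by (simp add: Ex integral_unique)
      finally show ?thesis .
    qed
  qed
  finally show ?thesis by simp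
qed

lemma integral_partial_derivative_eq_0:
  fixes F G :: "'a::euclidean_space \<Rightarrow> real"
  assumes cont: "continuous_on (cbox a b) G" and e: "e \<in> Basis" and ab: "a \<bullet> e \<le> b \<bullet> e"
    and deriv: "\<And>x. x \<in> cbox a b \<Longrightarrow> ((\<lambda>s. F (x + s *\<^sub>R e)) has_real_derivative G x) (at 0)"
    and per: "\<And>x. x \<in> cbox a b \<Longrightarrow> x \<bullet> e = a \<bullet> e \<Longrightarrow> F (x + (b \<bullet> e - a \<bullet> e) *\<^sub>R e) = F x"
  shows "integral (cbox a b) G = 0"
proof (rule integral_cbox_eq_0_if_line_integrals[OF cont e])
  fix x assume x: "x \<in> cbox a b"
  define y where "y s = x + (s - x \<bullet> e) *\<^sub>R e" for s
  have y: "y s \<in> cbox a b" if "s \<in> {a \<bullet> e..b \<bullet> e}" for s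
    using x that e by (auto simp: mem_box y_def inner_simps inner_Basis)
  have "((\<lambda>s. G (y s)) has_integral (F (y (b \<bullet> e)) - F (y (a \<bullet> e)))) {a \<bullet> e..b \<bullet> e}"
  proof (rule fundamental_theorem_of_calculus[OF ab])
    fix s assume "s \<in> {a \<bullet> e..b \<bullet> e}"
    from deriv[OF y[OF this]] have "((\<lambda>t. F (y s + t *\<^sub>R e)) has_real_derivative G (y s)) (at (s + - s))"
      by simp
    then have "((\<lambda>t. F (y s + (t + - s) *\<^sub>R e)) has_real_derivative G (y s)) (at s)"
      by (subst (asm) DERIV_shift)
    moreover have "y s + (t + - s) *\<^sub>R e = y t" for t
      by (simp add: y_def algebra_simps)
    ultimately show "((\<lambda>s. F (y s)) has_vector_derivative G (y s)) (at s within {a \<bullet> e..b \<bullet> e})"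
      by (simp add: has_real_derivative_iff_has_vector_derivative has_vector_derivative_at_within)
  qed
  moreover have "F (y (b \<bullet> e)) = F (y (a \<bullet> e))"
  proof -
    have "y (a \<bullet> e) \<bullet> e = a \<bullet> e"
      using e by (simp add: y_def inner_add_left inner_Basis)
    moreover have "y (b \<bullet> e) = y (a \<bullet> e) + (b \<bullet> e - a \<bullet> e) *\<^sub>R e"
      by (simp add: y_def algebra_simps)
    ultimately show ?thesis
      using per[OF y, of "a \<bullet> e"] ab by simp
  qed
  ultimately show "((\<lambda>s. G (x + (s - x \<bullet> e) *\<^sub>R e)) has_integral 0) {a \<bullet> e..b \<bullet> e}"
    by (simp add: y_def)
qed

lemma UNIV_spatial: "(UNIV :: spatial set) = {Rad, Theta, Phi, Psi, Zed}"
  using spatial.exhaust by auto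

lemma sum_spatial: "(\<Sum>i\<in>UNIV. F i) = F Rad + F Theta + F Phi + F Psi + F Zed"
  by (simp add: UNIV_spatial add.assoc)

lemma sum_option: "(\<Sum>i\<in>UNIV. F i) = F None + (\<Sum>j\<in>UNIV. F (Some j))"
  for F :: "'a::finite option \<Rightarrow> 'b::comm_monoid_add"
  by (simp add: UNIV_option_conv sum.reindex)

lemmas sum_coords = sum_option sum_spatial

context three_charge_microstate
begin

definition Qs where "Qs = Q1 + Q2"
definition m where "m = sqrt (Q1 * Q2)"
definition k where "k = aa\<^sup>2 * \<eta>"
abbreviation N where "N \<equiv> real n"

lemma basic_pos: "aa > 0" "m > 0" "Qs > 0" "Qp > 0" "0 < \<eta>" "k > 0" "N \<ge> 1"
proof -
  show a: "aa > 0" and "m > 0" "Qs > 0" and N: "N \<ge> 1"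
    using Q1_pos Q2_pos Rz_pos n_ge_1 by (auto simp: aa_def m_def Qs_def)
  show Qp: "Qp > 0" using a N by (auto simp: Qp_def)
  show "0 < \<eta>" using Q1_pos Q2_pos Qp by (auto simp: \<eta>_def intro!: divide_pos_pos add_pos_pos)
  then show "k > 0" using a by (simp add: k_def)
qed

lemma m_sq: "m\<^sup>2 = Q1 * Q2"
  using Q1_pos Q2_pos by (simp add: m_def)

lemma aa_Rz: "aa * Rz = m"
  using Rz_pos by (simp add: aa_def m_def)

lemma \<eta>_eq: "\<eta> * (m\<^sup>2 + Qs * Qp) = m\<^sup>2"
proof -
  have "Q1 * Q2 + Q1 * Qp + Q2 * Qp > 0"
    using Q1_pos Q2_pos basic_pos by (intro add_pos_pos mult_pos_pos) auto
  then show ?thesis by (simp add: \<eta>_def m_sq Qs_def field_simps)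
qed

lemma \<gamma>_sum: "\<gamma>1 + \<gamma>2 = aa" "\<gamma>1 = - (aa * N)" "\<gamma>2 = aa * (N + 1)"
  by (simp_all add: \<gamma>1_def \<gamma>2_def algebra_simps)

lemma k_Rz: "k * Rz\<^sup>2 = m\<^sup>2 * \<eta>" "k * Rz = aa * m * \<eta>" "\<eta> * Qp = k * N * (N + 1)"
  unfolding k_def Qp_def aa_Rz[symmetric] by (auto simp: power2_eq_square algebra_simps)

definition \<nu> :: "coords \<Rightarrow> real" where
  "\<nu> p = (N + 1) * (cos (thC p))\<^sup>2 - N * (sin (thC p))\<^sup>2"

lemma f_eq: "f p = (rC p)\<^sup>2 + k * \<nu> p"
  by (simp add: f_def \<gamma>_sum k_def \<nu>_def power2_eq_square algebra_simps)

lemma kN_less: "k * N < Q1" "k * N < Q2"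
proof -
  have "\<eta> * (Qs * Qp) < m\<^sup>2"
    using \<eta>_eq basic_pos by (smt (verit) distrib_left mult_pos_pos zero_less_power)
  then have "(k * N) * ((N + 1) * (Q1 + Q2)) < Q1 * Q2"
    using k_Rz(3) m_sq by (simp add: Qs_def algebra_simps)
  moreover have "(k * N) * Q1 \<le> (k * N) * ((N + 1) * (Q1 + Q2))"
    and "(k * N) * Q2 \<le> (k * N) * ((N + 1) * (Q1 + Q2))"
    using basic_pos Q1_pos Q2_pos by (auto intro!: mult_left_mono simp: algebra_simps)
  ultimately have "(k * N) * Q1 < Q2 * Q1" "(k * N) * Q2 < Q1 * Q2" by (simp_all add: mult.commute)
  then show "k * N < Q1" "k * N < Q2" using Q1_pos Q2_pos by simp_all
qed

lemma \<nu>_bounds: "- N \<le> \<nu> p" "\<nu> p \<le> N + 1"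
proof -
  have "\<nu> p = (2 * N + 1) * (cos (thC p))\<^sup>2 - N"
    using sin_cos_squared_add[of "thC p"] by (simp add: \<nu>_def sin_squared_eq algebra_simps)
  moreover have "0 \<le> (cos (thC p))\<^sup>2" "(cos (thC p))\<^sup>2 \<le> 1"
    by (auto simp: abs_square_le_1)
  moreover have "0 \<le> 2 * N + 1" by simp
  ultimately show "- N \<le> \<nu> p" "\<nu> p \<le> N + 1"
    using mult_left_mono[of "(cos (thC p))\<^sup>2" 1 "2 * N + 1"] by auto
qed

lemma f_bounds: "f p \<ge> (rC p)\<^sup>2 - k * N" "f p \<le> (rC p)\<^sup>2 + k * (N + 1)"
  using mult_left_mono[OF \<nu>_bounds(1), of k] mult_left_mono[OF \<nu>_bounds(2), of k p] basic_pos
  by (auto simp: f_eq)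

lemma f_plus_Q_pos: "f p + Q1 > 0" "f p + Q2 > 0"
proof -
  show "f p + Q1 > 0" "f p + Q2 > 0"
    using f_bounds(1)[of p] kN_less zero_le_power2[of "rC p"] by linarith+
qed

lemma hf_pos: "hf p > 0" and hf_sq: "(hf p)\<^sup>2 = (f p)\<^sup>2 + Qs * f p + m\<^sup>2"
proof -
  have pos: "(f p + Q1) * (f p + Q2) > 0" using f_plus_Q_pos[of p] by simp
  then show "hf p > 0" by (simp add: hf_def)
  have "(hf p)\<^sup>2 = (f p + Q1) * (f p + Q2)"
    using pos by (simp add: hf_def)
  then show "(hf p)\<^sup>2 = (f p)\<^sup>2 + Qs * f p + m\<^sup>2"
    unfolding m_sq by (simp add: Qs_def power2_eq_square algebra_simps)
qed

text \<open>\<open>hf g\<close>, simplified so that no singularity at \<open>f = 0\<close> is left.\<close>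

definition G :: "coords \<Rightarrow> coords \<Rightarrow> coords \<Rightarrow> real" where
  "G p v w = (let r2 = (rC p)\<^sup>2; c2 = (cos (thC p))\<^sup>2; s2 = (sin (thC p))\<^sup>2 in
     - f p * (tC v * tC w - zC v * zC w) + Qp * ((tC v - zC v) * (tC w - zC w))
     + (hf p)\<^sup>2 * (rC v * rC w / (r2 + k) + thC v * thC w)
     + c2 * ((f p + Qs) * (r2 - k * N) + m\<^sup>2) * (psC v * psC w)
     + s2 * ((f p + Qs) * (r2 + k * (N + 1)) + m\<^sup>2) * (phC v * phC w)
     + Qp * k * \<eta> * ((c2 * psC v + s2 * phC v) * (c2 * psC w + s2 * phC w))
     - m * aa * ((- N * c2 * psC v + (N + 1) * s2 * phC v) * (tC w - zC w)
               + (- N * c2 * psC w + (N + 1) * s2 * phC w) * (tC v - zC v))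
     - aa * \<eta> * m * ((c2 * psC v + s2 * phC v) * zC w + (c2 * psC w + s2 * phC w) * zC v))"

lemma line_element_eq:
  assumes "f p \<noteq> 0"
  shows "hf p * line_element p v = G p v v"
proof -
  define r2 c2 s2 where "r2 = (rC p)\<^sup>2" and "c2 = (cos (thC p))\<^sup>2" and "s2 = (sin (thC p))\<^sup>2"
  have s2: "s2 + c2 = 1" by (simp add: s2_def c2_def)
  have f: "f p = r2 + k * ((N + 1) * c2 - N * s2)" by (simp add: f_eq \<nu>_def r2_def c2_def s2_def)
  have hf: "hf p \<noteq> 0" using hf_pos[of p] by simp
  have 1: "hf p * h p = (f p + Qs) + m\<^sup>2 / f p"
    using assms hf_sq[of p] by (simp add: h_def power2_eq_square field_simps)
  have \<gamma>: "\<gamma>1\<^sup>2 - \<gamma>2\<^sup>2 = aa * (\<gamma>1 - \<gamma>2)" using \<gamma>_sum(1) by (simp add: power2_eq_square algebra_simps flip: \<gamma>_sum(1))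
  have QQ: "x * Q1 * Q2 = x * m\<^sup>2" for x by (simp add: m_sq)
  have 2: "hf p * (h p * (r2 + \<gamma>1 * (\<gamma>1 + \<gamma>2) * \<eta> - (\<gamma>1\<^sup>2 - \<gamma>2\<^sup>2) * \<eta> * Q1 * Q2 * c2 / (hf p)\<^sup>2))
       = (f p + Qs) * (r2 - k * N) + m\<^sup>2"
  proof -
    have "hf p * (h p * (r2 + \<gamma>1 * (\<gamma>1 + \<gamma>2) * \<eta> - (\<gamma>1\<^sup>2 - \<gamma>2\<^sup>2) * \<eta> * Q1 * Q2 * c2 / (hf p)\<^sup>2))
      = (hf p * h p) * (r2 - k * N) + (2 * N + 1) * k * m\<^sup>2 * c2 / f p"
      unfolding QQ using assms hf by (simp add: h_def \<gamma> \<gamma>_sum k_def power2_eq_square field_simps)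
    also have "\<dots> = (f p + Qs) * (r2 - k * N) + m\<^sup>2 * (r2 - k * N + (2 * N + 1) * k * c2) / f p"
      unfolding 1 using assms by (simp add: field_simps)
    also have "r2 - k * N + (2 * N + 1) * k * c2 = f p"
      unfolding f using s2 by algebra
    finally show ?thesis using assms by simp
  qed
  have 3: "hf p * (h p * (r2 + \<gamma>2 * (\<gamma>1 + \<gamma>2) * \<eta> + (\<gamma>1\<^sup>2 - \<gamma>2\<^sup>2) * \<eta> * Q1 * Q2 * s2 / (hf p)\<^sup>2))
       = (f p + Qs) * (r2 + k * (N + 1)) + m\<^sup>2"
  proof -
    have "hf p * (h p * (r2 + \<gamma>2 * (\<gamma>1 + \<gamma>2) * \<eta> + (\<gamma>1\<^sup>2 - \<gamma>2\<^sup>2) * \<eta> * Q1 * Q2 * s2 / (hf p)\<^sup>2))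
      = (hf p * h p) * (r2 + k * (N + 1)) - (2 * N + 1) * k * m\<^sup>2 * s2 / f p"
      unfolding QQ using assms hf by (simp add: h_def \<gamma> \<gamma>_sum k_def power2_eq_square field_simps)
    also have "\<dots> = (f p + Qs) * (r2 + k * (N + 1)) + m\<^sup>2 * (r2 + k * (N + 1) - (2 * N + 1) * k * s2) / f p"
      unfolding 1 using assms by (simp add: field_simps)
    also have "r2 + k * (N + 1) - (2 * N + 1) * k * s2 = f p"
      unfolding f using s2 by algebra
    finally show ?thesis using assms by simp
  qed
  have 4: "hf p * (1 / h p) = f p" using hf by (simp add: h_def)
  have 5: "(\<gamma>1 + \<gamma>2)\<^sup>2 * \<eta> = k" by (simp only: \<gamma>_sum(1) k_def)
  define P1 where "P1 = h p * (r2 + \<gamma>1 * (\<gamma>1 + \<gamma>2) * \<eta> - (\<gamma>1\<^sup>2 - \<gamma>2\<^sup>2) * \<eta> * Q1 * Q2 * c2 / (hf p)\<^sup>2)"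
  define P2 where "P2 = h p * (r2 + \<gamma>2 * (\<gamma>1 + \<gamma>2) * \<eta> + (\<gamma>1\<^sup>2 - \<gamma>2\<^sup>2) * \<eta> * Q1 * Q2 * s2 / (hf p)\<^sup>2)"
  define d where "d = (rC v)\<^sup>2 / (r2 + k)"
  have "line_element p v =
     - (1 / h p) * ((tC v)\<^sup>2 - (zC v)\<^sup>2) + Qp / hf p * (tC v - zC v)\<^sup>2
     + hf p * (d + (thC v)\<^sup>2) + P1 * c2 * (psC v)\<^sup>2 + P2 * s2 * (phC v)\<^sup>2
     + Qp * (\<gamma>1 + \<gamma>2)\<^sup>2 * \<eta>\<^sup>2 / hf p * (c2 * psC v + s2 * phC v)\<^sup>2
     - 2 * m / hf p * (\<gamma>1 * c2 * psC v + \<gamma>2 * s2 * phC v) * (tC v - zC v)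
     - 2 * (\<gamma>1 + \<gamma>2) * \<eta> * m / hf p * (c2 * psC v + s2 * phC v) * zC v"
    unfolding line_element_def Let_def r2_def c2_def s2_def m_def 5 P1_def P2_def d_def by (rule refl)
  then have "hf p * line_element p v =
     - (hf p * (1 / h p)) * ((tC v)\<^sup>2 - (zC v)\<^sup>2) + Qp * (tC v - zC v)\<^sup>2
     + (hf p)\<^sup>2 * (d + (thC v)\<^sup>2) + (hf p * P1) * c2 * (psC v)\<^sup>2 + (hf p * P2) * s2 * (phC v)\<^sup>2
     + Qp * (\<gamma>1 + \<gamma>2)\<^sup>2 * \<eta>\<^sup>2 * (c2 * psC v + s2 * phC v)\<^sup>2
     - 2 * m * (\<gamma>1 * c2 * psC v + \<gamma>2 * s2 * phC v) * (tC v - zC v)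
     - 2 * (\<gamma>1 + \<gamma>2) * \<eta> * m * (c2 * psC v + s2 * phC v) * zC v"
  proof -
    define ih u where "ih = inverse (hf p)" and "u = 1 / h p"
    have 6: "hf p * ih = 1" and 7: "x / hf p = x * ih" for x
      using hf by (simp_all add: ih_def divide_inverse)
    assume "line_element p v =
     - (1 / h p) * ((tC v)\<^sup>2 - (zC v)\<^sup>2) + Qp / hf p * (tC v - zC v)\<^sup>2
     + hf p * (d + (thC v)\<^sup>2) + P1 * c2 * (psC v)\<^sup>2 + P2 * s2 * (phC v)\<^sup>2
     + Qp * (\<gamma>1 + \<gamma>2)\<^sup>2 * \<eta>\<^sup>2 / hf p * (c2 * psC v + s2 * phC v)\<^sup>2
     - 2 * m / hf p * (\<gamma>1 * c2 * psC v + \<gamma>2 * s2 * phC v) * (tC v - zC v)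
     - 2 * (\<gamma>1 + \<gamma>2) * \<eta> * m / hf p * (c2 * psC v + s2 * phC v) * zC v"
    then show ?thesis
      unfolding 7 u_def[symmetric] using 6 by algebra
  qed
  also have "\<dots> = G p v v"
    unfolding 2[folded P1_def] 3[folded P2_def] 4 G_def Let_def r2_def[symmetric] c2_def[symmetric]
      s2_def[symmetric] \<gamma>_sum(1) \<gamma>_sum(2,3) d_def k_def
    by (simp add: power2_eq_square algebra_simps)
  finally show ?thesis .
qed

lemma G_eq:
  assumes "f p \<noteq> 0"
  shows "hf p * g p v w = G p v w"
proof -
  have "hf p * g p v w = (G p (v + w) (v + w) - G p v v - G p w w) / 2"
    unfolding g_def using line_element_eq[OF assms] by (simp add: algebra_simps flip: line_element_eq[OF assms])
  also have "\<dots> = G p v w"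
  proof -
    have "G p (v + w) (v + w) - G p v v - G p w w = 2 * G p v w"
      unfolding G_def Let_def divide_inverse by (simp add: algebra_simps)
    then show ?thesis by simp
  qed
  finally show ?thesis .
qed

text \<open>
  The inverse metric separates: with \<open>V = T + Z\<close> null, \<open>X = Rz Z - n \<Phi> + (n + 1) \<Psi>\<close> the generator of
  the circles that collapse at \<open>r = 0\<close>, and \<open>Y = (Rz / \<eta>) V + \<Phi> + \<Psi> - X\<close>, the form \<open>hf g\<^sup>-\<^sup>1\<close> is diagonal
  up to multiples of \<open>V\<^sup>2\<close>, \<open>X\<^sup>2\<close> and \<open>Y\<^sup>2\<close>.
\<close>

definition Xf :: "spatial option \<Rightarrow> real" where
  "Xf i = (if i = Some Zed then Rz else if i = Some Phi then - N else if i = Some Psi then N + 1 else 0)"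

definition Yf :: "spatial option \<Rightarrow> real" where
  "Yf i = (if i = None then Rz / \<eta> else if i = Some Zed then Rz * (1 / \<eta> - 1)
     else if i = Some Phi then N + 1 else if i = Some Psi then - N else 0)"

definition Vf :: "spatial option \<Rightarrow> real" where
  "Vf i = (if i = None \<or> i = Some Zed then 1 else 0)"

definition Hdiag :: "coords \<Rightarrow> spatial option \<Rightarrow> real" where
  "Hdiag p i = (case i of None \<Rightarrow> - (f p + Qs) | Some Rad \<Rightarrow> (rC p)\<^sup>2 + k | Some Theta \<Rightarrow> 1
     | Some Phi \<Rightarrow> 1 / (sin (thC p))\<^sup>2 | Some Psi \<Rightarrow> 1 / (cos (thC p))\<^sup>2 | Some Zed \<Rightarrow> f p + Qs)"

definition Hm :: "coords \<Rightarrow> spatial option \<Rightarrow> spatial option \<Rightarrow> real" where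
  "Hm p i j = (if i = j then Hdiag p i else 0)
     - Qp * Vf i * Vf j + k / (rC p)\<^sup>2 * Xf i * Xf j - k / ((rC p)\<^sup>2 + k) * Yf i * Yf j"

lemma Hm_sym: "Hm p i j = Hm p j i"
  by (auto simp: Hm_def mult_ac)

lemma sum_Hm:
  "(\<Sum>l\<in>UNIV. x l * Hm p l j) =
     x j * Hdiag p j
     - Qp * (\<Sum>l\<in>UNIV. x l * Vf l) * Vf j + k / (rC p)\<^sup>2 * (\<Sum>l\<in>UNIV. x l * Xf l) * Xf j
     - k / ((rC p)\<^sup>2 + k) * (\<Sum>l\<in>UNIV. x l * Yf l) * Yf j"
proof -
  have "x l * Hm p l j = (if l = j then x j * Hdiag p j else 0) - Qp * Vf j * (x l * Vf l)
      + k / (rC p)\<^sup>2 * Xf j * (x l * Xf l) - k / ((rC p)\<^sup>2 + k) * Yf j * (x l * Yf l)" for l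
    by (simp add: Hm_def algebra_simps)
  then show ?thesis
    by (simp only: sum.distrib sum_subtractf sum_distrib_left[symmetric]) (simp add: mult_ac)
qed

lemma G_inverse_components:
  fixes vt vz vp vs :: real
  assumes "rC p > 0" "sin (thC p) \<noteq> 0" "cos (thC p) \<noteq> 0"
  defines "r2 \<equiv> (rC p)\<^sup>2" and "c2 \<equiv> (cos (thC p))\<^sup>2" and "s2 \<equiv> (sin (thC p))\<^sup>2" and "F \<equiv> f p"
  defines "xt \<equiv> - F * vt + Qp * (vt - vz) - m * aa * (- N * c2 * vs + (N + 1) * s2 * vp)"
    and "xz \<equiv> F * vz - Qp * (vt - vz) + m * aa * (- N * c2 * vs + (N + 1) * s2 * vp)
               - aa * \<eta> * m * (c2 * vs + s2 * vp)"
    and "xp \<equiv> s2 * (((F + Qs) * (r2 + k * (N + 1)) + m\<^sup>2) * vp + Qp * k * \<eta> * (c2 * vs + s2 * vp)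
               - m * aa * (N + 1) * (vt - vz) - aa * \<eta> * m * vz)"
    and "xs \<equiv> c2 * (((F + Qs) * (r2 - k * N) + m\<^sup>2) * vs + Qp * k * \<eta> * (c2 * vs + s2 * vp)
               + m * aa * N * (vt - vz) - aa * \<eta> * m * vz)"
    and "X \<equiv> Rz * vz - s2 * (N * (F + Qs) + \<eta> * Qp) * vp + c2 * ((N + 1) * (F + Qs) - \<eta> * Qp) * vs"
    and "Y \<equiv> - (Rz / \<eta>) * vt + Rz * (1 / \<eta> - 1) * vz + s2 * ((N + 1) * (F + Qs) + \<eta> * Qp) * vp
               + c2 * (\<eta> * Qp - N * (F + Qs)) * vs"
  shows "Rz * xz - N * xp + (N + 1) * xs = r2 * X"
    and "Rz / \<eta> * xt + Rz * (1 / \<eta> - 1) * xz + (N + 1) * xp - N * xs = (r2 + k) * Y"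
    and "- (F + Qs) * xt - Qp * (xt + xz) - k * (Rz / \<eta>) * Y = (hf p)\<^sup>2 * vt"
    and "(F + Qs) * xz - Qp * (xt + xz) + k * Rz * X - k * (Rz * (1 / \<eta> - 1)) * Y = (hf p)\<^sup>2 * vz"
    and "xp / s2 - k * N * X - k * (N + 1) * Y = (hf p)\<^sup>2 * vp"
    and "xs / c2 + k * (N + 1) * X + k * N * Y = (hf p)\<^sup>2 * vs"
proof -
  define e where "e = 1 / \<eta>"
  have e: "e * \<eta> = 1" using basic_pos by (simp add: e_def)
  have s2: "s2 = 1 - c2" by (simp add: s2_def c2_def sin_squared_eq)
  have r2: "r2 = F - k * ((N + 1) * c2 - N * s2)"
    by (simp add: F_def r2_def f_eq \<nu>_def c2_def s2_def)
  have hf2: "(hf p)\<^sup>2 = F\<^sup>2 + Qs * F + m\<^sup>2" by (simp add: hf_sq F_def)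
  have nz: "s2 \<noteq> 0" "c2 \<noteq> 0" using assms by (auto simp: s2_def c2_def)
  have inv: "Rz / \<eta> = Rz * e" "1 / \<eta> = e" by (simp_all add: e_def)
  have E: "e * m\<^sup>2 = m\<^sup>2 + Qs * Qp" using \<eta>_eq e by algebra
  have kk: "k = aa\<^sup>2 * \<eta>" by (simp add: k_def)
  have QQ: "Qp = aa\<^sup>2 * N * (N + 1)" by (simp add: Qp_def)
  have mm: "m = aa * Rz" by (simp add: aa_Rz)
  show "Rz * xz - N * xp + (N + 1) * xs = r2 * X"
    unfolding xz_def xp_def xs_def X_def using s2 r2 e E kk QQ mm by algebra
  show "Rz / \<eta> * xt + Rz * (1 / \<eta> - 1) * xz + (N + 1) * xp - N * xs = (r2 + k) * Y"
    unfolding xt_def xz_def xp_def xs_def Y_def inv using s2 r2 e E kk QQ mm by algebra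
  show "- (F + Qs) * xt - Qp * (xt + xz) - k * (Rz / \<eta>) * Y = (hf p)\<^sup>2 * vt"
    unfolding xt_def xz_def Y_def inv hf2 using s2 e E kk QQ mm by algebra
  show "(F + Qs) * xz - Qp * (xt + xz) + k * Rz * X - k * (Rz * (1 / \<eta> - 1)) * Y = (hf p)\<^sup>2 * vz"
    unfolding xt_def xz_def X_def Y_def inv hf2 using s2 e E kk QQ mm by algebra
  have 1: "xp / s2 = ((F + Qs) * (r2 + k * (N + 1)) + m\<^sup>2) * vp + Qp * k * \<eta> * (c2 * vs + s2 * vp)
               - m * aa * (N + 1) * (vt - vz) - aa * \<eta> * m * vz"
    using nz by (simp add: xp_def)
  show "xp / s2 - k * N * X - k * (N + 1) * Y = (hf p)\<^sup>2 * vp"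
    unfolding 1 X_def Y_def inv hf2 using s2 r2 e E kk QQ mm by algebra
  have 2: "xs / c2 = ((F + Qs) * (r2 - k * N) + m\<^sup>2) * vs + Qp * k * \<eta> * (c2 * vs + s2 * vp)
               + m * aa * N * (vt - vz) - aa * \<eta> * m * vz"
    using nz by (simp add: xs_def)
  show "xs / c2 + k * (N + 1) * X + k * N * Y = (hf p)\<^sup>2 * vs"
    unfolding 2 X_def Y_def inv hf2 using s2 r2 e E kk QQ mm by algebra
qed

lemma regular_nz:
  assumes "p \<in> regular"
  shows "rC p > 0" "sin (thC p) > 0" "cos (thC p) > 0" "f p \<noteq> 0"
  using assms by (auto simp: regular_def intro!: sin_gt_zero cos_gt_zero)

lemma g_eq: "p \<in> regular \<Longrightarrow> g p v w = G p v w / hf p"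
  using G_eq[of p v w] regular_nz(4)[of p] hf_pos[of p] by (simp add: field_simps)

lemma G_Hm:
  assumes p: "p \<in> regular"
  shows "(\<Sum>l\<in>UNIV. G p v (axis l 1) * Hm p l j) = (hf p)\<^sup>2 * v $ j"
proof -
  note nz = regular_nz[OF p]
  have rk: "(rC p)\<^sup>2 + k > 0" using basic_pos by (simp add: add_nonneg_pos)
  note aux = G_inverse_components[where p = p and vt = "tC v" and vz = "zC v" and vp = "phC v" and vs = "psC v", OF nz(1)]
  have nz': "sin (thC p) \<noteq> 0" "cos (thC p) \<noteq> 0" "(rC p)\<^sup>2 \<noteq> 0" "(rC p)\<^sup>2 + k \<noteq> 0" using nz rk by auto
  note A = aux[OF nz'(1,2)]
  define xt xz xp xs where "xt = G p v (axis None 1)" and "xz = G p v (axis (Some Zed) 1)"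
    and "xp = G p v (axis (Some Phi) 1)" and "xs = G p v (axis (Some Psi) 1)"
  have comp: "xt = - f p * tC v + Qp * (tC v - zC v)
      - m * aa * (- N * (cos (thC p))\<^sup>2 * psC v + (N + 1) * (sin (thC p))\<^sup>2 * phC v)"
    "xz = f p * zC v - Qp * (tC v - zC v)
      + m * aa * (- N * (cos (thC p))\<^sup>2 * psC v + (N + 1) * (sin (thC p))\<^sup>2 * phC v)
      - aa * \<eta> * m * ((cos (thC p))\<^sup>2 * psC v + (sin (thC p))\<^sup>2 * phC v)"
    "xp = (sin (thC p))\<^sup>2 * (((f p + Qs) * ((rC p)\<^sup>2 + k * (N + 1)) + m\<^sup>2) * phC v
      + Qp * k * \<eta> * ((cos (thC p))\<^sup>2 * psC v + (sin (thC p))\<^sup>2 * phC v)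
      - m * aa * (N + 1) * (tC v - zC v) - aa * \<eta> * m * zC v)"
    "xs = (cos (thC p))\<^sup>2 * (((f p + Qs) * ((rC p)\<^sup>2 - k * N) + m\<^sup>2) * psC v
      + Qp * k * \<eta> * ((cos (thC p))\<^sup>2 * psC v + (sin (thC p))\<^sup>2 * phC v)
      + m * aa * N * (tC v - zC v) - aa * \<eta> * m * zC v)"
    "G p v (axis (Some Rad) 1) * ((rC p)\<^sup>2 + k) = (hf p)\<^sup>2 * rC v"
    "G p v (axis (Some Theta) 1) = (hf p)\<^sup>2 * thC v"
    unfolding xt_def xz_def xp_def xs_def G_def Let_def
    using nz'(4) by (simp_all add: axis_def algebra_simps) (simp_all add: field_simps)
  note B = A[folded comp(1) comp(2) comp(3) comp(4)]
  have sX: "(\<Sum>l\<in>UNIV. G p v (axis l 1) * Xf l) = Rz * xz - N * xp + (N + 1) * xs"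
    and sY: "(\<Sum>l\<in>UNIV. G p v (axis l 1) * Yf l) = Rz / \<eta> * xt + Rz * (1 / \<eta> - 1) * xz + (N + 1) * xp - N * xs"
    and sV: "(\<Sum>l\<in>UNIV. G p v (axis l 1) * Vf l) = xt + xz"
    unfolding sum_coords xt_def xz_def xp_def xs_def by (simp_all add: Xf_def Yf_def Vf_def algebra_simps)
  have c1: "k / r * (r * z) * y = k * z * y" if "r \<noteq> 0" for r z y :: real using that by simp
  from B obtain X Y where C: "Rz * xz - N * xp + (N + 1) * xs = (rC p)\<^sup>2 * X"
    "Rz / \<eta> * xt + Rz * (1 / \<eta> - 1) * xz + (N + 1) * xp - N * xs = ((rC p)\<^sup>2 + k) * Y"
    "- (f p + Qs) * xt - Qp * (xt + xz) - k * (Rz / \<eta>) * Y = (hf p)\<^sup>2 * tC v"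
    "(f p + Qs) * xz - Qp * (xt + xz) + k * Rz * X - k * (Rz * (1 / \<eta> - 1)) * Y = (hf p)\<^sup>2 * zC v"
    "xp / (sin (thC p))\<^sup>2 - k * N * X - k * (N + 1) * Y = (hf p)\<^sup>2 * phC v"
    "xs / (cos (thC p))\<^sup>2 + k * (N + 1) * X + k * N * Y = (hf p)\<^sup>2 * psC v"
    by blast
  show ?thesis
    unfolding sum_Hm sX sY sV C(1,2) c1[OF nz'(3)] c1[OF nz'(4)]
  proof (cases j)
    case None
    then show "G p v (axis j 1) * Hdiag p j
      - Qp * (xt + xz) * Vf j + k * X * Xf j - k * Y * Yf j = (hf p)\<^sup>2 * v $ j"
      using C(3) by (simp add: Hdiag_def Vf_def Xf_def Yf_def xt_def algebra_simps)
  next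
    case (Some i)
    then show "G p v (axis j 1) * Hdiag p j
      - Qp * (xt + xz) * Vf j + k * X * Xf j - k * Y * Yf j = (hf p)\<^sup>2 * v $ j"
      using C(4-6) nz'(4) comp(5,6)
      by (cases i) (simp_all add: Hdiag_def Vf_def Xf_def Yf_def xz_def xp_def xs_def algebra_simps)
  qed
qed

definition g_inv :: "coords \<Rightarrow> real ^ (spatial option) ^ (spatial option)" where
  "g_inv p = (\<chi> i j. Hm p i j / hf p)"

lemma G_sym: "G p v w = G p w v"
  unfolding G_def Let_def by (simp add: algebra_simps)

lemma g_matrix_inverse:
  assumes "p \<in> regular"
  shows "g_matrix p ** g_inv p = mat 1" "g_inv p ** g_matrix p = mat 1" "matrix_inv (g_matrix p) = g_inv p"
proof -
  have "(g_matrix p ** g_inv p) $ i $ j = (mat 1 :: real ^ (spatial option) ^ (spatial option)) $ i $ j" for i j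
  proof -
    have "(g_matrix p ** g_inv p) $ i $ j = (\<Sum>l\<in>UNIV. G p (axis i 1) (axis l 1) * Hm p l j) / (hf p)\<^sup>2"
      unfolding matrix_matrix_mult_def g_matrix_def g_inv_def
      by (simp add: g_eq[OF assms] sum_divide_distrib power2_eq_square)
    also have "\<dots> = axis i 1 $ j"
      using G_Hm[OF assms, of "axis i 1" j] hf_pos[of p] by simp
    finally show ?thesis by (simp add: mat_def axis_def)
  qed
  then show 1: "g_matrix p ** g_inv p = mat 1" by (simp add: vec_eq_iff)
  then show 2: "g_inv p ** g_matrix p = mat 1" by (simp add: matrix_left_right_inverse)
  have "g_matrix p ** matrix_inv (g_matrix p) = mat 1"
    using someI[where P = "\<lambda>B. g_matrix p ** B = mat 1 \<and> B ** g_matrix p = mat 1", of "g_inv p"] 1 2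
    unfolding matrix_inv_def by blast
  then have "g_inv p ** (g_matrix p ** matrix_inv (g_matrix p)) = g_inv p" by simp
  then show "matrix_inv (g_matrix p) = g_inv p"
    by (simp add: matrix_mul_assoc 2)
qed

end

section \<open>Determinants\<close>

lemma det_option:
  fixes A :: "real ^ ('n::finite option) ^ ('n option)"
  assumes "\<And>j. A $ None $ Some j = 0"
  shows "det A = A $ None $ None * det ((\<chi> i j. A $ Some i $ Some j) :: real ^ 'n ^ 'n)"
proof -
  let ?S = "range (Some :: 'n \<Rightarrow> 'n option)"
  have U: "(UNIV :: 'n option set) = insert None ?S" by (rule UNIV_option_conv)
  have bij: "bij_betw (Some :: 'n \<Rightarrow> 'n option) UNIV ?S" by (simp add: bij_betw_def)
  have inv: "bij_betw (inv_into UNIV (Some :: 'n \<Rightarrow> 'n option)) ?S UNIV"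
    by (rule bij_betw_inv_into[OF bij])
  let ?\<Phi> = "map_permutation (UNIV :: 'n set) (Some :: 'n \<Rightarrow> 'n option)"
  have c: "?\<Phi> (map_permutation ?S (inv_into UNIV Some) s) = s" if "s permutes ?S" for s
    using that by (intro map_permutation_compose_inv[where B = UNIV] inv) (auto simp: f_inv_into_f)
  have "det A = (\<Sum>b\<in>insert None ?S. \<Sum>s | s permutes ?S.
      of_int (sign (Transposition.transpose None b \<circ> s)) *
      (\<Prod>i\<in>UNIV. A $ i $ (Transposition.transpose None b \<circ> s) i))"
    unfolding det_def by (subst (1) U, subst sum_over_permutations_insert) auto
  also have "\<dots> = (\<Sum>b\<in>{None}. \<Sum>s | s permutes ?S.
      of_int (sign (Transposition.transpose None b \<circ> s)) *
      (\<Prod>i\<in>UNIV. A $ i $ (Transposition.transpose None b \<circ> s) i))"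
  proof (rule sum.mono_neutral_right)
    show "\<forall>b\<in>insert None ?S - {None}. (\<Sum>s | s permutes ?S.
      of_int (sign (Transposition.transpose None b \<circ> s)) *
      (\<Prod>i\<in>UNIV. A $ i $ (Transposition.transpose None b \<circ> s) i)) = 0"
    proof (intro ballI sum.neutral)
      fix b s assume b: "b \<in> insert None ?S - {None}" and "s \<in> {s. s permutes ?S}"
      then have "s None = None" by (auto simp: permutes_def)
      then have "(Transposition.transpose None b \<circ> s) None = b" by simp
      with b assms have "A $ None $ (Transposition.transpose None b \<circ> s) None = 0" by auto
      then have "(\<Prod>i\<in>UNIV. A $ i $ (Transposition.transpose None b \<circ> s) i) = 0"
        by (intro prod_zero) auto
      then show "of_int (sign (Transposition.transpose None b \<circ> s)) *
        (\<Prod>i\<in>UNIV. A $ i $ (Transposition.transpose None b \<circ> s) i) = 0" by simp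
    qed
  qed auto
  also have "\<dots> = (\<Sum>s | s permutes ?S. of_int (sign s) * (\<Prod>i\<in>UNIV. A $ i $ s i))"
    by simp
  also have "\<dots> = (\<Sum>s | s permutes (UNIV :: 'n set). of_int (sign (?\<Phi> s)) * (\<Prod>i\<in>UNIV. A $ i $ ?\<Phi> s i))"
  proof (rule sum.reindex_bij_witness[where i = ?\<Phi> and j = "map_permutation ?S (inv_into UNIV Some)"])
    fix s assume s: "s \<in> {s. s permutes ?S}"
    show "?\<Phi> (map_permutation ?S (inv_into UNIV Some) s) = s"
      using s c by simp
    show "map_permutation ?S (inv_into UNIV Some) s \<in> {s. s permutes UNIV}"
      using s map_permutation_permutes[OF inv, of s] by simp
  next
    fix s :: "'n \<Rightarrow> 'n" assume s: "s \<in> {s. s permutes UNIV}"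
    show "map_permutation ?S (inv_into UNIV Some) (?\<Phi> s) = s"
      using s by (intro map_permutation_compose_inv[OF bij]) auto
    show "?\<Phi> s \<in> {s. s permutes ?S}"
      using s map_permutation_permutes[OF bij, of s] by simp
  qed (simp add: c)
  also have "\<dots> = (\<Sum>s | s permutes (UNIV :: 'n set). A $ None $ None * (of_int (sign s) * (\<Prod>i\<in>UNIV. A $ Some i $ Some (s i))))"
  proof (intro sum.cong refl)
    fix s :: "'n \<Rightarrow> 'n" assume s: "s \<in> {s. s permutes UNIV}"
    have "sign (?\<Phi> s) = sign s"
      using s by (intro sign_map_permutation) auto
    moreover have "?\<Phi> s None = None" by (simp add: map_permutation_def restrict_id_def)
    moreover have "?\<Phi> s (Some i) = Some (s i)" for i by (simp add: map_permutation_apply)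
    moreover have "(\<Prod>i\<in>UNIV. A $ i $ ?\<Phi> s i) = A $ None $ ?\<Phi> s None * (\<Prod>i\<in>UNIV. A $ Some i $ ?\<Phi> s (Some i))"
      unfolding U by (simp add: prod.reindex)
    ultimately show "of_int (sign (?\<Phi> s)) * (\<Prod>i\<in>UNIV. A $ i $ ?\<Phi> s i)
      = A $ None $ None * (of_int (sign s) * (\<Prod>i\<in>UNIV. A $ Some i $ Some (s i)))"
      by simp
  qed
  also have "\<dots> = A $ None $ None * det ((\<chi> i j. A $ Some i $ Some j) :: real ^ 'n ^ 'n)"
    unfolding det_def by (simp add: sum_distrib_left)
  finally show ?thesis .
qed

lemma det_spatial_block:
  fixes A :: "real ^ spatial ^ spatial"
  assumes "\<And>j. j \<noteq> Rad \<Longrightarrow> A $ Rad $ j = 0" "\<And>j. j \<noteq> Theta \<Longrightarrow> A $ Theta $ j = 0"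
  shows "det A = A $ Rad $ Rad * A $ Theta $ Theta *
    (A $ Phi $ Phi * (A $ Psi $ Psi * A $ Zed $ Zed - A $ Psi $ Zed * A $ Zed $ Psi)
     - A $ Phi $ Psi * (A $ Psi $ Phi * A $ Zed $ Zed - A $ Psi $ Zed * A $ Zed $ Phi)
     + A $ Phi $ Zed * (A $ Psi $ Phi * A $ Zed $ Psi - A $ Psi $ Psi * A $ Zed $ Phi))"
proof -
  have f: "finite {Theta, Phi, Psi, Zed}" "Rad \<notin> {Theta, Phi, Psi, Zed}"
    "finite {Phi, Psi, Zed}" "Theta \<notin> {Phi, Psi, Zed}"
    "finite {Psi, Zed}" "Phi \<notin> {Psi, Zed}" "finite {Zed}" "Psi \<notin> {Zed}" by auto
  show ?thesis
    unfolding det_def UNIV_spatial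
    unfolding sum_over_permutations_insert[OF f(1,2)] sum_over_permutations_insert[OF f(3,4)]
      sum_over_permutations_insert[OF f(5,6)] sum_over_permutations_insert[OF f(7,8)]
    unfolding permutes_sing
    by (simp add: assms sign_swap_id permutation_swap_id permutation_compose sign_compose sign_id
        swap_id_eq) (simp add: algebra_simps)
qed

lemma det_inverse_minor:
  fixes A B :: "real ^ ('n::finite option) ^ ('n option)"
  assumes "A ** B = mat 1"
  shows "det A * B $ None $ None = det ((\<chi> i j. A $ Some i $ Some j) :: real ^ 'n ^ 'n)"
proof -
  define Q :: "real ^ ('n option) ^ ('n option)" where
    "Q = (\<chi> i j. if j = None then B $ i $ None else if i = j then 1 else 0)"
  have "(\<chi> i j. Q $ Some i $ Some j) = (mat 1 :: real ^ 'n ^ 'n)"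
    by (simp add: Q_def mat_def vec_eq_iff)
  then have Q: "det Q = B $ None $ None"
    by (subst det_option) (simp_all add: Q_def)
  have AQ: "(A ** Q) $ i $ j = (if j = None then axis None 1 $ i else A $ i $ j)" for i j
  proof (cases j)
    case None
    have "(A ** Q) $ i $ None = (A ** B) $ i $ None"
      by (simp add: matrix_matrix_mult_def Q_def)
    then show ?thesis using assms None by (simp add: mat_def axis_def eq_commute)
  next
    case (Some l)
    have "(A ** Q) $ i $ j = (\<Sum>l\<in>UNIV. A $ i $ l * (if l = j then 1 else 0))"
      using Some by (simp add: matrix_matrix_mult_def Q_def)
    then show ?thesis using Some by (simp add: if_distrib sum.delta cong: if_cong)
  qed
  have "det (A ** Q) = det (transpose (A ** Q))" by simp
  also have "\<dots> = det ((\<chi> i j. transpose (A ** Q) $ Some i $ Some j) :: real ^ 'n ^ 'n)"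
    by (subst det_option) (simp_all add: transpose_def AQ axis_def)
  also have "(\<chi> i j. transpose (A ** Q) $ Some i $ Some j)
      = transpose ((\<chi> i j. A $ Some i $ Some j) :: real ^ 'n ^ 'n)"
    by (simp add: transpose_def AQ vec_eq_iff)
  finally show ?thesis by (simp add: det_mul Q)
qed

context three_charge_microstate
begin

definition S :: "coords \<Rightarrow> real" where
  "S p = f p + Qs + Qp + m\<^sup>2 / (\<eta> * ((rC p)\<^sup>2 + k))"

definition wt :: "coords \<Rightarrow> real" where
  "wt p = rC p * (sin (thC p) * cos (thC p))"

lemma rk_pos: "(rC p)\<^sup>2 + k > 0"
  using basic_pos by (simp add: add_nonneg_pos)

lemma Hm_None: "Hm p None None = - S p"
proof -
  have "k * Rz\<^sup>2 / (\<eta>\<^sup>2 * ((rC p)\<^sup>2 + k)) = m\<^sup>2 / (\<eta> * ((rC p)\<^sup>2 + k))"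
    unfolding k_Rz(1) using basic_pos by (simp add: power2_eq_square)
  then show ?thesis
    by (simp add: Hm_def Hdiag_def S_def Vf_def Xf_def Yf_def power2_eq_square mult_ac)
qed

lemma det_g_bar:
  assumes p: "p \<in> regular"
  shows "det ((\<chi> i j. g_bar p (axis i 1) (axis j 1)) :: real ^ spatial ^ spatial) = (wt p)\<^sup>2 * hf p * S p"
proof -
  define r2 c2 s2 where "r2 = (rC p)\<^sup>2" and "c2 = (cos (thC p))\<^sup>2" and "s2 = (sin (thC p))\<^sup>2"
  define F where "F = f p"
  have s2: "s2 = 1 - c2" by (simp add: s2_def c2_def sin_squared_eq)
  have r2: "r2 = F - k * ((N + 1) * c2 - N * s2)"
    by (simp add: F_def r2_def f_eq \<nu>_def c2_def s2_def)
  have hf: "hf p > 0" by (rule hf_pos)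
  have rk: "r2 + k > 0" using rk_pos[of p] by (simp add: r2_def)
  have ax: "on_slice 0 (axis i 1) = axis (Some i) 1" for i
    by (auto simp: on_slice_def vec_eq_iff axis_def split: option.splits)
  have gb: "g_bar p (axis i 1) (axis j 1) = G p (axis (Some i) 1) (axis (Some j) 1) / hf p" for i j
    by (simp add: g_bar_def ax g_eq[OF p])
  let ?G = "\<lambda>i j. G p (axis (Some i) 1) (axis (Some j) 1)"
  have G: "?G Rad Rad = (hf p)\<^sup>2 / (r2 + k)" "?G Theta Theta = (hf p)\<^sup>2"
    "?G Phi Phi = s2 * ((F + Qs) * (r2 + k * (N + 1)) + m\<^sup>2) + Qp * k * \<eta> * s2\<^sup>2"
    "?G Psi Psi = c2 * ((F + Qs) * (r2 - k * N) + m\<^sup>2) + Qp * k * \<eta> * c2\<^sup>2"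
    "?G Zed Zed = F + Qp"
    "?G Phi Psi = Qp * k * \<eta> * c2 * s2" "?G Psi Phi = Qp * k * \<eta> * c2 * s2"
    "?G Phi Zed = s2 * (m * aa * (N + 1) - aa * \<eta> * m)" "?G Zed Phi = s2 * (m * aa * (N + 1) - aa * \<eta> * m)"
    "?G Psi Zed = c2 * (- m * aa * N - aa * \<eta> * m)" "?G Zed Psi = c2 * (- m * aa * N - aa * \<eta> * m)"
    and G0: "\<And>j. j \<noteq> Rad \<Longrightarrow> ?G Rad j = 0" "\<And>j. j \<noteq> Theta \<Longrightarrow> ?G Theta j = 0"
    unfolding G_def Let_def
    by (simp_all add: r2_def c2_def s2_def F_def axis_def power2_eq_square algebra_simps)
  define D where "D = ?G Phi Phi * (?G Psi Psi * ?G Zed Zed - ?G Psi Zed * ?G Zed Psi)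
     - ?G Phi Psi * (?G Psi Phi * ?G Zed Zed - ?G Psi Zed * ?G Zed Phi)
     + ?G Phi Zed * (?G Psi Phi * ?G Zed Psi - ?G Psi Psi * ?G Zed Phi)"
  define e where "e = 1 / \<eta>"
  have e: "e * \<eta> = 1" using basic_pos by (simp add: e_def)
  have E: "e * m\<^sup>2 = m\<^sup>2 + Qs * Qp" using \<eta>_eq e by algebra
  have kk: "k = aa\<^sup>2 * \<eta>" by (simp add: k_def)
  have QQ: "Qp = aa\<^sup>2 * N * (N + 1)" by (simp add: Qp_def)
  have hf2: "(hf p)\<^sup>2 = F\<^sup>2 + Qs * F + m\<^sup>2" by (simp add: hf_sq F_def)
  have Sr: "S p * (r2 + k) = (F + Qs + Qp) * (r2 + k) + m\<^sup>2 * e"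
  proof -
    have "m\<^sup>2 / (\<eta> * ((rC p)\<^sup>2 + k)) * (r2 + k) = m\<^sup>2 * e"
      using rk by (simp add: r2_def e_def)
    then show ?thesis unfolding S_def F_def distrib_right[of _ _ "r2 + k"] by simp
  qed
  have "D = (hf p)\<^sup>2 * (r2 * s2 * c2) * ((F + Qs + Qp) * (r2 + k) + m\<^sup>2 * e)"
    unfolding D_def G hf2 using s2 r2 e E kk QQ by algebra
  then have D: "D = (hf p)\<^sup>2 * (wt p)\<^sup>2 * (S p * (r2 + k))"
    unfolding Sr by (simp add: wt_def r2_def s2_def c2_def power_mult_distrib)
  have "det ((\<chi> i j. g_bar p (axis i 1) (axis j 1)) :: real ^ spatial ^ spatial)
      = (hf p / (r2 + k)) * hf p * (D / (hf p) ^ 3)"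
  proof -
    define y where "y = inverse (hf p)"
    have y: "x / hf p = x * y" "D / (hf p) ^ 3 = D * y ^ 3" for x
      by (simp_all add: y_def divide_inverse power_inverse)
    have 1: "?G Rad Rad * y = hf p / (r2 + k)" "?G Theta Theta * y = hf p"
      using hf by (simp_all add: G y_def power2_eq_square)
    show ?thesis
    proof -
      define A :: "real ^ spatial ^ spatial" where "A = (\<chi> i j. ?G i j * y)"
      have A: "A $ i $ j = ?G i j * y" for i j by (simp add: A_def)
      have "A $ Phi $ Phi * (A $ Psi $ Psi * A $ Zed $ Zed - A $ Psi $ Zed * A $ Zed $ Psi)
       - A $ Phi $ Psi * (A $ Psi $ Phi * A $ Zed $ Zed - A $ Psi $ Zed * A $ Zed $ Phi)
       + A $ Phi $ Zed * (A $ Psi $ Phi * A $ Zed $ Psi - A $ Psi $ Psi * A $ Zed $ Phi) = D * y ^ 3"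
        unfolding A D_def by algebra
      moreover have "A $ Rad $ j = 0" if "j \<noteq> Rad" for j using that by (simp add: A G0)
      moreover have "A $ Theta $ j = 0" if "j \<noteq> Theta" for j using that by (simp add: A G0)
      ultimately have "det A = A $ Rad $ Rad * A $ Theta $ Theta * (D * y ^ 3)"
        by (simp add: det_spatial_block)
      also have "\<dots> = hf p / (r2 + k) * hf p * (D * y ^ 3)"
        unfolding A 1 ..
      finally show ?thesis unfolding gb y A_def .
    qed
  qed
  also have "\<dots> = (wt p)\<^sup>2 * hf p * S p"
    unfolding D using hf rk by (simp add: power2_eq_square power3_eq_cube)
  finally show ?thesis .
qed

lemma S_pos: "S p > 0"
proof -
  have "f p + Qs > 0" using f_plus_Q_pos[of p] Q2_pos by (simp add: Qs_def)
  then show ?thesis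
    using basic_pos rk_pos[of p] by (simp add: S_def add_pos_pos)
qed

lemma wt_pos: "p \<in> regular \<Longrightarrow> wt p > 0"
  using regular_nz[of p] by (simp add: wt_def)

lemma det_g:
  assumes p: "p \<in> regular"
  shows "sqrt \<bar>det (g_matrix p)\<bar> = wt p * hf p"
proof -
  have *: "(\<chi> i j. g_matrix p $ Some i $ Some j)
      = ((\<chi> i j. g_bar p (axis i 1) (axis j 1)) :: real ^ spatial ^ spatial)"
    by (auto simp: g_matrix_def g_bar_def on_slice_def vec_eq_iff axis_def split: option.splits
        intro!: arg_cong2[of _ _ _ _ "g p"])
  have "det (g_matrix p) * (- S p / hf p) = (wt p)\<^sup>2 * hf p * S p"
    using det_inverse_minor[OF g_matrix_inverse(1)[OF p]] det_g_bar[OF p]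
    unfolding * by (simp add: g_inv_def Hm_None)
  then have "S p * (det (g_matrix p) + (wt p * hf p)\<^sup>2) = 0"
    using hf_pos[of p] by (simp add: field_simps power2_eq_square)
  then have "det (g_matrix p) = - ((wt p * hf p)\<^sup>2)"
    using S_pos[of p] by simp
  then show ?thesis
    using wt_pos[OF p] hf_pos[of p] by simp
qed

lemma dvol_density_eq:
  assumes p: "p \<in> regular"
  shows "dvol_density p = wt p * sqrt (hf p * S p)"
  unfolding dvol_density_def det_g_bar[OF p]
  using wt_pos[OF p] hf_pos[of p] S_pos[of p] by (simp add: real_sqrt_mult)

end

section \<open>Orthonormal frames\<close>

lemma orthonormal_frame_expansion:
  fixes b :: "'a::euclidean_space \<Rightarrow> 'a \<Rightarrow> real"
  assumes b: "bilinear b" and X: "\<And>A B. A \<in> {1..DIM('a)} \<Longrightarrow> B \<in> {1..DIM('a)} \<Longrightarrow> b (X A) (X B) = (if A = B then 1 else 0)"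
  shows "b v v = (\<Sum>A\<in>{1..DIM('a)}. (b v (X A))\<^sup>2)"
proof -
  let ?I = "{1..DIM('a)}"
  have lin: "linear (\<lambda>v. b v w)" "linear (\<lambda>w. b v w)" for v w
    using b by (auto simp: bilinear_def)
  have comb: "b (\<Sum>A\<in>?I. c A *\<^sub>R X A) (X B) = c B" if "B \<in> ?I" for c B
  proof -
    have "b (\<Sum>A\<in>?I. c A *\<^sub>R X A) (X B) = (\<Sum>A\<in>?I. c A * (if A = B then 1 else 0))"
      using that X by (simp add: linear_sum[OF lin(1)] linear_cmul[OF lin(1)])
    then show ?thesis using that by (simp add: if_distrib sum.delta cong: if_cong)
  qed
  have inj: "inj_on X ?I"
  proof (rule inj_onI)
    fix A B assume "A \<in> ?I" "B \<in> ?I" "X A = X B"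
    then show "A = B" using X[of A B] X[of A A] by (auto split: if_splits)
  qed
  have "independent (X ` ?I)"
    unfolding independent_explicit_module
  proof (intro allI impI)
    fix t u w assume t: "finite t" "t \<subseteq> X ` ?I" "(\<Sum>w\<in>t. u w *\<^sub>R w) = 0" "w \<in> t"
    define c where "c A = (if X A \<in> t then u (X A) else 0)" for A
    have "(\<Sum>A\<in>?I. c A *\<^sub>R X A) = (\<Sum>w\<in>X ` ?I. (if w \<in> t then u w else 0) *\<^sub>R w)"
      by (subst sum.reindex[OF inj]) (simp add: c_def)
    also have "\<dots> = (\<Sum>w\<in>t. u w *\<^sub>R w)"
      using t by (intro sum.mono_neutral_cong_right) auto
    finally have 0: "(\<Sum>A\<in>?I. c A *\<^sub>R X A) = 0" using t by simp
    from t obtain B where B: "B \<in> ?I" "w = X B" by auto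
    have "c B = 0" using comb[OF B(1), of c] 0 linear_0[OF lin(1)] by simp
    then show "u w = 0" using B t by (simp add: c_def)
  qed
  moreover have "card (X ` ?I) = DIM('a)" using card_image[OF inj] by simp
  ultimately have "UNIV \<subseteq> span (X ` ?I)"
    using card_eq_dim[of "X ` ?I" UNIV] by (simp add: dim_UNIV)
  then have "v \<in> span (X ` ?I)" by blast
  then obtain u where "v = (\<Sum>w\<in>X ` ?I. u w *\<^sub>R w)"
    by (auto simp: span_finite)
  then have v: "v = (\<Sum>A\<in>?I. u (X A) *\<^sub>R X A)" by (simp only: sum.reindex[OF inj] o_def)
  have c: "b v (X A) = u (X A)" if "A \<in> ?I" for A
    using comb[OF that, of "\<lambda>A. u (X A)"] v by simp
  have "b v v = b v (\<Sum>A\<in>?I. u (X A) *\<^sub>R X A)" using v by simp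
  also have "\<dots> = (\<Sum>A\<in>?I. u (X A) * b v (X A))"
    by (simp add: linear_sum[OF lin(2)] linear_cmul[OF lin(2)])
  also have "\<dots> = (\<Sum>A\<in>?I. (b v (X A))\<^sup>2)"
    by (intro sum.cong refl) (simp add: c power2_eq_square)
  finally show ?thesis .
qed

lemma orthonormal_frame_exists:
  fixes b :: "'a::euclidean_space \<Rightarrow> 'a \<Rightarrow> real"
  assumes b: "bilinear b" and sym: "\<And>v w. b v w = b w v" and pos: "\<And>v. v \<noteq> 0 \<Longrightarrow> b v v > 0"
  shows "\<exists>X. \<forall>A\<in>{1..DIM('a)}. \<forall>B\<in>{1..DIM('a)}. b (X A) (X B) = (if A = B then 1 else 0)"
proof -
  have lin: "linear (\<lambda>v. b v w)" "linear (\<lambda>w. b v w)" for v w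
    using b by (auto simp: bilinear_def)
  have "\<exists>X. \<forall>A\<in>{1..l}. \<forall>B\<in>{1..l}. b (X A) (X B) = (if A = B then 1 else 0)" if "l \<le> DIM('a)" for l
    using that
  proof (induction l)
    case (Suc l)
    then obtain X where "\<forall>A\<in>{1..l}. \<forall>B\<in>{1..l}. b (X A) (X B) = (if A = B then 1 else 0)"
      using Suc_leD by blast
    then have X: "b (X A) (X B) = (if A = B then 1 else 0)" if "A \<in> {1..l}" "B \<in> {1..l}" for A B
      using that by blast
    define w where "w A = (\<Sum>e\<in>Basis. b (X A) e *\<^sub>R e)" for A
    have w: "w A \<bullet> v = b (X A) v" for A v
    proof -
      have "b (X A) v = b (X A) (\<Sum>e\<in>Basis. (v \<bullet> e) *\<^sub>R e)" by (simp add: euclidean_representation)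
      also have "\<dots> = (\<Sum>e\<in>Basis. (v \<bullet> e) * b (X A) e)"
        by (simp add: linear_sum[OF lin(2)] linear_cmul[OF lin(2)])
      finally show ?thesis by (simp add: w_def inner_sum_left mult.commute) (simp add: inner_commute)
    qed
    have "dim (w ` {1..l}) \<le> card (w ` {1..l})" by (intro dim_le_card') simp
    also have "\<dots> \<le> l" using card_image_le[of "{1..l}" w] by simp
    also have "\<dots> < DIM('a)" using Suc.prems by simp
    finally obtain v where v: "v \<noteq> 0" "\<And>y. y \<in> span (w ` {1..l}) \<Longrightarrow> orthogonal v y"
      using orthogonal_to_subspace_exists by blast
    have v0: "b (X A) v = 0" if "A \<in> {1..l}" for A
      using v(2)[OF span_base, of "w A"] that w[of A v] by (auto simp: orthogonal_def inner_commute)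
    define y where "y = (1 / sqrt (b v v)) *\<^sub>R v"
    have y: "b (X A) y = 0" if "A \<in> {1..l}" for A
      using v0[OF that] by (simp add: y_def linear_cmul[OF lin(2)])
    have y': "b y (X A) = 0" if "A \<in> {1..l}" for A
      using y[OF that] sym[of y "X A"] by simp
    have yy: "b y y = 1"
      using pos[OF v(1)] by (simp add: y_def linear_cmul[OF lin(1)] linear_cmul[OF lin(2)])
    show ?case
    proof (intro exI[of _ "X(Suc l := y)"] ballI)
      fix A B assume "A \<in> {1..Suc l}" "B \<in> {1..Suc l}"
      then consider "A = Suc l" "B = Suc l" | "A = Suc l" "B \<in> {1..l}" | "A \<in> {1..l}" "B = Suc l"
        | "A \<in> {1..l}" "B \<in> {1..l}" by (auto simp: le_Suc_eq)
      then show "b ((X(Suc l := y)) A) ((X(Suc l := y)) B) = (if A = B then 1 else 0)"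
        by cases (use y yy X y' in auto)
    qed
  qed simp
  then show ?thesis by blast
qed

section \<open>The energy densities\<close>

lemma sum_sq_le: "(a + b)\<^sup>2 \<le> 2 * a\<^sup>2 + 2 * b\<^sup>2" for a b :: real
  using zero_le_power2[of "a - b"] unfolding power2_sum power2_diff by linarith

lemma diff_sq_le: "(a - b)\<^sup>2 \<le> 2 * a\<^sup>2 + 2 * b\<^sup>2" for a b :: real
  using sum_sq_le[of a "- b"] by simp

context three_charge_microstate
begin

text \<open>\<open>\<xi>\<close> stands for the differential of a function, given by its components.\<close>

definition Xu :: "(spatial option \<Rightarrow> real) \<Rightarrow> real" where
  "Xu \<xi> = Rz * \<xi> (Some Zed) - N * \<xi> (Some Phi) + (N + 1) * \<xi> (Some Psi)"

definition Bu :: "coords \<Rightarrow> (spatial option \<Rightarrow> real) \<Rightarrow> real" where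
  "Bu p \<xi> = (f p + Qs) * \<xi> (Some Zed)
     - aa * m / ((rC p)\<^sup>2 + k) * (\<xi> (Some Phi) + \<xi> (Some Psi) - Xu \<xi>)"

definition Q0 :: "coords \<Rightarrow> (spatial option \<Rightarrow> real) \<Rightarrow> real" where
  "Q0 p \<xi> = (k * Xu \<xi> / rC p + rC p * (\<xi> (Some Phi) + \<xi> (Some Psi)))\<^sup>2 / ((rC p)\<^sup>2 + k)
     + (cos (thC p) / sin (thC p) * \<xi> (Some Phi) - sin (thC p) / cos (thC p) * \<xi> (Some Psi))\<^sup>2
     + ((rC p)\<^sup>2 + k) * (\<xi> (Some Rad))\<^sup>2 + (\<xi> (Some Theta))\<^sup>2"

definition Mu :: "coords \<Rightarrow> (spatial option \<Rightarrow> real) \<Rightarrow> real" where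
  "Mu p \<xi> = Q0 p \<xi> + (Bu p \<xi>)\<^sup>2 / S p"

definition NN :: "coords \<Rightarrow> (spatial option \<Rightarrow> real) \<Rightarrow> real" where
  "NN p \<xi> = ((rC p)\<^sup>2 + 1) * (\<xi> None)\<^sup>2 + Mu p \<xi>"

definition eV :: "coords \<Rightarrow> (spatial option \<Rightarrow> real) \<Rightarrow> real" where
  "eV p \<xi> = (Q0 p \<xi> + S p * (\<xi> None + \<xi> (Some Zed))\<^sup>2) / 2"

definition eT :: "coords \<Rightarrow> (spatial option \<Rightarrow> real) \<Rightarrow> real" where
  "eT p \<xi> = (Q0 p \<xi> + S p * (\<xi> None)\<^sup>2 + 2 * Bu p \<xi> * \<xi> (Some Zed) - S p * (\<xi> (Some Zed))\<^sup>2) / 2"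

definition interior_pts :: "coords set" where
  "interior_pts = {p. rC p > 0 \<and> 0 < thC p \<and> thC p < pi / 2}"

lemma interior_nz:
  assumes "p \<in> interior_pts"
  shows "rC p > 0" "sin (thC p) > 0" "cos (thC p) > 0"
  using assms by (auto simp: interior_pts_def intro!: sin_gt_zero cos_gt_zero)

lemma regular_interior: "p \<in> regular \<longleftrightarrow> p \<in> interior_pts \<and> f p \<noteq> 0"
  by (auto simp: regular_def interior_pts_def)

lemma Hm_None_sum:
  "(\<Sum>j\<in>UNIV. \<xi> j * Hm p j None) = - S p * (\<xi> None + \<xi> (Some Zed)) + Bu p \<xi>"
proof -
  define R where "R = (rC p)\<^sup>2 + k"
  have R: "R > 0" using rk_pos[of p] by (simp add: R_def)
  define e y where "e = 1 / \<eta>" and "y = 1 / R"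
  have e: "e * \<eta> = 1" and y: "R * y = 1" using basic_pos R by (simp_all add: e_def y_def)
  have 1: "Rz / \<eta> = Rz * e" "1 / \<eta> = e" "k / R = k * y" "m\<^sup>2 / (\<eta> * R) = m\<^sup>2 * e * y" "aa * m / R = aa * m * y"
    by (simp_all add: e_def y_def)
  have kk: "k = aa\<^sup>2 * \<eta>" by (simp add: k_def)
  have mm: "m = aa * Rz" by (simp add: aa_Rz)
  have sY: "(\<Sum>l\<in>UNIV. \<xi> l * Yf l) = Rz * e * \<xi> None + Rz * (e - 1) * \<xi> (Some Zed)
      + (N + 1) * \<xi> (Some Phi) - N * \<xi> (Some Psi)"
    and sV: "(\<Sum>l\<in>UNIV. \<xi> l * Vf l) = \<xi> None + \<xi> (Some Zed)"
    unfolding sum_coords by (simp_all add: Yf_def Vf_def algebra_simps e_def)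
  have fields: "Vf None = 1" "Xf None = 0" "Yf None = Rz * e"
    by (simp_all add: Vf_def Xf_def Yf_def e_def)
  show ?thesis
    unfolding sum_Hm sY sV S_def Bu_def Xu_def R_def[symmetric] fields Hdiag_def option.case 1
    using e y kk mm by algebra
qed

lemma sum_sum_Hm:
  "(\<Sum>i\<in>UNIV. (\<Sum>j\<in>UNIV. x j * Hm p j i) * y i) =
     (\<Sum>j\<in>UNIV. x j * Hdiag p j * y j)
     - Qp * (\<Sum>l\<in>UNIV. x l * Vf l) * (\<Sum>l\<in>UNIV. y l * Vf l)
     + k / (rC p)\<^sup>2 * (\<Sum>l\<in>UNIV. x l * Xf l) * (\<Sum>l\<in>UNIV. y l * Xf l)
     - k / ((rC p)\<^sup>2 + k) * (\<Sum>l\<in>UNIV. x l * Yf l) * (\<Sum>l\<in>UNIV. y l * Yf l)"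
proof -
  have *: "(\<Sum>i\<in>UNIV. (a i - b * Vf i + c * Xf i - d * Yf i) * y i)
    = (\<Sum>i\<in>UNIV. a i * y i) - b * (\<Sum>l\<in>UNIV. y l * Vf l) + c * (\<Sum>l\<in>UNIV. y l * Xf l)
      - d * (\<Sum>l\<in>UNIV. y l * Yf l)" for a b c d
    unfolding sum_coords by (simp add: algebra_simps)
  show ?thesis unfolding sum_Hm * ..
qed

lemma Hm_form:
  assumes "p \<in> interior_pts"
  shows "(\<Sum>i\<in>UNIV. (\<Sum>j\<in>UNIV. \<xi> j * Hm p j i) * \<xi> i)
    = - S p * (\<xi> None + \<xi> (Some Zed))\<^sup>2 + 2 * (\<xi> None + \<xi> (Some Zed)) * Bu p \<xi> + Q0 p \<xi>"
proof -
  define R r s c where "R = (rC p)\<^sup>2 + k" and "r = rC p" and "s = sin (thC p)" and "c = cos (thC p)"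
  have R: "R > 0" using rk_pos[of p] by (simp add: R_def)
  have nz: "r \<noteq> 0" "s \<noteq> 0" "c \<noteq> 0" using interior_nz[OF assms] by (auto simp: r_def s_def c_def)
  define e y where "e = 1 / \<eta>" and "y = 1 / R"
  define r' s' c' where "r' = 1 / r" and "s' = 1 / s" and "c' = 1 / c"
  have e: "e * \<eta> = 1" and y: "R * y = 1" using basic_pos R by (simp_all add: e_def y_def)
  have n': "r * r' = 1" "s * s' = 1" "c * c' = 1" using nz by (simp_all add: r'_def s'_def c'_def)
  have 1: "Rz / \<eta> = Rz * e" "1 / \<eta> = e" "k / R = k * y" "m\<^sup>2 / (\<eta> * R) = m\<^sup>2 * e * y" "aa * m / R = aa * m * y"
    "x / r = x * r'" "c / s = c * s'" "s / c = s * c'" "x / R = x * y" "k / r\<^sup>2 = k * r'\<^sup>2" "1 / s\<^sup>2 = s'\<^sup>2" "1 / c\<^sup>2 = c'\<^sup>2" for x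
    by (simp_all add: e_def y_def r'_def s'_def c'_def power_divide)
  have kk: "k = aa\<^sup>2 * \<eta>" by (simp add: k_def)
  have mm: "m = aa * Rz" by (simp add: aa_Rz)
  have sc: "s\<^sup>2 + c\<^sup>2 = 1" by (simp add: s_def c_def)
  have Rr: "R = r\<^sup>2 + k" by (simp add: R_def r_def)
  define t z ph ps ur ut where "t = \<xi> None" and "z = \<xi> (Some Zed)" and "ph = \<xi> (Some Phi)"
    and "ps = \<xi> (Some Psi)" and "ur = \<xi> (Some Rad)" and "ut = \<xi> (Some Theta)"
  define x where "x = Rz * z - N * ph + (N + 1) * ps"
  define Y where "Y = Rz * e * t + Rz * (e - 1) * z + (N + 1) * ph - N * ps"
  have sX: "(\<Sum>l\<in>UNIV. \<xi> l * Xf l) = x"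
    and sY: "(\<Sum>l\<in>UNIV. \<xi> l * Yf l) = Y"
    and sV: "(\<Sum>l\<in>UNIV. \<xi> l * Vf l) = t + z"
    unfolding sum_coords x_def Y_def t_def z_def ph_def ps_def
    by (simp_all add: Xf_def Yf_def Vf_def algebra_simps e_def)
  have "(\<Sum>i\<in>UNIV. (\<Sum>j\<in>UNIV. \<xi> j * Hm p j i) * \<xi> i)
     = - (f p + Qs) * t\<^sup>2 + R * ur\<^sup>2 + ut\<^sup>2 + s'\<^sup>2 * ph\<^sup>2 + c'\<^sup>2 * ps\<^sup>2 + (f p + Qs) * z\<^sup>2
       - Qp * (t + z)\<^sup>2 + k * r'\<^sup>2 * x\<^sup>2 - k * y * Y\<^sup>2"
    unfolding sum_sum_Hm sX sY sV
    unfolding r_def[symmetric] s_def[symmetric] c_def[symmetric] Rr[symmetric] 1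
    unfolding sum_coords Hdiag_def option.case spatial.case r_def[symmetric] s_def[symmetric] c_def[symmetric] Rr[symmetric] 1
    by (simp add: t_def z_def ph_def ps_def ur_def ut_def power2_eq_square algebra_simps)
  also have "\<dots> = - S p * (t + z)\<^sup>2 + 2 * (t + z) * Bu p \<xi> + Q0 p \<xi>"
    unfolding S_def Bu_def Q0_def Xu_def t_def[symmetric] z_def[symmetric] ph_def[symmetric] ps_def[symmetric]
      ur_def[symmetric] ut_def[symmetric] x_def[symmetric] r_def[symmetric] s_def[symmetric] c_def[symmetric]
    unfolding Rr[symmetric] 1 Y_def x_def
    using e y n' kk mm sc Rr by algebra
  finally show ?thesis by (simp add: t_def z_def)
qed

lemma size_bounds:
  "\<exists>C\<ge>1. \<forall>p. (rC p)\<^sup>2 + 1 \<le> C * hf p \<and> hf p \<le> C * ((rC p)\<^sup>2 + 1)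
     \<and> (rC p)\<^sup>2 + 1 \<le> C * S p \<and> S p \<le> C * ((rC p)\<^sup>2 + 1)
     \<and> (rC p)\<^sup>2 + 1 \<le> C * ((rC p)\<^sup>2 + k) \<and> (rC p)\<^sup>2 + k \<le> C * ((rC p)\<^sup>2 + 1)
     \<and> \<bar>f p\<bar> \<le> C * ((rC p)\<^sup>2 + 1) \<and> \<bar>f p + Qs\<bar> \<le> C * ((rC p)\<^sup>2 + 1)"
proof -
  define d where "d = min Q1 Q2 - k * N"
  have d: "d > 0" using kN_less by (simp add: d_def)
  define A where "A = m\<^sup>2 / (\<eta> * k)"
  have A: "A > 0" using basic_pos by (simp add: A_def)
  define C where "C = 1 + k * (N + 1) + Qs + Qp + A + 1 / Q2 + 1 / d + 1 / k + k"
  have kN: "k * (N + 1) > 0" "0 \<le> k * N" using basic_pos by auto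
  note pos = basic_pos d A kN Q1_pos Q2_pos
  have inv: "1 / Q2 > 0" "1 / d > 0" "1 / k > 0" using pos by auto
  have C1: "C \<ge> 1" unfolding C_def using pos inv by linarith
  have up: "x \<le> C * ((rC p)\<^sup>2 + 1)" if "x \<le> (rC p)\<^sup>2 + b" "b \<le> C" for x b p
  proof -
    have "(rC p)\<^sup>2 + b \<le> C * (rC p)\<^sup>2 + C"
      using that C1 mult_right_mono[of 1 C "(rC p)\<^sup>2"] by simp
    then show ?thesis using that by (simp add: algebra_simps)
  qed
  have low: "(rC p)\<^sup>2 + 1 \<le> C * x" if "(rC p)\<^sup>2 + b \<le> x" "b > 0" "1 + 1 / b \<le> C" for x b p
  proof -
    have "(rC p)\<^sup>2 + 1 \<le> (1 + 1 / b) * ((rC p)\<^sup>2 + b)"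
      using that by (simp add: field_simps)
    also have "\<dots> \<le> C * x" using that C1 by (intro mult_mono) auto
    finally show ?thesis .
  qed
  show ?thesis
  proof (intro exI[of _ C] conjI allI C1)
    fix p
    have fl: "f p \<ge> (rC p)\<^sup>2 - k * N" "f p \<le> (rC p)\<^sup>2 + k * (N + 1)" by (rule f_bounds)+
    have fq: "f p + Qs \<ge> (rC p)\<^sup>2 + Q2" "f p + Qs \<ge> (rC p)\<^sup>2 + Q1" using fl kN_less by (simp_all add: Qs_def)
    have r0: "(rC p)\<^sup>2 \<ge> 0" by simp
    have "((rC p)\<^sup>2 + d)\<^sup>2 \<le> (f p + Q1) * (f p + Q2)"
      unfolding power2_eq_square[of "_ + d"]
      using fl d r0 f_plus_Q_pos[of p] by (intro mult_mono) (auto simp: d_def)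
    then have hl: "(rC p)\<^sup>2 + d \<le> hf p"
      unfolding hf_def by (intro real_le_rsqrt)
    show "(rC p)\<^sup>2 + 1 \<le> C * hf p"
      by (rule low[OF hl d]) (unfold C_def, use pos inv in linarith)
    have "m\<^sup>2 \<le> Qs * (f p + Qs)"
    proof -
      have "Q1 * Q2 \<le> Qs * (f p + Qs)"
        using fq r0 pos f_plus_Q_pos[of p] by (intro mult_mono) (auto simp: Qs_def)
      then show ?thesis by (simp add: m_sq)
    qed
    then have "(hf p)\<^sup>2 \<le> (f p + Qs)\<^sup>2"
      unfolding hf_sq by (simp add: power2_eq_square algebra_simps)
    then have "hf p \<le> f p + Qs"
      by (rule power2_le_imp_le) (use fq r0 pos in linarith)
    then have "hf p \<le> (rC p)\<^sup>2 + (k * (N + 1) + Qs)" using fl by linarith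
    then show "hf p \<le> C * ((rC p)\<^sup>2 + 1)"
      by (rule up) (unfold C_def, use pos inv in linarith)
    have mS: "0 \<le> m\<^sup>2 / (\<eta> * ((rC p)\<^sup>2 + k))" using pos r0 by simp
    have mS2: "m\<^sup>2 / (\<eta> * ((rC p)\<^sup>2 + k)) \<le> A"
      unfolding A_def using pos r0 by (intro divide_left_mono mult_left_mono mult_pos_pos add_nonneg_pos) auto
    have "(rC p)\<^sup>2 + Q2 \<le> S p" unfolding S_def using fq mS pos by linarith
    then show "(rC p)\<^sup>2 + 1 \<le> C * S p"
      by (rule low) (use pos in simp, unfold C_def, use pos inv in linarith)
    have "S p \<le> (rC p)\<^sup>2 + (k * (N + 1) + Qs + Qp + A)"
      unfolding S_def using fl mS2 by linarith
    then show "S p \<le> C * ((rC p)\<^sup>2 + 1)"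
      by (rule up) (unfold C_def, use pos inv in linarith)
    show "(rC p)\<^sup>2 + 1 \<le> C * ((rC p)\<^sup>2 + k)"
      by (rule low[of _ k]) (use pos in simp_all, unfold C_def, use pos inv in linarith)
    show "(rC p)\<^sup>2 + k \<le> C * ((rC p)\<^sup>2 + 1)"
      by (rule up[of _ _ k]) (simp, unfold C_def, use pos inv in linarith)
    have "k * N \<le> k * (N + 1)" using pos by (simp add: algebra_simps)
    then have "\<bar>f p\<bar> \<le> (rC p)\<^sup>2 + k * (N + 1)" using fl r0 kN by (intro abs_leI) linarith+
    then show "\<bar>f p\<bar> \<le> C * ((rC p)\<^sup>2 + 1)"
      by (rule up) (unfold C_def, use pos inv in linarith)
    have "\<bar>f p + Qs\<bar> \<le> (rC p)\<^sup>2 + (k * (N + 1) + Qs)" using fl fq r0 pos by (intro abs_leI) linarith+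
    then show "\<bar>f p + Qs\<bar> \<le> C * ((rC p)\<^sup>2 + 1)"
      by (rule up) (unfold C_def, use pos inv in linarith)
  qed
qed

lemma Q0_parts:
  "(k * Xu \<xi> / rC p + rC p * (\<xi> (Some Phi) + \<xi> (Some Psi)))\<^sup>2 \<le> Q0 p \<xi> * ((rC p)\<^sup>2 + k)"
  "(cos (thC p) / sin (thC p) * \<xi> (Some Phi) - sin (thC p) / cos (thC p) * \<xi> (Some Psi))\<^sup>2 \<le> Q0 p \<xi>"
  "((rC p)\<^sup>2 + k) * (\<xi> (Some Rad))\<^sup>2 \<le> Q0 p \<xi>" "(\<xi> (Some Theta))\<^sup>2 \<le> Q0 p \<xi>" "0 \<le> Q0 p \<xi>"
proof -
  define R where "R = (rC p)\<^sup>2 + k"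
  have R: "R > 0" using rk_pos[of p] by (simp add: R_def)
  define a1 a2 where "a1 = (k * Xu \<xi> / rC p + rC p * (\<xi> (Some Phi) + \<xi> (Some Psi)))\<^sup>2"
    and "a2 = (cos (thC p) / sin (thC p) * \<xi> (Some Phi) - sin (thC p) / cos (thC p) * \<xi> (Some Psi))\<^sup>2"
  have Q: "Q0 p \<xi> = a1 / R + a2 + R * (\<xi> (Some Rad))\<^sup>2 + (\<xi> (Some Theta))\<^sup>2"
    by (simp add: Q0_def a1_def a2_def R_def)
  have n: "0 \<le> a1 / R" "0 \<le> a2" "0 \<le> R * (\<xi> (Some Rad))\<^sup>2" "0 \<le> (\<xi> (Some Theta))\<^sup>2"
    using R by (simp_all add: a1_def a2_def)
  have "a1 / R \<le> Q0 p \<xi>" unfolding Q using n by linarith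
  then have "a1 \<le> Q0 p \<xi> * R" using R by (simp add: pos_divide_le_eq)
  then show "(k * Xu \<xi> / rC p + rC p * (\<xi> (Some Phi) + \<xi> (Some Psi)))\<^sup>2 \<le> Q0 p \<xi> * ((rC p)\<^sup>2 + k)"
    by (simp add: a1_def R_def)
  show "(cos (thC p) / sin (thC p) * \<xi> (Some Phi) - sin (thC p) / cos (thC p) * \<xi> (Some Psi))\<^sup>2 \<le> Q0 p \<xi>"
    unfolding a2_def[symmetric] Q using n by linarith
  show "((rC p)\<^sup>2 + k) * (\<xi> (Some Rad))\<^sup>2 \<le> Q0 p \<xi>" "(\<xi> (Some Theta))\<^sup>2 \<le> Q0 p \<xi>" "0 \<le> Q0 p \<xi>"
    unfolding R_def[symmetric] Q using n by linarith+
qed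

lemma Mu_parts: "Q0 p \<xi> \<le> Mu p \<xi>" "(Bu p \<xi>)\<^sup>2 \<le> S p * Mu p \<xi>" "0 \<le> Mu p \<xi>"
proof -
  have n: "0 \<le> (Bu p \<xi>)\<^sup>2 / S p" using S_pos[of p] by simp
  then show "Q0 p \<xi> \<le> Mu p \<xi>" "0 \<le> Mu p \<xi>" using Q0_parts(5)[of p \<xi>] by (simp_all add: Mu_def)
  have "(Bu p \<xi>)\<^sup>2 = S p * ((Bu p \<xi>)\<^sup>2 / S p)" using S_pos[of p] by simp
  also have "\<dots> \<le> S p * Mu p \<xi>"
    using S_pos[of p] Q0_parts(5)[of p \<xi>] by (intro mult_left_mono) (auto simp: Mu_def)
  finally show "(Bu p \<xi>)\<^sup>2 \<le> S p * Mu p \<xi>" .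
qed

text \<open>
  Solving the two linear equations for \<open>\<zeta>\<close> and \<open>\<phi> + \<psi>\<close> below, whose determinant is \<open>- hf\<^sup>2\<close>, shows
  that \<open>Mu\<close> controls every spatial component.
\<close>

lemma Mu_coercive:
  "\<exists>C\<ge>0. \<forall>p\<in>interior_pts. \<forall>\<xi>. ((rC p)\<^sup>2 + 1) * (\<xi> (Some Zed))\<^sup>2 \<le> C * Mu p \<xi>
     \<and> (\<xi> (Some Phi) + \<xi> (Some Psi))\<^sup>2 \<le> C * Mu p \<xi> \<and> (\<xi> (Some Phi))\<^sup>2 \<le> C * Mu p \<xi>
     \<and> (\<xi> (Some Psi))\<^sup>2 \<le> C * Mu p \<xi> \<and> (Xu \<xi>)\<^sup>2 \<le> C * Mu p \<xi>"
proof -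
  obtain C where C: "C \<ge> 1" and sb: "\<And>p. (rC p)\<^sup>2 + 1 \<le> C * hf p" "\<And>p. S p \<le> C * ((rC p)\<^sup>2 + 1)"
    "\<And>p. (rC p)\<^sup>2 + k \<le> C * ((rC p)\<^sup>2 + 1)" "\<And>p. \<bar>f p\<bar> \<le> C * ((rC p)\<^sup>2 + 1)" "\<And>p. \<bar>f p + Qs\<bar> \<le> C * ((rC p)\<^sup>2 + 1)"
    using size_bounds by blast
  define K where "K = k * (2 * N + 1)"
  define E where "E = Rz / \<eta>"
  define A1 where "A1 = 2 * C + 2 * K\<^sup>2"
  define A2 where "A2 = 2 * C + 2 * E\<^sup>2"
  define Cz where "Cz = C ^ 4 * (2 * E\<^sup>2 * A1 + 2 * C\<^sup>2 * A2)"
  define Cp where "Cp = C ^ 4 * (2 * C\<^sup>2 * A1 + 2 * (k * Rz)\<^sup>2 * A2)"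
  define Ca where "Ca = 2 * Cp + 2"
  define Cx where "Cx = 2 * (Rz\<^sup>2 * Cz) + 2 * (2 * (N\<^sup>2 * Ca) + 2 * ((N + 1)\<^sup>2 * Ca))"
  have A0: "A1 \<ge> 0" "A2 \<ge> 0" using C by (auto simp: A1_def A2_def)
  have C0: "Cz \<ge> 0" "Cp \<ge> 0" using A0 C by (auto simp: Cz_def Cp_def)
  have C0': "Ca \<ge> 0" "Cx \<ge> 0" using C0 by (auto simp: Ca_def Cx_def)
  show ?thesis
  proof (intro exI[of _ "Cz + Cp + Ca + Cx"] conjI ballI allI)
    show "0 \<le> Cz + Cp + Ca + Cx" using C0 C0' by simp
    fix p \<xi> assume p: "p \<in> interior_pts"
    define r s c where "r = rC p" and "s = sin (thC p)" and "c = cos (thC p)"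
    have nz: "r > 0" "s > 0" "c > 0" using interior_nz[OF p] by (auto simp: r_def s_def c_def)
    have sc: "s\<^sup>2 + c\<^sup>2 = 1" by (simp add: s_def c_def)
    have s1: "s\<^sup>2 \<le> 1" "c\<^sup>2 \<le> 1" using sc by (smt (verit) zero_le_power2)+
    have sc1: "(s * c)\<^sup>2 \<le> 1" using s1 by (simp add: power_mult_distrib mult_le_one)
    define R where "R = r\<^sup>2 + k"
    have R: "R > 0" using rk_pos[of p] by (simp add: R_def r_def)
    define \<rho> where "\<rho> = r\<^sup>2 + 1"
    have \<rho>: "\<rho> \<ge> 1" "r\<^sup>2 \<le> \<rho>" by (auto simp: \<rho>_def)
    define z ph ps x pp where "z = \<xi> (Some Zed)" and "ph = \<xi> (Some Phi)" and "ps = \<xi> (Some Psi)"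
      and "x = Xu \<xi>" and "pp = ph + ps"
    define M where "M = Mu p \<xi>"
    have M0: "M \<ge> 0" unfolding M_def by (rule Mu_parts)
    define w b where "w = k * x / r + r * pp" and "b = c / s * ph - s / c * ps"
    have QM: "Q0 p \<xi> \<le> M" unfolding M_def by (rule Mu_parts)
    have w: "w\<^sup>2 \<le> M * R"
      using order_trans[OF Q0_parts(1)[of \<xi> p] mult_right_mono[OF QM, of "(rC p)\<^sup>2 + k"]] R
      by (simp add: w_def x_def r_def pp_def ph_def ps_def R_def)
    have b: "b\<^sup>2 \<le> M"
      using order_trans[OF Q0_parts(2)[of p \<xi>] QM] by (simp add: b_def s_def c_def ph_def ps_def)
    define L1 L2 where "L1 = k * Rz * z + f p * pp" and "L2 = (f p + Qs) * z - E * pp"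
    have fR: "f p = r\<^sup>2 + k * ((N + 1) * c\<^sup>2 - N * s\<^sup>2)" by (simp add: f_eq \<nu>_def r_def c_def s_def)
    have xe: "x = Rz * z - N * ph + (N + 1) * ps" by (simp add: x_def Xu_def z_def ph_def ps_def)
    have bsc: "s * c * b = c\<^sup>2 * ph - s\<^sup>2 * ps"
      using nz by (simp add: b_def power2_eq_square field_simps)
    have phe: "ph = s\<^sup>2 * pp + s * c * b" "ps = c\<^sup>2 * pp - s * c * b"
      unfolding bsc pp_def using sc by algebra+
    have rw: "r * w = k * x + r\<^sup>2 * pp" using nz by (simp add: w_def power2_eq_square algebra_simps)
    have L1: "L1 = r * w + K * (s * c * b)"
      unfolding L1_def rw bsc K_def fR xe pp_def using sc by algebra
    have Bu: "Bu p \<xi> = (f p + Qs) * z - aa * m / R * (pp - x)"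
      by (simp add: Bu_def R_def r_def z_def pp_def ph_def ps_def x_def)
    have Ek: "E * k = aa * m"
      unfolding E_def using k_Rz(2) basic_pos by (simp add: field_simps)
    have L2: "L2 = Bu p \<xi> - E * (r * w) / R"
    proof -
      have "E * (r * w) = aa * m * x + E * r\<^sup>2 * pp" unfolding rw Ek[symmetric] by (simp add: algebra_simps)
      then have "Bu p \<xi> - E * (r * w) / R = (f p + Qs) * z - (aa * m * (pp - x) + aa * m * x + E * r\<^sup>2 * pp) / R"
        unfolding Bu by (simp add: add_divide_distrib)
      also have "aa * m * (pp - x) + aa * m * x + E * r\<^sup>2 * pp = E * pp * R"
        unfolding Ek[symmetric] R_def by (simp add: algebra_simps)
      finally show ?thesis using R by (simp add: L2_def)
    qed
    have R\<rho>: "R \<le> C * \<rho>" using sb(3)[of p] by (simp add: R_def \<rho>_def r_def)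
    have \<rho>2: "1 \<le> \<rho>\<^sup>2" using \<rho> by (simp add: one_le_power)
    have rw2: "(r * w)\<^sup>2 \<le> \<rho> * (M * (C * \<rho>))"
    proof -
      have "w\<^sup>2 \<le> M * (C * \<rho>)" using w mult_left_mono[OF R\<rho> M0] by linarith
      then show ?thesis unfolding power_mult_distrib using \<rho> by (intro mult_mono) auto
    qed
    have "(K * (s * c * b))\<^sup>2 \<le> K\<^sup>2 * M"
    proof -
      have "(K * (s * c * b))\<^sup>2 = K\<^sup>2 * ((s * c)\<^sup>2 * b\<^sup>2)" by (simp add: power_mult_distrib)
      also have "\<dots> \<le> K\<^sup>2 * (1 * M)" using sc1 b by (intro mult_left_mono mult_mono) auto
      finally show ?thesis by simp
    qed
    also have "\<dots> \<le> K\<^sup>2 * M * \<rho>\<^sup>2"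
      using mult_left_mono[OF \<rho>2, of "K\<^sup>2 * M"] M0 by simp
    finally have Kb: "(K * (s * c * b))\<^sup>2 \<le> K\<^sup>2 * M * \<rho>\<^sup>2" .
    have L1b: "L1\<^sup>2 \<le> A1 * \<rho>\<^sup>2 * M"
    proof -
      have "L1\<^sup>2 \<le> 2 * (r * w)\<^sup>2 + 2 * (K * (s * c * b))\<^sup>2" unfolding L1 by (rule sum_sq_le)
      also have "\<dots> \<le> 2 * (\<rho> * (M * (C * \<rho>))) + 2 * (K\<^sup>2 * M * \<rho>\<^sup>2)" using rw2 Kb by linarith
      also have "\<dots> = A1 * \<rho>\<^sup>2 * M" by (simp add: A1_def power2_eq_square algebra_simps)
      finally show ?thesis .
    qed
    have B2: "(Bu p \<xi>)\<^sup>2 \<le> C * \<rho> * M"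
      using order_trans[OF Mu_parts(2)[of p \<xi>] mult_right_mono[OF sb(2)[of p] Mu_parts(3)[of p \<xi>]]]
      by (simp add: M_def \<rho>_def r_def)
    have "(E * (r * w) / R)\<^sup>2 = E\<^sup>2 * ((r\<^sup>2 / R) * (w\<^sup>2 / R))"
      by (simp add: power_mult_distrib power_divide power2_eq_square)
    also have "\<dots> \<le> E\<^sup>2 * (1 * M)"
      using R w basic_pos by (intro mult_left_mono mult_mono) (auto simp: R_def field_simps)
    also have "\<dots> \<le> E\<^sup>2 * (\<rho> * M)"
      using \<rho> M0 by (intro mult_left_mono mult_right_mono) auto
    finally have Er: "(E * (r * w) / R)\<^sup>2 \<le> E\<^sup>2 * (\<rho> * M)" .
    have L2b: "L2\<^sup>2 \<le> A2 * \<rho> * M"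
    proof -
      have "L2\<^sup>2 \<le> 2 * (Bu p \<xi>)\<^sup>2 + 2 * (E * (r * w) / R)\<^sup>2" unfolding L2 by (rule diff_sq_le)
      also have "\<dots> \<le> 2 * (C * \<rho> * M) + 2 * (E\<^sup>2 * (\<rho> * M))" using B2 Er by linarith
      also have "\<dots> = A2 * \<rho> * M" by (simp add: A2_def algebra_simps)
      finally show ?thesis .
    qed
    have hf2: "(hf p)\<^sup>2 = (f p)\<^sup>2 + Qs * f p + m\<^sup>2" by (rule hf_sq)
    have EkRz: "E * (k * Rz) = m\<^sup>2" using Ek aa_Rz by algebra
    have sol: "(hf p)\<^sup>2 * z = E * L1 + f p * L2" "(hf p)\<^sup>2 * pp = (f p + Qs) * L1 - (k * Rz) * L2"
      unfolding L1_def L2_def hf2 EkRz[symmetric] by (simp_all add: power2_eq_square algebra_simps)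
    have f2: "(f p)\<^sup>2 \<le> C\<^sup>2 * \<rho>\<^sup>2" "(f p + Qs)\<^sup>2 \<le> C\<^sup>2 * \<rho>\<^sup>2"
      using sb(4,5)[of p] abs_le_square_iff[of _ "C * \<rho>"] C \<rho>
      by (simp_all add: \<rho>_def r_def flip: power_mult_distrib)
    have hfl: "\<rho> ^ 4 \<le> C ^ 4 * ((hf p)\<^sup>2)\<^sup>2"
    proof -
      have "\<rho> ^ 4 \<le> (C * hf p) ^ 4" using sb(1)[of p] \<rho> by (intro power_mono) (auto simp: \<rho>_def r_def)
      then show ?thesis by (simp add: power_mult_distrib flip: power_mult)
    qed
    have key: "\<rho> ^ 4 * y\<^sup>2 \<le> C ^ 4 * D" if "((hf p)\<^sup>2 * y)\<^sup>2 \<le> D" for y D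
    proof -
      have "\<rho> ^ 4 * y\<^sup>2 \<le> C ^ 4 * ((hf p)\<^sup>2)\<^sup>2 * y\<^sup>2" using hfl by (intro mult_right_mono) auto
      also have "\<dots> = C ^ 4 * ((hf p)\<^sup>2 * y)\<^sup>2" by (simp add: power_mult_distrib)
      also have "\<dots> \<le> C ^ 4 * D" using that C by (intro mult_left_mono) auto
      finally show ?thesis .
    qed
    have "((hf p)\<^sup>2 * z)\<^sup>2 \<le> 2 * (E * L1)\<^sup>2 + 2 * (f p * L2)\<^sup>2" unfolding sol by (rule sum_sq_le)
    also have "\<dots> = 2 * (E\<^sup>2 * L1\<^sup>2) + 2 * ((f p)\<^sup>2 * L2\<^sup>2)" by (simp add: power_mult_distrib)
    also have "\<dots> \<le> 2 * (E\<^sup>2 * (A1 * \<rho> ^ 3 * M)) + 2 * ((C\<^sup>2 * \<rho>\<^sup>2) * (A2 * \<rho> * M))"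
    proof -
      have "A1 * \<rho>\<^sup>2 * M \<le> A1 * \<rho> ^ 3 * M"
        using \<rho> A0 M0 by (intro mult_right_mono mult_left_mono power_increasing) auto
      then have "E\<^sup>2 * L1\<^sup>2 \<le> E\<^sup>2 * (A1 * \<rho> ^ 3 * M)" using L1b by (intro mult_left_mono) auto
      moreover have "(f p)\<^sup>2 * L2\<^sup>2 \<le> (C\<^sup>2 * \<rho>\<^sup>2) * (A2 * \<rho> * M)" using f2 L2b by (intro mult_mono) auto
      ultimately show ?thesis by linarith
    qed
    also have "\<dots> = (2 * E\<^sup>2 * A1 + 2 * C\<^sup>2 * A2) * \<rho> ^ 3 * M"
      by (simp add: power2_eq_square power3_eq_cube algebra_simps)
    finally have "\<rho> ^ 4 * z\<^sup>2 \<le> C ^ 4 * ((2 * E\<^sup>2 * A1 + 2 * C\<^sup>2 * A2) * \<rho> ^ 3 * M)" by (rule key)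
    then have "\<rho> ^ 3 * (\<rho> * z\<^sup>2) \<le> \<rho> ^ 3 * (Cz * M)"
      by (simp add: Cz_def algebra_simps eval_nat_numeral)
    then have Z: "\<rho> * z\<^sup>2 \<le> Cz * M" using \<rho> by simp
    have "((hf p)\<^sup>2 * pp)\<^sup>2 \<le> 2 * ((f p + Qs) * L1)\<^sup>2 + 2 * ((k * Rz) * L2)\<^sup>2" unfolding sol by (rule diff_sq_le)
    also have "\<dots> = 2 * ((f p + Qs)\<^sup>2 * L1\<^sup>2) + 2 * ((k * Rz)\<^sup>2 * L2\<^sup>2)" by (simp add: power_mult_distrib)
    also have "\<dots> \<le> 2 * ((C\<^sup>2 * \<rho>\<^sup>2) * (A1 * \<rho>\<^sup>2 * M)) + 2 * ((k * Rz)\<^sup>2 * (A2 * \<rho> ^ 4 * M))"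
    proof -
      have "A2 * \<rho> * M \<le> A2 * \<rho> ^ 4 * M"
        using \<rho> A0 M0 self_le_power[of \<rho> 4] by (intro mult_right_mono mult_left_mono) auto
      then have "(k * Rz)\<^sup>2 * L2\<^sup>2 \<le> (k * Rz)\<^sup>2 * (A2 * \<rho> ^ 4 * M)" using L2b by (intro mult_left_mono) auto
      moreover have "(f p + Qs)\<^sup>2 * L1\<^sup>2 \<le> (C\<^sup>2 * \<rho>\<^sup>2) * (A1 * \<rho>\<^sup>2 * M)" using f2 L1b by (intro mult_mono) auto
      ultimately show ?thesis by linarith
    qed
    also have "\<dots> = (2 * C\<^sup>2 * A1 + 2 * (k * Rz)\<^sup>2 * A2) * \<rho> ^ 4 * M"
      by (simp add: power2_eq_square eval_nat_numeral algebra_simps)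
    finally have "\<rho> ^ 4 * pp\<^sup>2 \<le> C ^ 4 * ((2 * C\<^sup>2 * A1 + 2 * (k * Rz)\<^sup>2 * A2) * \<rho> ^ 4 * M)" by (rule key)
    then have "\<rho> ^ 4 * pp\<^sup>2 \<le> \<rho> ^ 4 * (Cp * M)" by (simp add: Cp_def algebra_simps)
    then have P: "pp\<^sup>2 \<le> Cp * M" using \<rho> by simp
    have sb2: "(s * c * b)\<^sup>2 \<le> M"
    proof -
      have "(s * c)\<^sup>2 * b\<^sup>2 \<le> 1 * M" using sc1 b by (intro mult_mono) auto
      then show ?thesis by (simp add: power_mult_distrib)
    qed
    have tp: "(t * pp)\<^sup>2 \<le> Cp * M" if "0 \<le> t" "t \<le> 1" for t
    proof -
      have "t\<^sup>2 * pp\<^sup>2 \<le> 1 * (Cp * M)" using that P by (intro mult_mono) (auto simp: power_le_one)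
      then show ?thesis by (simp add: power_mult_distrib)
    qed
    have Ph: "ph\<^sup>2 \<le> Ca * M"
    proof -
      have "ph\<^sup>2 \<le> 2 * (s\<^sup>2 * pp)\<^sup>2 + 2 * (s * c * b)\<^sup>2" unfolding phe(1) by (rule sum_sq_le)
      also have "\<dots> \<le> 2 * (Cp * M) + 2 * M" using tp[of "s\<^sup>2"] sb2 s1 by auto
      finally show ?thesis by (simp add: Ca_def algebra_simps)
    qed
    have Ps: "ps\<^sup>2 \<le> Ca * M"
    proof -
      have "ps\<^sup>2 \<le> 2 * (c\<^sup>2 * pp)\<^sup>2 + 2 * (s * c * b)\<^sup>2" unfolding phe(2) by (rule diff_sq_le)
      also have "\<dots> \<le> 2 * (Cp * M) + 2 * M" using tp[of "c\<^sup>2"] sb2 s1 by auto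
      finally show ?thesis by (simp add: Ca_def algebra_simps)
    qed
    have z1: "z\<^sup>2 \<le> Cz * M" using Z \<rho> mult_right_mono[of 1 \<rho> "z\<^sup>2"] by simp
    have X: "x\<^sup>2 \<le> Cx * M"
    proof -
      have "x = Rz * z + ((N + 1) * ps - N * ph)" unfolding xe by simp
      then have "x\<^sup>2 = (Rz * z + ((N + 1) * ps - N * ph))\<^sup>2" by (rule arg_cong)
      also have "\<dots> \<le> 2 * (Rz * z)\<^sup>2 + 2 * ((N + 1) * ps - N * ph)\<^sup>2" by (rule sum_sq_le)
      also have "\<dots> \<le> 2 * (Rz * z)\<^sup>2 + 2 * (2 * ((N + 1) * ps)\<^sup>2 + 2 * (N * ph)\<^sup>2)"
        by (intro add_left_mono mult_left_mono diff_sq_le) auto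
      also have "\<dots> \<le> 2 * (Rz\<^sup>2 * (Cz * M)) + 2 * (2 * ((N + 1)\<^sup>2 * (Ca * M)) + 2 * (N\<^sup>2 * (Ca * M)))"
        unfolding power_mult_distrib using z1 Ph Ps by (intro add_mono mult_left_mono) auto
      also have "\<dots> = Cx * M" by (simp add: Cx_def algebra_simps)
      finally show ?thesis .
    qed
    let ?C = "Cz + Cp + Ca + Cx"
    have le: "D * M \<le> ?C * M" if "D \<le> ?C" for D using that M0 by (intro mult_right_mono)
    show "((rC p)\<^sup>2 + 1) * (\<xi> (Some Zed))\<^sup>2 \<le> ?C * Mu p \<xi>"
      using order_trans[OF Z le] C0 C0' by (simp add: \<rho>_def r_def z_def M_def)
    show "(\<xi> (Some Phi) + \<xi> (Some Psi))\<^sup>2 \<le> ?C * Mu p \<xi>"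
      using order_trans[OF P le] C0 C0' by (simp add: pp_def ph_def ps_def M_def)
    show "(\<xi> (Some Phi))\<^sup>2 \<le> ?C * Mu p \<xi>" using order_trans[OF Ph le] C0 C0' by (simp add: ph_def M_def)
    show "(\<xi> (Some Psi))\<^sup>2 \<le> ?C * Mu p \<xi>" using order_trans[OF Ps le] C0 C0' by (simp add: ps_def M_def)
    show "(Xu \<xi>)\<^sup>2 \<le> ?C * Mu p \<xi>" using order_trans[OF X le] C0 C0' by (simp add: x_def M_def)
  qed
qed

lemma eV_nonneg: "0 \<le> eV p \<xi>"
  using Q0_parts(5)[of p \<xi>] S_pos[of p] by (simp add: eV_def)

lemma Q0_le_eV: "Q0 p \<xi> \<le> 2 * eV p \<xi>" "S p * (\<xi> None + \<xi> (Some Zed))\<^sup>2 \<le> 2 * eV p \<xi>"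
  using Q0_parts(5)[of p \<xi>] S_pos[of p] by (simp_all add: eV_def)

lemma NN_parts: "((rC p)\<^sup>2 + 1) * (\<xi> None)\<^sup>2 \<le> NN p \<xi>" "Mu p \<xi> \<le> NN p \<xi>" "0 \<le> NN p \<xi>"
  using Mu_parts(3)[of p \<xi>] by (simp_all add: NN_def)

lemma eV_flux:
  "\<exists>C\<ge>0. \<forall>p \<xi>. ((rC p)\<^sup>2 + k) * \<bar>\<xi> (Some Rad) * (\<xi> None + \<xi> (Some Zed))\<bar> \<le> C * eV p \<xi>"
proof -
  obtain C where C: "C \<ge> 1" and sb: "\<And>p. (rC p)\<^sup>2 + 1 \<le> C * S p" "\<And>p. (rC p)\<^sup>2 + k \<le> C * ((rC p)\<^sup>2 + 1)"
    using size_bounds by blast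
  have "((rC p)\<^sup>2 + k) * \<bar>\<xi> (Some Rad) * (\<xi> None + \<xi> (Some Zed))\<bar> \<le> 2 * C\<^sup>2 * eV p \<xi>" for p \<xi>
  proof -
    define v where "v = \<xi> None + \<xi> (Some Zed)"
    define R where "R = (rC p)\<^sup>2 + k"
    have R: "R > 0" using rk_pos[of p] by (simp add: R_def)
    have "R \<le> C * (C * S p)" unfolding R_def using sb(2)[of p] mult_left_mono[OF sb(1)[of p], of C] C by linarith
    then have RS: "R * v\<^sup>2 \<le> C\<^sup>2 * (S p * v\<^sup>2)"
      using mult_right_mono[of R "C * (C * S p)" "v\<^sup>2"] by (simp add: power2_eq_square mult_ac)
    have "2 * \<bar>\<xi> (Some Rad) * v\<bar> \<le> (\<xi> (Some Rad))\<^sup>2 + v\<^sup>2"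
      using sum_squares_bound[of "\<bar>\<xi> (Some Rad)\<bar>" "\<bar>v\<bar>"] by (simp add: abs_mult)
    then have "R * (2 * \<bar>\<xi> (Some Rad) * v\<bar>) \<le> R * ((\<xi> (Some Rad))\<^sup>2 + v\<^sup>2)"
      using R by (intro mult_left_mono) auto
    also have "\<dots> \<le> Q0 p \<xi> + C\<^sup>2 * (S p * v\<^sup>2)"
      using Q0_parts(3)[of p \<xi>] RS by (simp add: R_def distrib_left)
    also have "\<dots> \<le> 2 * eV p \<xi> + C\<^sup>2 * (2 * eV p \<xi>)"
      using Q0_le_eV[of p \<xi>] by (intro add_mono mult_left_mono) (auto simp: v_def)
    also have "\<dots> \<le> C\<^sup>2 * (2 * eV p \<xi>) + C\<^sup>2 * (2 * eV p \<xi>)"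
      using mult_right_mono[of 1 "C\<^sup>2" "2 * eV p \<xi>"] one_le_power[OF C, of 2] eV_nonneg[of p \<xi>] by simp
    finally show ?thesis by (simp add: v_def R_def mult_ac)
  qed
  then show ?thesis by (intro exI[of _ "2 * C\<^sup>2"]) auto
qed

lemma eT_flux:
  "\<exists>C\<ge>0. \<forall>p \<xi>. ((rC p)\<^sup>2 + k) * \<bar>\<xi> (Some Rad) * \<xi> None\<bar> \<le> C * NN p \<xi>"
proof -
  obtain C where C: "C \<ge> 1" and sb: "\<And>p. (rC p)\<^sup>2 + k \<le> C * ((rC p)\<^sup>2 + 1)"
    using size_bounds by blast
  have "((rC p)\<^sup>2 + k) * \<bar>\<xi> (Some Rad) * \<xi> None\<bar> \<le> (1 + C) * NN p \<xi>" for p \<xi>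
  proof -
    define v where "v = \<xi> None"
    define R where "R = (rC p)\<^sup>2 + k"
    have R: "R > 0" using rk_pos[of p] by (simp add: R_def)
    have RS: "R * v\<^sup>2 \<le> C * (((rC p)\<^sup>2 + 1) * v\<^sup>2)"
      using mult_right_mono[OF sb[of p], of "v\<^sup>2"] by (simp add: R_def mult_ac)
    have "2 * \<bar>\<xi> (Some Rad) * v\<bar> \<le> (\<xi> (Some Rad))\<^sup>2 + v\<^sup>2"
      using sum_squares_bound[of "\<bar>\<xi> (Some Rad)\<bar>" "\<bar>v\<bar>"] by (simp add: abs_mult)
    then have "R * (2 * \<bar>\<xi> (Some Rad) * v\<bar>) \<le> R * ((\<xi> (Some Rad))\<^sup>2 + v\<^sup>2)"
      using R by (intro mult_left_mono) auto
    also have "\<dots> \<le> Q0 p \<xi> + C * (((rC p)\<^sup>2 + 1) * v\<^sup>2)"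
      using Q0_parts(3)[of p \<xi>] RS by (simp add: R_def distrib_left)
    also have "\<dots> \<le> NN p \<xi> + C * NN p \<xi>"
      using NN_parts(1,2)[of p \<xi>] Mu_parts(1)[of p \<xi>] C
      by (intro add_mono mult_left_mono) (auto simp: v_def)
    finally have "R * (2 * \<bar>\<xi> (Some Rad) * v\<bar>) \<le> (1 + C) * NN p \<xi>" by (simp add: algebra_simps)
    moreover have "0 \<le> R * \<bar>\<xi> (Some Rad) * v\<bar>" using R by simp
    ultimately show ?thesis by (simp add: v_def R_def)
  qed
  then show ?thesis using C by (intro exI[of _ "1 + C"]) auto
qed

lemma eV_le_NN: "\<exists>C\<ge>0. \<forall>p\<in>interior_pts. \<forall>\<xi>. eV p \<xi> \<le> C * NN p \<xi>"
proof -
  obtain C where C: "C \<ge> 1" and sb: "\<And>p. S p \<le> C * ((rC p)\<^sup>2 + 1)"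
    using size_bounds by blast
  obtain D where D: "D \<ge> 0" and co: "\<And>p \<xi>. p \<in> interior_pts \<Longrightarrow> ((rC p)\<^sup>2 + 1) * (\<xi> (Some Zed))\<^sup>2 \<le> D * Mu p \<xi>"
    using Mu_coercive by blast
  have "eV p \<xi> \<le> (1 + C * (2 + 2 * D)) * NN p \<xi>" if p: "p \<in> interior_pts" for p \<xi>
  proof -
    define \<rho> t z where "\<rho> = (rC p)\<^sup>2 + 1" and "t = \<xi> None" and "z = \<xi> (Some Zed)"
    have \<rho>: "\<rho> \<ge> 0" by (simp add: \<rho>_def)
    have "S p * (t + z)\<^sup>2 \<le> (C * \<rho>) * (2 * t\<^sup>2 + 2 * z\<^sup>2)"
      using sb[of p] C \<rho> by (intro mult_mono sum_sq_le) (auto simp: \<rho>_def)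
    also have "\<dots> = C * (2 * (\<rho> * t\<^sup>2) + 2 * (\<rho> * z\<^sup>2))" by (simp add: algebra_simps)
    also have "\<dots> \<le> C * (2 * NN p \<xi> + 2 * (D * NN p \<xi>))"
      using NN_parts(1)[of p \<xi>] order_trans[OF co[OF p] mult_left_mono[OF NN_parts(2) D]] C
      by (intro mult_left_mono add_mono) (auto simp: \<rho>_def t_def z_def)
    finally have "S p * (t + z)\<^sup>2 \<le> C * (2 + 2 * D) * NN p \<xi>" by (simp add: algebra_simps)
    moreover have "Q0 p \<xi> \<le> NN p \<xi>" using Mu_parts(1) NN_parts(2) by (rule order_trans)
    ultimately have "2 * eV p \<xi> \<le> (1 + C * (2 + 2 * D)) * NN p \<xi>"
      by (simp add: eV_def t_def z_def distrib_right)
    with eV_nonneg[of p \<xi>] show ?thesis by linarith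
  qed
  moreover have "0 \<le> 1 + C * (2 + 2 * D)" using C D by simp
  ultimately show ?thesis by blast
qed

lemma eT_bounds:
  "\<exists>C\<ge>0. \<exists>c>0. \<exists>R>0. \<forall>p\<in>interior_pts. \<forall>\<xi>. \<bar>eT p \<xi>\<bar> \<le> C * NN p \<xi> \<and> (R \<le> rC p \<longrightarrow> c * NN p \<xi> \<le> eT p \<xi>)"
proof -
  obtain C where C: "C \<ge> 1" and sb: "\<And>p. S p \<le> C * ((rC p)\<^sup>2 + 1)" "\<And>p. (rC p)\<^sup>2 + 1 \<le> C * S p"
    using size_bounds by blast
  obtain D where D: "D \<ge> 0" and co: "\<And>p \<xi>. p \<in> interior_pts \<Longrightarrow> ((rC p)\<^sup>2 + 1) * (\<xi> (Some Zed))\<^sup>2 \<le> D * Mu p \<xi>"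
      "\<And>p \<xi>. p \<in> interior_pts \<Longrightarrow> (\<xi> (Some Phi) + \<xi> (Some Psi))\<^sup>2 \<le> D * Mu p \<xi>"
      "\<And>p \<xi>. p \<in> interior_pts \<Longrightarrow> (Xu \<xi>)\<^sup>2 \<le> D * Mu p \<xi>"
    using Mu_coercive by blast
  define D1 D2 where "D1 = Qp + m\<^sup>2 / (\<eta> * k)" and "D2 = aa * m / k"
  have D12: "D1 > 0" "D2 > 0" using basic_pos by (simp_all add: D1_def D2_def add_pos_pos)
  define D3 where "D3 = 2 * D1\<^sup>2 * D + 8 * D2\<^sup>2 * D"
  have D3: "D3 \<ge> 0" using D by (simp add: D3_def)
  define R where "R = 1 + 2 * C\<^sup>2 * D3"
  have R: "R \<ge> 1" using D3 by (simp add: R_def)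
  have main: "\<exists>w. 2 * eT p \<xi> = Q0 p \<xi> + S p * (\<xi> None)\<^sup>2 + (Bu p \<xi>)\<^sup>2 / S p - w \<and> 0 \<le> w \<and> w * ((rC p)\<^sup>2 + 1) \<le> C * D3 * NN p \<xi>"
    if p: "p \<in> interior_pts" for p \<xi>
  proof -
    define \<rho> where "\<rho> = (rC p)\<^sup>2 + 1"
    define t z pp x where "t = \<xi> None" and "z = \<xi> (Some Zed)" and "pp = \<xi> (Some Phi) + \<xi> (Some Psi)" and "x = Xu \<xi>"
    have \<rho>: "\<rho> \<ge> 1" by (simp add: \<rho>_def)
    define P where "P = (rC p)\<^sup>2 + k"
    have P: "P \<ge> k" "P > 0" using rk_pos[of p] by (simp_all add: P_def)
    define w where "w = (Bu p \<xi> - S p * z)\<^sup>2 / S p"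
    have "2 * eT p \<xi> = Q0 p \<xi> + S p * t\<^sup>2 + (Bu p \<xi>)\<^sup>2 / S p - w"
      using S_pos[of p] by (simp add: eT_def w_def t_def z_def power2_eq_square field_simps)
    moreover have "0 \<le> w" using S_pos[of p] by (simp add: w_def)
    moreover have "w * \<rho> \<le> C * D3 * NN p \<xi>"
    proof -
      let ?M = "Mu p \<xi>"
      have b: "Bu p \<xi> - S p * z = - ((Qp + m\<^sup>2 / (\<eta> * P)) * z + aa * m / P * (pp - x))"
        by (simp add: Bu_def S_def P_def z_def pp_def x_def algebra_simps)
      have c1: "(Qp + m\<^sup>2 / (\<eta> * P))\<^sup>2 \<le> D1\<^sup>2"
        unfolding D1_def using basic_pos P
        by (intro power_mono add_mono divide_left_mono mult_left_mono mult_pos_pos add_nonneg_nonneg) auto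
      have c2: "(aa * m / P)\<^sup>2 \<le> D2\<^sup>2"
        unfolding D2_def using basic_pos P by (intro power_mono divide_left_mono) auto
      have z2: "z\<^sup>2 \<le> D * ?M"
        using mult_right_mono[OF \<rho>, of "z\<^sup>2"] co(1)[OF p, of \<xi>] by (simp add: \<rho>_def z_def)
      have "(pp - x)\<^sup>2 \<le> 2 * pp\<^sup>2 + 2 * x\<^sup>2" by (rule diff_sq_le)
      also have "\<dots> \<le> 4 * (D * ?M)" using co(2,3)[OF p, of \<xi>] by (simp add: pp_def x_def)
      finally have px: "(pp - x)\<^sup>2 \<le> 4 * (D * ?M)" .
      have "(Bu p \<xi> - S p * z)\<^sup>2 \<le> 2 * ((Qp + m\<^sup>2 / (\<eta> * P)) * z)\<^sup>2 + 2 * (aa * m / P * (pp - x))\<^sup>2"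
        unfolding b power2_minus by (rule sum_sq_le)
      also have "\<dots> \<le> 2 * (D1\<^sup>2 * (D * ?M)) + 2 * (D2\<^sup>2 * (4 * (D * ?M)))"
        unfolding power_mult_distrib[of "Qp + _"] power_mult_distrib[of "aa * m / P"]
        using c1 c2 z2 px by (intro add_mono mult_left_mono mult_mono) auto
      also have "\<dots> = D3 * ?M" by (simp add: D3_def algebra_simps)
      finally have 1: "(Bu p \<xi> - S p * z)\<^sup>2 \<le> D3 * ?M" .
      have "w * \<rho> \<le> w * (C * S p)"
        using sb(2)[of p] S_pos[of p] by (intro mult_left_mono) (auto simp: \<rho>_def w_def)
      also have "\<dots> = C * (Bu p \<xi> - S p * z)\<^sup>2" using S_pos[of p] by (simp add: w_def)
      also have "\<dots> \<le> C * (D3 * NN p \<xi>)"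
        using order_trans[OF 1 mult_left_mono[OF NN_parts(2) D3]] C by (intro mult_left_mono) auto
      finally show ?thesis by simp
    qed
    ultimately show ?thesis by (auto simp: t_def \<rho>_def)
  qed
  have "0 \<le> C + 1 + C * D3" "0 < 1 / (4 * C)" "0 < R" using C D3 R by auto
  moreover have "\<forall>p\<in>interior_pts. \<forall>\<xi>. \<bar>eT p \<xi>\<bar> \<le> (C + 1 + C * D3) * NN p \<xi> \<and>
    (R \<le> rC p \<longrightarrow> 1 / (4 * C) * NN p \<xi> \<le> eT p \<xi>)"
  proof (intro conjI ballI allI impI)
    fix p \<xi> assume p: "p \<in> interior_pts"
    define \<rho> where "\<rho> = (rC p)\<^sup>2 + 1"
    have \<rho>: "\<rho> \<ge> 1" by (simp add: \<rho>_def)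
    from main[OF p, of \<xi>] obtain w where w: "2 * eT p \<xi> = Q0 p \<xi> + S p * (\<xi> None)\<^sup>2 + (Bu p \<xi>)\<^sup>2 / S p - w"
      "0 \<le> w" "w * \<rho> \<le> C * D3 * NN p \<xi>" by (auto simp: \<rho>_def)
    have Mu: "Q0 p \<xi> + (Bu p \<xi>)\<^sup>2 / S p = Mu p \<xi>" by (simp add: Mu_def)
    have St: "S p * (\<xi> None)\<^sup>2 \<le> C * (\<rho> * (\<xi> None)\<^sup>2)" "\<rho> * (\<xi> None)\<^sup>2 \<le> C * (S p * (\<xi> None)\<^sup>2)"
      using mult_right_mono[OF sb(1)[of p], of "(\<xi> None)\<^sup>2"] mult_right_mono[OF sb(2)[of p], of "(\<xi> None)\<^sup>2"]
      by (simp_all add: \<rho>_def mult_ac)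
    have w1: "w \<le> C * D3 * NN p \<xi>"
      using w(2,3) mult_left_mono[OF \<rho> w(2)] by simp
    have "S p * (\<xi> None)\<^sup>2 \<le> C * NN p \<xi>"
      using order_trans[OF St(1)[unfolded \<rho>_def] mult_left_mono[OF NN_parts(1)[of p \<xi>], of C]] C by simp
    moreover have "0 \<le> S p * (\<xi> None)\<^sup>2" using S_pos[of p] by simp
    moreover have "0 \<le> Mu p \<xi>" "Mu p \<xi> \<le> NN p \<xi>" by (rule Mu_parts NN_parts)+
    ultimately have "\<bar>2 * eT p \<xi>\<bar> \<le> C * NN p \<xi> + NN p \<xi> + C * D3 * NN p \<xi>"
      using w(1,2) w1 Mu by (intro abs_leI) linarith+
    then show "\<bar>eT p \<xi>\<bar> \<le> (C + 1 + C * D3) * NN p \<xi>"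
      by (simp add: distrib_right)
    assume Rp: "R \<le> rC p"
    have "R \<le> R * R" using mult_left_mono[OF R, of R] R by simp
    also have "\<dots> \<le> rC p * rC p" using Rp R by (intro mult_mono) auto
    finally have \<rho>R: "2 * C\<^sup>2 * D3 \<le> \<rho>" by (simp add: \<rho>_def R_def power2_eq_square)
    have "C * (2 * w) \<le> NN p \<xi>"
    proof -
      have "\<rho> * (C * (2 * w)) \<le> (2 * C\<^sup>2 * D3) * NN p \<xi>"
        using mult_left_mono[OF w(3), of "2 * C"] C by (simp add: power2_eq_square mult_ac)
      also have "\<dots> \<le> \<rho> * NN p \<xi>" using \<rho>R NN_parts(3) by (intro mult_right_mono)
      finally show ?thesis using \<rho> by simp
    qed
    moreover have "NN p \<xi> \<le> C * (2 * eT p \<xi> + w)"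
    proof -
      have "NN p \<xi> = \<rho> * (\<xi> None)\<^sup>2 + Mu p \<xi>" by (simp add: NN_def \<rho>_def)
      also have "\<dots> \<le> C * (S p * (\<xi> None)\<^sup>2) + C * Mu p \<xi>"
        using St(2) mult_right_mono[OF C Mu_parts(3)[of p \<xi>]] by simp
      also have "\<dots> = C * (S p * (\<xi> None)\<^sup>2 + Mu p \<xi>)" by (simp add: distrib_left)
      also have "S p * (\<xi> None)\<^sup>2 + Mu p \<xi> = 2 * eT p \<xi> + w" using w(1) Mu by simp
      finally show ?thesis .
    qed
    ultimately have "NN p \<xi> \<le> 4 * C * eT p \<xi>" by (simp add: algebra_simps)
    then show "1 / (4 * C) * NN p \<xi> \<le> eT p \<xi>" using C by (simp add: field_simps)
  qed
  ultimately show ?thesis by blast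
qed

lemma NN_le_inner:
  "\<exists>C\<ge>0. \<forall>p\<in>interior_pts. \<forall>\<xi>. rC p \<le> R \<longrightarrow> NN p \<xi> \<le> C * (eV p \<xi> + (\<xi> (Some Phi))\<^sup>2 + (\<xi> (Some Psi))\<^sup>2)"
proof -
  obtain C where C: "C \<ge> 1" and sb: "\<And>p. (rC p)\<^sup>2 + 1 \<le> C * S p" "\<And>p. (rC p)\<^sup>2 + k \<le> C * ((rC p)\<^sup>2 + 1)"
    "\<And>p. \<bar>f p + Qs\<bar> \<le> C * ((rC p)\<^sup>2 + 1)"
    using size_bounds by blast
  define K where "K = R\<^sup>2 + 1"
  have K: "K \<ge> 1" by (simp add: K_def)
  define D2 where "D2 = aa * m / k"
  define Kx where "Kx = (2 * K * (2 * C * K) + 2 * K\<^sup>2 * 2) / k\<^sup>2"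
  define Kz where "Kz = (2 * Kx + 2 * (2 * N\<^sup>2 + 2 * (N + 1)\<^sup>2)) / Rz\<^sup>2"
  define Kt where "Kt = 2 * (2 * C) + 2 * Kz"
  define Kb where "Kb = 2 * ((C * K)\<^sup>2 * Kz) + 2 * (D2\<^sup>2 * (2 * 2 + 2 * Kx))"
  define F where "F = K * Kt + 2 + C * Kb"
  have nn: "Kx \<ge> 0" using C K by (simp add: Kx_def)
  then have nn2: "Kz \<ge> 0" by (simp add: Kz_def)
  then have nn3: "Kt \<ge> 0" "Kb \<ge> 0" using C nn by (simp_all add: Kt_def Kb_def)
  have "NN p \<xi> \<le> F * (eV p \<xi> + (\<xi> (Some Phi))\<^sup>2 + (\<xi> (Some Psi))\<^sup>2)"
    if p: "p \<in> interior_pts" and pR: "rC p \<le> R" for p \<xi>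
  proof -
    define E where "E = eV p \<xi> + (\<xi> (Some Phi))\<^sup>2 + (\<xi> (Some Psi))\<^sup>2"
    define r where "r = rC p"
    have r: "r > 0" using interior_nz[OF p] by (simp add: r_def)
    define \<rho> where "\<rho> = r\<^sup>2 + 1"
    have "r\<^sup>2 \<le> R\<^sup>2" using pR r by (intro power_mono) (auto simp: r_def)
    then have \<rho>: "\<rho> \<ge> 1" "\<rho> \<le> K" "r\<^sup>2 \<le> K" by (simp_all add: \<rho>_def K_def)
    define P where "P = r\<^sup>2 + k"
    have P: "P \<ge> k" "P > 0" using rk_pos[of p] by (simp_all add: P_def r_def)
    have PK: "P \<le> C * K"
      using order_trans[OF sb(2)[of p] mult_left_mono[OF \<rho>(2)[unfolded \<rho>_def r_def], of C]] C
      by (simp add: P_def r_def)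
    define t z ph ps pp x where "t = \<xi> None" and "z = \<xi> (Some Zed)" and "ph = \<xi> (Some Phi)"
      and "ps = \<xi> (Some Psi)" and "pp = ph + ps" and "x = Xu \<xi>"
    have E: "eV p \<xi> \<le> E" "ph\<^sup>2 \<le> E" "ps\<^sup>2 \<le> E" "0 \<le> E" and pp0: "ph\<^sup>2 + ps\<^sup>2 \<le> E"
      using eV_nonneg[of p \<xi>] by (simp_all add: E_def ph_def ps_def)
    have Q: "Q0 p \<xi> \<le> 2 * E" using Q0_le_eV(1)[of p \<xi>] E by linarith
    have "1 \<le> C * S p" by (rule order_trans[OF \<rho>(1)[unfolded \<rho>_def r_def] sb(1)[of p]])
    then have CS: "1 / S p \<le> C" using S_pos[of p] by (simp add: field_simps)
    have v: "(t + z)\<^sup>2 \<le> (2 * C) * E"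
    proof -
      have "1 * (t + z)\<^sup>2 \<le> (C * S p) * (t + z)\<^sup>2" using \<open>1 \<le> C * S p\<close> by (intro mult_right_mono) auto
      also have "\<dots> = C * (S p * (t + z)\<^sup>2)" by simp
      also have "\<dots> \<le> C * (2 * E)"
        using Q0_le_eV(2)[of p \<xi>] E C by (intro mult_left_mono) (auto simp: t_def z_def)
      finally show ?thesis by simp
    qed
    have pp: "pp\<^sup>2 \<le> 2 * E" using sum_sq_le[of ph ps] pp0 by (simp add: pp_def)
    define w where "w = k * x / r + r * pp"
    have w: "w\<^sup>2 \<le> 2 * E * (C * K)"
    proof -
      have "w\<^sup>2 \<le> Q0 p \<xi> * P"
        using Q0_parts(1)[of \<xi> p] by (simp add: w_def x_def r_def pp_def ph_def ps_def P_def)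
      also have "\<dots> \<le> 2 * E * (C * K)"
        using Q PK P E by (intro mult_mono) auto
      finally show ?thesis .
    qed
    have kx: "k * x = r * w - r\<^sup>2 * pp" using r by (simp add: w_def power2_eq_square algebra_simps)
    have "k\<^sup>2 * x\<^sup>2 = (r * w - r\<^sup>2 * pp)\<^sup>2" unfolding kx[symmetric] by (simp add: power_mult_distrib)
    also have "\<dots> \<le> 2 * (r * w)\<^sup>2 + 2 * (r\<^sup>2 * pp)\<^sup>2" by (rule diff_sq_le)
    also have "\<dots> = 2 * (r\<^sup>2 * w\<^sup>2) + 2 * ((r\<^sup>2)\<^sup>2 * pp\<^sup>2)" by (simp add: power_mult_distrib)
    also have "\<dots> \<le> 2 * (K * (2 * E * (C * K))) + 2 * (K\<^sup>2 * (2 * E))"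
      using w pp \<rho> K by (intro add_mono mult_left_mono mult_mono power_mono) auto
    also have "\<dots> = (k\<^sup>2 * Kx) * E"
    proof -
      have "k\<^sup>2 * Kx = 2 * K * (2 * C * K) + 2 * K\<^sup>2 * 2" using basic_pos by (simp add: Kx_def)
      then show ?thesis by (simp add: algebra_simps)
    qed
    also have "\<dots> = k\<^sup>2 * (Kx * E)" by simp
    finally have x: "x\<^sup>2 \<le> Kx * E" using basic_pos by simp
    have "Rz * z = x + (N * ph - (N + 1) * ps)" by (simp add: x_def Xu_def z_def ph_def ps_def)
    then have "Rz\<^sup>2 * z\<^sup>2 = (x + (N * ph - (N + 1) * ps))\<^sup>2" by (metis power_mult_distrib)
    also have "\<dots> \<le> 2 * x\<^sup>2 + 2 * (N * ph - (N + 1) * ps)\<^sup>2" by (rule sum_sq_le)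
    also have "\<dots> \<le> 2 * x\<^sup>2 + 2 * (2 * (N * ph)\<^sup>2 + 2 * ((N + 1) * ps)\<^sup>2)"
      by (intro add_left_mono mult_left_mono diff_sq_le) auto
    also have "\<dots> \<le> 2 * (Kx * E) + 2 * (2 * (N\<^sup>2 * E) + 2 * ((N + 1)\<^sup>2 * E))"
      unfolding power_mult_distrib using x E by (intro add_mono mult_left_mono) auto
    also have "\<dots> = (Rz\<^sup>2 * Kz) * E"
    proof -
      have "Rz\<^sup>2 * Kz = 2 * Kx + 2 * (2 * N\<^sup>2 + 2 * (N + 1)\<^sup>2)" using Rz_pos by (simp add: Kz_def)
      then show ?thesis by (simp add: algebra_simps)
    qed
    also have "\<dots> = Rz\<^sup>2 * (Kz * E)" by simp
    finally have z: "z\<^sup>2 \<le> Kz * E" using Rz_pos by simp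
    have "t = (t + z) - z" by simp
    then have "t\<^sup>2 \<le> 2 * (t + z)\<^sup>2 + 2 * z\<^sup>2" by (metis diff_sq_le)
    also have "\<dots> \<le> Kt * E" using v z by (simp add: Kt_def algebra_simps)
    finally have t: "t\<^sup>2 \<le> Kt * E" .
    have "(Bu p \<xi>)\<^sup>2 = ((f p + Qs) * z - aa * m / P * (pp - x))\<^sup>2"
      by (simp add: Bu_def P_def r_def z_def pp_def ph_def ps_def x_def)
    also have "\<dots> \<le> 2 * ((f p + Qs) * z)\<^sup>2 + 2 * (aa * m / P * (pp - x))\<^sup>2" by (rule diff_sq_le)
    also have "\<dots> \<le> 2 * ((C * K)\<^sup>2 * (Kz * E)) + 2 * (D2\<^sup>2 * (2 * (2 * E) + 2 * (Kx * E)))"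
    proof -
      have "\<bar>f p + Qs\<bar> \<le> C * K"
        using order_trans[OF sb(3)[of p] mult_left_mono[OF \<rho>(2)[unfolded \<rho>_def r_def], of C]] C by simp
      then have "(f p + Qs)\<^sup>2 \<le> (C * K)\<^sup>2" using C K by (simp flip: abs_le_square_iff)
      moreover have "(aa * m / P)\<^sup>2 \<le> D2\<^sup>2"
        unfolding D2_def using basic_pos P by (intro power_mono divide_left_mono) auto
      moreover have "(pp - x)\<^sup>2 \<le> 2 * (2 * E) + 2 * (Kx * E)" using diff_sq_le[of pp x] pp x by linarith
      ultimately show ?thesis
        unfolding power_mult_distrib[of "f p + Qs"] power_mult_distrib[of "aa * m / P"]
        using z by (intro add_mono mult_left_mono mult_mono) auto
    qed
    also have "\<dots> = Kb * E" by (simp add: Kb_def algebra_simps)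
    finally have B: "(Bu p \<xi>)\<^sup>2 \<le> Kb * E" .
    have "(Bu p \<xi>)\<^sup>2 / S p = 1 / S p * (Bu p \<xi>)\<^sup>2" by simp
    also have "\<dots> \<le> C * (Kb * E)" using CS B C by (intro mult_mono) auto
    finally have BS: "(Bu p \<xi>)\<^sup>2 / S p \<le> C * (Kb * E)" .
    have "NN p \<xi> = \<rho> * t\<^sup>2 + Q0 p \<xi> + (Bu p \<xi>)\<^sup>2 / S p"
      by (simp add: NN_def Mu_def \<rho>_def r_def t_def)
    also have "\<dots> \<le> K * (Kt * E) + 2 * E + C * (Kb * E)"
      using t \<rho> Q BS K by (intro add_mono mult_mono) auto
    also have "\<dots> = F * E" by (simp add: F_def algebra_simps)
    finally show ?thesis by (simp add: E_def)
  qed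
  moreover have "F \<ge> 0" using nn nn2 nn3 C K by (simp add: F_def)
  ultimately show ?thesis by blast
qed

section \<open>The energy norm and the volume form\<close>

lemma on_slice_nth [simp]: "on_slice s x $ None = s" "on_slice s x $ Some j = x $ j"
  by (simp_all add: on_slice_def)

lemma G_expand: "G p v w = (\<Sum>l\<in>UNIV. w $ l * G p v (axis l 1))"
  unfolding sum_coords G_def Let_def by (simp add: axis_def algebra_simps add_divide_distrib)

lemma bilinear_g_bar: "p \<in> regular \<Longrightarrow> bilinear (g_bar p)"
  unfolding bilinear_def linear_iff g_bar_def G_def
  by (simp add: g_eq G_def Let_def add_divide_distrib diff_divide_distrib algebra_simps)

lemma g_bar_sym: "p \<in> regular \<Longrightarrow> g_bar p v w = g_bar p w v"
  by (simp add: g_bar_def g_eq G_sym)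

lemma g_bar_pos:
  assumes p: "p \<in> regular" and w: "w \<noteq> 0"
  shows "g_bar p w w > 0"
proof -
  have pi: "p \<in> interior_pts" using p by (simp add: regular_interior)
  define v where "v = on_slice 0 w"
  define \<xi> where "\<xi> l = G p v (axis l 1)" for l
  have raise: "(\<Sum>l\<in>UNIV. \<xi> l * Hm p l j) = (hf p)\<^sup>2 * v $ j" for j
    unfolding \<xi>_def by (rule G_Hm[OF p])
  have "- S p * (\<xi> None + \<xi> (Some Zed)) + Bu p \<xi> = 0"
    using raise[of None] unfolding Hm_None_sum by (simp add: v_def)
  then have B: "Bu p \<xi> = S p * (\<xi> None + \<xi> (Some Zed))" by simp
  have "(hf p)\<^sup>2 * G p v v = (\<Sum>i\<in>UNIV. (\<Sum>j\<in>UNIV. \<xi> j * Hm p j i) * \<xi> i)"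
    unfolding raise G_expand[of p v v] by (simp add: \<xi>_def sum_distrib_left mult.assoc)
  also have "\<dots> = Mu p \<xi>"
    unfolding Hm_form[OF pi] Mu_def B using S_pos[of p] by (simp add: power2_eq_square)
  finally have M: "(hf p)\<^sup>2 * G p v v = Mu p \<xi>" .
  have "Mu p \<xi> \<noteq> 0"
  proof
    assume 0: "Mu p \<xi> = 0"
    have Q: "Q0 p \<xi> = 0" using Mu_parts(1)[of p \<xi>] Q0_parts(5)[of p \<xi>] 0 by simp
    have R: "(rC p)\<^sup>2 + k > 0" by (rule rk_pos)
    obtain C where "((rC p)\<^sup>2 + 1) * (\<xi> (Some Zed))\<^sup>2 \<le> C * Mu p \<xi>"
      "(\<xi> (Some Phi))\<^sup>2 \<le> C * Mu p \<xi>" "(\<xi> (Some Psi))\<^sup>2 \<le> C * Mu p \<xi>"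
      using Mu_coercive pi by blast
    then have "((rC p)\<^sup>2 + 1) * (\<xi> (Some Zed))\<^sup>2 \<le> 0" and ph: "\<xi> (Some Phi) = 0" "\<xi> (Some Psi) = 0"
      using 0 by simp_all
    then have z: "\<xi> (Some Zed) = 0"       using zero_le_power2[of "rC p"] by (auto simp: mult_le_0_iff)
    have "((rC p)\<^sup>2 + k) * (\<xi> (Some Rad))\<^sup>2 \<le> 0" "(\<xi> (Some Theta))\<^sup>2 \<le> 0"
      using Q0_parts(3)[of p \<xi>] Q0_parts(4)[of \<xi> p] Q by simp_all
    then have r: "\<xi> (Some Rad) = 0" "\<xi> (Some Theta) = 0" using R by (simp_all add: mult_le_0_iff)
    have "(Bu p \<xi>)\<^sup>2 \<le> 0" using Mu_parts(2)[of p \<xi>] 0 by simp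
    then have "\<xi> None = 0" using B z S_pos[of p] by simp
    then have "\<xi> l = 0" for l
      using z ph r by (cases l rule: option.exhaust) (auto, metis spatial.exhaust)
    then have "v $ j = 0" for j using raise[of j] hf_pos[of p] by simp
    then have "w = 0" by (metis v_def on_slice_nth(2) vec_eq_iff zero_index)
    with w show False ..
  qed
  with Mu_parts(3)[of p \<xi>] have "(hf p)\<^sup>2 * G p v v > 0" unfolding M by simp
  then have "G p v v > 0" using hf_pos[of p] by (simp add: zero_less_mult_iff)
  then show ?thesis using hf_pos[of p] by (simp add: g_bar_def v_def g_eq[OF p])
qed

lemma DIM_slice: "DIM(slice_coords) = 5"
proof -
  have "CARD(spatial) = 5" by (simp add: UNIV_spatial)
  then show ?thesis by simp
qed

lemma dirderiv_expand:
  assumes "U differentiable (at p)"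
  shows "dirderiv v U p = (\<Sum>i\<in>UNIV. v $ i * pd i U p)"
proof -
  have lin: "linear (frechet_derivative U (at p))" using assms by (rule linear_frechet_derivative)
  have "dirderiv v U p = frechet_derivative U (at p) (\<Sum>i\<in>UNIV. v $ i *\<^sub>R axis i 1)"
    unfolding dirderiv_def by (simp add: basis_expansion[of v, unfolded scalar_mult_eq_scaleR])
  then show ?thesis by (simp add: pd_def dirderiv_def linear_sum[OF lin] linear_cmul[OF lin])
qed

lemma grad_sq_eq:
  assumes p: "p \<in> regular" and U: "U differentiable (at p)"
  shows "grad_sq U p = (pd None U p)\<^sup>2 + Mu p (\<lambda>i. pd i U p) / hf p"
proof -
  have pi: "p \<in> interior_pts" using p by (simp add: regular_interior)
  define \<xi> where "\<xi> i = pd i U p" for i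
  define \<xi>' where "\<xi>' = (\<lambda>i. if i = None then Bu p \<xi> / S p - \<xi> (Some Zed) else \<xi> i)"
  define V :: coords where "V = (\<chi> i. (\<Sum>l\<in>UNIV. \<xi>' l * Hm p l i) / hf p)"
  define W :: slice_coords where "W = (\<chi> j. V $ Some j)"
  have B': "Bu p \<xi>' = Bu p \<xi>" and Q': "Q0 p \<xi>' = Q0 p \<xi>"
    by (simp_all add: \<xi>'_def Bu_def Q0_def Xu_def)
  have V0: "V $ None = 0"
    using S_pos[of p] by (simp add: V_def Hm_None_sum B') (simp add: \<xi>'_def)
  have VW: "on_slice 0 W = V"
    using V0 by (auto simp: vec_eq_iff W_def on_slice_def split: option.splits)
  have "g_inv p *v (\<chi> i. \<xi>' i) = V"
    by (simp add: vec_eq_iff V_def g_inv_def matrix_vector_mult_def sum_divide_distrib mult_ac Hm_sym[of p])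
  then have "g_matrix p *v V = (\<chi> i. \<xi>' i)"
    using g_matrix_inverse(1)[OF p] by (metis matrix_vector_mul_assoc matrix_vector_mul_lid)
  then have gV: "(\<Sum>j\<in>UNIV. g p (axis i 1) (axis j 1) * V $ j) = \<xi>' i" for i
    by (simp add: vec_eq_iff matrix_vector_mult_def g_matrix_def)
  have gVi: "g p V (axis i 1) = \<xi>' i" for i
  proof -
    have "g p V (axis i 1) = G p (axis i 1) V / hf p" using g_eq[OF p] G_sym by simp
    also have "\<dots> = (\<Sum>j\<in>UNIV. g p (axis i 1) (axis j 1) * V $ j)"
      unfolding G_expand[of p "axis i 1" V] by (simp add: g_eq[OF p] sum_divide_distrib mult.commute)
    finally show ?thesis using gV by simp
  qed
  have riesz: "g_bar p W w = dirderiv (on_slice 0 w) U p" for w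
  proof -
    have "g_bar p W w = (\<Sum>i\<in>UNIV. on_slice 0 w $ i * g p V (axis i 1))"
      unfolding g_bar_def VW g_eq[OF p] G_expand[of p V "on_slice 0 w"] by (simp add: sum_divide_distrib)
    also have "\<dots> = (\<Sum>i\<in>UNIV. on_slice 0 w $ i * \<xi> i)"
      unfolding gVi sum_coords by (simp add: \<xi>'_def)
    finally show ?thesis unfolding dirderiv_expand[OF U] \<xi>_def .
  qed
  have "g_bar p W W = (\<Sum>i\<in>UNIV. V $ i * \<xi>' i)"
    unfolding riesz dirderiv_expand[OF U] VW sum_coords using V0 by (simp add: \<xi>'_def \<xi>_def)
  also have "\<dots> = (\<Sum>i\<in>UNIV. (\<Sum>j\<in>UNIV. \<xi>' j * Hm p j i) * \<xi>' i) / hf p"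
    by (subst sum_divide_distrib) (simp add: V_def)
  also have "\<dots> = Mu p \<xi> / hf p"
    unfolding Hm_form[OF pi] B' Q' using S_pos[of p]
    by (simp add: \<xi>'_def Mu_def power2_eq_square)
  finally have WW: "g_bar p W W = Mu p \<xi> / hf p" .
  obtain X :: "nat \<Rightarrow> slice_coords" where "orthonormal_frame p X"
    using orthonormal_frame_exists[OF bilinear_g_bar[OF p] g_bar_sym[OF p] g_bar_pos[OF p]]
    unfolding DIM_slice orthonormal_frame_def by blast
  then have X: "orthonormal_frame p (SOME X. orthonormal_frame p X)"
    by (rule someI[where P = "orthonormal_frame p"])
  define Y where "Y = (SOME X. orthonormal_frame p X)"
  have "g_bar p W W = (\<Sum>A\<in>{1..5}. (g_bar p W (Y A))\<^sup>2)"
    using orthonormal_frame_expansion[OF bilinear_g_bar[OF p], of Y W] X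
    unfolding DIM_slice orthonormal_frame_def Y_def by blast
  then have "(\<Sum>A\<in>{1..5}. (dirderiv (on_slice 0 (Y A)) U p)\<^sup>2) = Mu p \<xi> / hf p"
    unfolding riesz[symmetric] using WW by simp
  then show ?thesis
    unfolding grad_sq_def Let_def Y_def[symmetric] by (simp add: \<xi>_def[abs_def])
qed

lemma grad_sq_dvol_bounds:
  "\<exists>C>0. \<forall>p\<in>regular. \<forall>U. U differentiable (at p) \<longrightarrow>
     grad_sq U p * dvol_density p \<le> C * (wt p * NN p (\<lambda>i. pd i U p)) \<and>
     wt p * NN p (\<lambda>i. pd i U p) \<le> C * (grad_sq U p * dvol_density p)"
proof -
  obtain C where C: "C \<ge> 1" and sb: "\<And>p. (rC p)\<^sup>2 + 1 \<le> C * hf p" "\<And>p. hf p \<le> C * ((rC p)\<^sup>2 + 1)"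
    "\<And>p. (rC p)\<^sup>2 + 1 \<le> C * S p" "\<And>p. S p \<le> C * ((rC p)\<^sup>2 + 1)"
    using size_bounds by blast
  have "grad_sq U p * dvol_density p \<le> C\<^sup>2 * (wt p * NN p (\<lambda>i. pd i U p)) \<and>
     wt p * NN p (\<lambda>i. pd i U p) \<le> C\<^sup>2 * (grad_sq U p * dvol_density p)"
    if p: "p \<in> regular" and U: "U differentiable (at p)" for p U
  proof -
    define \<rho> where "\<rho> = (rC p)\<^sup>2 + 1"
    have \<rho>: "\<rho> \<ge> 1" by (simp add: \<rho>_def)
    define \<sigma> where "\<sigma> = sqrt (hf p * S p)"
    define t M where "t = (pd None U p)\<^sup>2" and "M = Mu p (\<lambda>i. pd i U p)"
    have tM: "t \<ge> 0" "M \<ge> 0" by (auto simp: t_def M_def Mu_parts)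
    note pos = hf_pos[of p] S_pos[of p]
    have D: "grad_sq U p * dvol_density p = wt p * (\<sigma> * t + \<sigma> / hf p * M)"
      unfolding grad_sq_eq[OF p U] dvol_density_eq[OF p] by (simp add: \<sigma>_def t_def M_def algebra_simps)
    have NN: "NN p (\<lambda>i. pd i U p) = \<rho> * t + M" by (simp add: NN_def \<rho>_def t_def M_def)
    have "hf p * S p \<le> (C * \<rho>) * (C * \<rho>)" using sb pos C by (intro mult_mono) (auto simp: \<rho>_def)
    then have s1: "\<sigma> \<le> C * \<rho>" unfolding \<sigma>_def using C \<rho> by (intro real_le_lsqrt) (auto simp: power2_eq_square)
    have "\<rho> * \<rho> \<le> (C * hf p) * (C * S p)" using sb pos C \<rho> by (intro mult_mono) (auto simp: \<rho>_def)
    then have "(\<rho> / C)\<^sup>2 \<le> hf p * S p" using C by (simp add: power2_eq_square field_simps)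
    then have "\<rho> / C \<le> \<sigma>" unfolding \<sigma>_def by (rule real_le_rsqrt)
    then have s2: "\<rho> \<le> C * \<sigma>" using C by (simp add: field_simps)
    have \<sigma>0: "\<sigma> > 0" using pos by (simp add: \<sigma>_def)
    have h1: "\<sigma> / hf p \<le> C\<^sup>2"
    proof -
      have "\<sigma> \<le> C * (C * hf p)" using s1 mult_left_mono[OF sb(1)[of p, folded \<rho>_def], of C] C by linarith
      then show ?thesis using pos by (simp add: field_simps power2_eq_square)
    qed
    have h2: "1 \<le> C\<^sup>2 * (\<sigma> / hf p)"
    proof -
      have "hf p \<le> C * (C * \<sigma>)" using sb(2)[of p, folded \<rho>_def] mult_left_mono[OF s2, of C] C by linarith
      then show ?thesis using pos by (simp add: field_simps power2_eq_square)
    qed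
    have CC: "C \<le> C\<^sup>2" using C mult_left_mono[of 1 C C] by (simp add: power2_eq_square)
    have s1': "\<sigma> \<le> C\<^sup>2 * \<rho>" using s1 mult_right_mono[OF CC, of \<rho>] \<rho> by linarith
    have s2': "\<rho> \<le> C\<^sup>2 * \<sigma>" using s2 mult_right_mono[OF CC, of \<sigma>] \<sigma>0 by linarith
    have "\<sigma> * t + \<sigma> / hf p * M \<le> (C\<^sup>2 * \<rho>) * t + C\<^sup>2 * M"
      using s1' h1 tM by (intro add_mono mult_right_mono)
    then have 1: "\<sigma> * t + \<sigma> / hf p * M \<le> C\<^sup>2 * (\<rho> * t + M)" by (simp add: algebra_simps)
    have "\<rho> * t + 1 * M \<le> (C\<^sup>2 * \<sigma>) * t + (C\<^sup>2 * (\<sigma> / hf p)) * M"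
      using s2' h2 tM by (intro add_mono mult_right_mono)
    then have 2: "\<rho> * t + M \<le> C\<^sup>2 * (\<sigma> * t + \<sigma> / hf p * M)" by (simp add: algebra_simps)
    have w: "wt p \<ge> 0" using wt_pos[OF p] by simp
    show ?thesis
      unfolding D NN using mult_left_mono[OF 1 w] mult_left_mono[OF 2 w] by (simp add: mult_ac)
  qed
  then show ?thesis using C by (intro exI[of _ "C\<^sup>2"]) auto
qed

end

section \<open>Partial derivatives in coordinates\<close>

lemma pd_add: "F differentiable (at p) \<Longrightarrow> G differentiable (at p) \<Longrightarrow>
    pd i (\<lambda>q. F q + G q) p = pd i F p + pd i G p"
  by (simp add: pd_def dirderiv_def frechet_derivative_add)

lemma pd_mult: "F differentiable (at p) \<Longrightarrow> G differentiable (at p) \<Longrightarrow>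
    pd i (\<lambda>q. F q * G q) p = F p * pd i G p + pd i F p * G p"
  by (simp add: pd_def dirderiv_def frechet_derivative_mult)

lemma pd_sum: "(\<And>l. l \<in> I \<Longrightarrow> F l differentiable (at p)) \<Longrightarrow>
    pd i (\<lambda>q. \<Sum>l\<in>I. F l q) p = (\<Sum>l\<in>I. pd i (F l) p)"
  by (simp add: pd_def dirderiv_def frechet_derivative_sum)

lemma pd_cong_open:
  assumes "open S" "p \<in> S" "\<And>q. q \<in> S \<Longrightarrow> F q = G q" "F differentiable (at p)"
  shows "pd i F p = pd i G p"
  unfolding pd_def dirderiv_def
  using frechet_derivative_transform_within_open[OF assms(4,1,2,3)] by simp

lemma pd_line:
  "F differentiable (at p) \<Longrightarrow> ((\<lambda>s. F (p + s *\<^sub>R axis i 1)) has_real_derivative pd i F p) (at 0)"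
  using differentiable_along_line[of F p 0 "axis i 1"] by (simp add: pd_def dirderiv_def)

lemma pd_eqI:
  assumes "F differentiable (at p)" "((\<lambda>s. F (p + s *\<^sub>R axis i 1)) has_real_derivative d) (at 0)"
  shows "pd i F p = d"
  using pd_line[OF assms(1)] assms(2) by (rule DERIV_unique)

lemma pd_translate:
  assumes "\<And>q. F (q + a) = F q" "F differentiable (at p)"
  shows "F differentiable (at (p + a))" "pd i F (p + a) = pd i F p"
proof -
  have "((\<lambda>q. q + - a) has_derivative (\<lambda>h. h)) (at (p + a))"
    by (auto intro!: derivative_eq_intros)
  then have "((\<lambda>q. F (q + - a)) has_derivative frechet_derivative F (at p)) (at (p + a))"
    using has_derivative_compose[of "\<lambda>q. q + - a" "\<lambda>h. h" "p + a" UNIV F "frechet_derivative F (at p)"]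
      has_derivative_frechet[OF assms(2)]
    by simp
  moreover have "F (q + - a) = F q" for q using assms(1)[of "q + - a"] by simp
  ultimately have "(F has_derivative frechet_derivative F (at p)) (at (p + a))" by simp
  then show "F differentiable (at (p + a))" "pd i F (p + a) = pd i F p"
    by (auto simp: differentiable_def pd_def dirderiv_def dest: frechet_derivative_eqI)
qed

lemma pd_invariant_0:
  assumes "F differentiable (at p)" "\<And>s. F (p + s *\<^sub>R axis i 1) = F p"
  shows "pd i F p = 0"
  by (rule pd_eqI[OF assms(1)]) (simp add: assms(2))

lemma Ck_pd: "Ck (Suc l) U \<Longrightarrow> Ck l (pd i U)"
  unfolding pd_def[abs_def] dirderiv_def[abs_def] by simp

lemma smooth_pd: "smooth U \<Longrightarrow> smooth (pd i U)"
  unfolding smooth_def using Ck_pd by blast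

lemma smooth_differentiable: "smooth U \<Longrightarrow> U differentiable (at p)"
  unfolding smooth_def by (metis Ck.simps(2))

lemma smooth_C1_on: "smooth U \<Longrightarrow> C1_on S U"
  unfolding smooth_def using Ck_C1_on by blast

lemma smooth_continuous: "smooth U \<Longrightarrow> continuous_on S U"
  unfolding smooth_def using Ck_continuous continuous_on_subset by blast

lemma pd_commute: "smooth U \<Longrightarrow> pd i (pd j U) p = pd j (pd i U) p"
  using second_derivative_symmetric[of U "axis j 1" p "axis i 1"]
  by (simp add: smooth_def pd_def[abs_def] dirderiv_def[abs_def])

lemma C1_on_pd_continuous: "C1_on S F \<Longrightarrow> continuous_on S (pd i F)"
  unfolding pd_def[abs_def] dirderiv_def[abs_def] by (rule C1_onD(2))

lemma C1_on_nth: "C1_on S (\<lambda>p :: coords. p $ i)"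
  by (rule Ck_C1_on[OF Ck_bounded_linear[OF bounded_linear_vec_nth]])

lemma on_slice_add: "on_slice t (x + s *\<^sub>R axis j 1) = on_slice t x + s *\<^sub>R axis (Some j) 1"
  by (auto simp: on_slice_def vec_eq_iff axis_def split: option.splits)

lemma on_slice_add_time: "on_slice (t + s) x = on_slice t x + s *\<^sub>R axis None 1"
  by (auto simp: on_slice_def vec_eq_iff axis_def split: option.splits)

lemma continuous_on_slice: "continuous_on S (\<lambda>(t, x). on_slice t x)"
  unfolding on_slice_def case_prod_beta
proof (rule continuous_on_vec_lambda)
  show "continuous_on S (\<lambda>x. case i of None \<Rightarrow> fst x | Some j \<Rightarrow> snd x $ j)" for i :: "spatial option"
    by (cases i) (auto intro!: continuous_intros)
qed

lemma continuous_on_slice': "continuous_on S (on_slice t)"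
  using continuous_on_compose2[OF continuous_on_slice[of UNIV], of S "\<lambda>x. (t, x)"]
    continuous_on_Pair[OF continuous_on_const continuous_on_id]
  by auto

context three_charge_microstate
begin

section \<open>The wave equation in coordinates\<close>

definition AA :: "coords \<Rightarrow> spatial option \<Rightarrow> spatial option \<Rightarrow> real" where
  "AA q i j = wt q * Hm q i j"

definition wave_op :: "(coords \<Rightarrow> real) \<Rightarrow> coords \<Rightarrow> real" where
  "wave_op U p = (\<Sum>i\<in>UNIV. pd i (\<lambda>q. \<Sum>j\<in>UNIV. AA q i j * pd j U q) p)"

definition periodic :: "(coords \<Rightarrow> real) \<Rightarrow> bool" where
  "periodic U \<longleftrightarrow> (\<forall>p. U (p + (2 * pi) *\<^sub>R axis (Some Phi) 1) = U p \<and>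
     U (p + (2 * pi) *\<^sub>R axis (Some Psi) 1) = U p \<and> U (p + (2 * pi * Rz) *\<^sub>R axis (Some Zed) 1) = U p)"

definition coord_solution :: "(coords \<Rightarrow> real) \<Rightarrow> bool" where
  "coord_solution U \<longleftrightarrow> smooth U \<and> periodic U \<and> (\<forall>p\<in>interior_pts. wave_op U p = 0)"

lemma open_interior: "open interior_pts"
  unfolding interior_pts_def
  by (intro open_Collect_conj open_Collect_less continuous_intros)

lemma f_continuous: "continuous_on A f"
  unfolding f_def[abs_def] by (intro continuous_intros)

lemma open_regular: "open regular"
  unfolding regular_def
  by (intro open_Collect_conj open_Collect_less open_Collect_neq continuous_intros f_continuous)

lemma C1_on_f: "C1_on A f"
  unfolding f_def[abs_def]
  by (intro C1_on_add C1_on_mult C1_on_const C1_on_power C1_on_sin C1_on_cos C1_on_nth)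

lemma C1_on_AA: "C1_on interior_pts (\<lambda>q. AA q i j)"
proof -
  have nz: "rC p \<noteq> 0" "sin (thC p) \<noteq> 0" "cos (thC p) \<noteq> 0" "(rC p)\<^sup>2 + k \<noteq> 0" if "p \<in> interior_pts" for p
    using interior_nz[OF that] rk_pos[of p] by auto
  note C1s = C1_on_add C1_on_diff C1_on_minus C1_on_mult C1_on_divide C1_on_const C1_on_power C1_on_sin C1_on_cos C1_on_nth C1_on_f
  have D: "C1_on interior_pts (\<lambda>p. if i = j then
       Hdiag p i
     else 0)"
  proof -
    have "C1_on interior_pts (\<lambda>p. - (f p + Qs))" "C1_on interior_pts (\<lambda>p. f p + Qs)"
      "C1_on interior_pts (\<lambda>p. (rC p)\<^sup>2 + k)" by (intro C1s)+
    moreover have "C1_on interior_pts (\<lambda>p. 1 / (sin (thC p))\<^sup>2)" "C1_on interior_pts (\<lambda>p. 1 / (cos (thC p))\<^sup>2)"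
      by (intro C1s; simp add: nz)+
    ultimately show ?thesis
      by (cases i rule: option.exhaust; cases "i = j"; cases "the i") (simp_all add: Hdiag_def C1_on_const)
  qed
  show ?thesis
    unfolding AA_def wt_def Hm_def by (intro C1s D) (simp_all add: nz)
qed

lemma AA_sym: "AA q i j = AA q j i"
  by (simp add: AA_def Hm_sym)

lemma AA_invariant:
  assumes "l \<in> {None, Some Phi, Some Psi, Some Zed}"
  shows "AA (q + s *\<^sub>R axis l 1) i j = AA q i j"
proof -
  have 1: "rC (q + s *\<^sub>R axis l 1) = rC q" "thC (q + s *\<^sub>R axis l 1) = thC q"
    using assms by (auto simp: axis_def)
  have 2: "f (q + s *\<^sub>R axis l 1) = f q" unfolding f_def 1 ..
  show ?thesis unfolding AA_def wt_def Hm_def Hdiag_def 1 2 ..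
qed

lemma interior_translate:
  assumes "l \<in> {None, Some Phi, Some Psi, Some Zed}"
  shows "p + s *\<^sub>R axis l 1 \<in> interior_pts \<longleftrightarrow> p \<in> interior_pts"
  using assms by (auto simp: interior_pts_def axis_def)

lemma AA_differentiable: "p \<in> interior_pts \<Longrightarrow> (\<lambda>q. AA q i j) differentiable (at p)"
  using C1_on_AA by (rule C1_onD(1))

definition flux :: "(coords \<Rightarrow> real) \<Rightarrow> spatial option \<Rightarrow> coords \<Rightarrow> real" where
  "flux U i q = (\<Sum>j\<in>UNIV. AA q i j * pd j U q)"

lemma C1_on_flux: "smooth U \<Longrightarrow> C1_on interior_pts (flux U i)"
  unfolding flux_def by (intro C1_on_sum C1_on_mult C1_on_AA smooth_C1_on smooth_pd)

lemma pd_flux: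
  assumes "smooth U" "p \<in> interior_pts"
  shows "pd l (flux U i) p = (\<Sum>j\<in>UNIV. AA p i j * pd l (pd j U) p + pd l (\<lambda>q. AA q i j) p * pd j U p)"
  unfolding flux_def
  by (subst pd_sum) (simp_all add: pd_mult AA_differentiable[OF assms(2)]
      smooth_differentiable[OF smooth_pd[OF assms(1)]] differentiable_mult)

lemma wave_op_flux: "wave_op U p = (\<Sum>i\<in>UNIV. pd i (flux U i) p)"
  by (simp add: wave_op_def flux_def[abs_def])

lemma periodic_pd: "smooth U \<Longrightarrow> periodic U \<Longrightarrow> periodic (pd i U)"
  unfolding periodic_def using pd_translate(2)[OF _ smooth_differentiable] by auto

lemma coord_solution_pd:
  assumes U: "coord_solution U" and l: "l \<in> {Some Phi, Some Psi}"
  shows "coord_solution (pd l U)"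
proof -
  have sm: "smooth U" and per: "periodic U" and wave: "\<And>p. p \<in> interior_pts \<Longrightarrow> wave_op U p = 0"
    using U by (auto simp: coord_solution_def)
  have l': "l \<in> {None, Some Phi, Some Psi, Some Zed}" using l by auto
  have "wave_op (pd l U) p = 0" if p: "p \<in> interior_pts" for p
  proof -
    define D where "D i j = pd i (\<lambda>q. AA q i j) p" for i j
    have Dt: "pd i (\<lambda>q. AA q i j) (p + s *\<^sub>R axis l 1) = D i j" for i j s
      unfolding D_def by (rule pd_translate(2)) (simp_all add: AA_invariant[OF l'] AA_differentiable p)
    have ex: "wave_op W (p + s *\<^sub>R axis l 1) = (\<Sum>i\<in>UNIV. \<Sum>j\<in>UNIV. AA p i j * pd i (pd j W) (p + s *\<^sub>R axis l 1)
        + D i j * pd j W (p + s *\<^sub>R axis l 1))" if "smooth W" for W s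
      unfolding wave_op_flux using that p
      by (simp add: pd_flux interior_translate[OF l'] Dt AA_invariant[OF l'])
    have "((\<lambda>s. \<Sum>i\<in>UNIV. \<Sum>j\<in>UNIV. AA p i j * pd i (pd j U) (p + s *\<^sub>R axis l 1)
        + D i j * pd j U (p + s *\<^sub>R axis l 1)) has_real_derivative
        (\<Sum>i\<in>UNIV. \<Sum>j\<in>UNIV. AA p i j * pd l (pd i (pd j U)) p + D i j * pd l (pd j U) p)) (at 0)"
      by (intro DERIV_sum DERIV_add DERIV_cmult pd_line smooth_differentiable smooth_pd sm)
    moreover have "(\<Sum>i\<in>UNIV. \<Sum>j\<in>UNIV. AA p i j * pd i (pd j U) (p + s *\<^sub>R axis l 1)
        + D i j * pd j U (p + s *\<^sub>R axis l 1)) = 0" for s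
      using wave[of "p + s *\<^sub>R axis l 1"] p by (simp add: interior_translate[OF l'] ex[OF sm])
    ultimately have "((\<lambda>s. 0) has_real_derivative
        (\<Sum>i\<in>UNIV. \<Sum>j\<in>UNIV. AA p i j * pd l (pd i (pd j U)) p + D i j * pd l (pd j U) p)) (at 0)"
      by simp
    then have "(\<Sum>i\<in>UNIV. \<Sum>j\<in>UNIV. AA p i j * pd l (pd i (pd j U)) p + D i j * pd l (pd j U) p) = 0"
      by (rule DERIV_unique[OF _ DERIV_const])
    moreover have "pd l (pd i (pd j U)) p = pd i (pd j (pd l U)) p" for i j
    proof -
      have "pd l (pd j U) = pd j (pd l U)" using pd_commute[OF sm] by auto
      then show ?thesis using pd_commute[OF smooth_pd[OF sm], of l i j] by simp
    qed
    moreover have "pd l (pd j U) p = pd j (pd l U) p" for j by (rule pd_commute[OF sm])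
    ultimately show ?thesis using ex[OF smooth_pd[OF sm], of l 0] by simp
  qed
  then show ?thesis using sm per by (simp add: coord_solution_def smooth_pd periodic_pd)
qed

section \<open>Pulling back to the chart\<close>

lemma chart_in_\<M>: "chart p \<in> \<M>"
proof -
  have "norm (of_real (sin (thC p)) * cis a, of_real (cos (thC p)) * cis b) = 1" for a b
    by (simp add: norm_Pair norm_mult)
  then show ?thesis by (simp add: chart_def \<M>_def)
qed

lemma smooth_chart_component: "b \<in> Basis \<Longrightarrow> Ck l (\<lambda>p. chart p \<bullet> b)"
proof -
  have lin: "Ck l (\<lambda>p :: coords. p $ i + c * p $ j)" for i j c
    by (intro Ck_add Ck_mult Ck_const Ck_bounded_linear bounded_linear_vec_nth)
  have nth: "Ck l (\<lambda>p :: coords. p $ i)" for i by (intro Ck_bounded_linear bounded_linear_vec_nth)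
  have sc: "Ck l (\<lambda>p. sin (F p))" "Ck l (\<lambda>p. cos (F p))" if "Ck l F" for F :: "coords \<Rightarrow> real"
    using Ck_compose[of l F sin] Ck_compose[of l F cos] that Ck_sin_cos[of l] by auto
  have e: "zC p / Rz = 0 * rC p + (1 / Rz) * zC p" "phC p + real n * zC p / Rz = phC p + (real n / Rz) * zC p"
    "psC p - (real n + 1) * zC p / Rz = psC p + (- (real n + 1) / Rz) * zC p" for p :: coords
    by (simp_all add: divide_inverse algebra_simps)
  have z: "Ck l (\<lambda>p. zC p / Rz)" "Ck l (\<lambda>p. phC p + real n * zC p / Rz)"
    "Ck l (\<lambda>p. psC p - (real n + 1) * zC p / Rz)"
    unfolding e by (intro Ck_add Ck_mult Ck_const nth)+
  assume "b \<in> Basis"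
  then show ?thesis
    unfolding chart_def Basis_prod_def Basis_complex_def
    by (auto simp: inner_complex_def inner_prod_def intro!: Ck_mult sc z nth Ck_const)
qed

lemma chart_periodic:
  "chart (p + (2 * pi) *\<^sub>R axis (Some Phi) 1) = chart p"
  "chart (p + (2 * pi) *\<^sub>R axis (Some Psi) 1) = chart p"
  "chart (p + (2 * pi * Rz) *\<^sub>R axis (Some Zed) 1) = chart p"
proof -
  have c: "cis (x + 2 * pi) = cis x" for x by (simp add: cis_mult[symmetric])
  have c': "cis (x + 2 * pi * real j) = cis x" "cis (x - 2 * pi * real j) = cis x" for x j
    by (simp_all add: cis_mult[symmetric] cis_divide[symmetric] cis_multiple_2pi)
  show "chart (p + (2 * pi) *\<^sub>R axis (Some Phi) 1) = chart p"
    using c[of "phC p + real n * zC p / Rz"] by (simp add: chart_def axis_def algebra_simps)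
  show "chart (p + (2 * pi) *\<^sub>R axis (Some Psi) 1) = chart p"
    using c[of "psC p - (real n + 1) * zC p / Rz"] by (simp add: chart_def axis_def algebra_simps)
  have e: "(zC p + 2 * pi * Rz) / Rz = zC p / Rz + 2 * pi"
    "phC p + real n * (zC p + 2 * pi * Rz) / Rz = phC p + real n * zC p / Rz + 2 * pi * real n"
    "psC p - (real n + 1) * (zC p + 2 * pi * Rz) / Rz = psC p - (real n + 1) * zC p / Rz - 2 * pi * real (n + 1)"
    using Rz_pos by (simp_all add: field_simps)
  let ?p = "p + (2 * pi * Rz) *\<^sub>R axis (Some Zed) 1"
  have comp: "tC ?p = tC p" "rC ?p = rC p" "thC ?p = thC p" "phC ?p = phC p" "psC ?p = psC p"
    "zC ?p = zC p + 2 * pi * Rz" by (simp_all add: axis_def)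
  show "chart ?p = chart p"
    unfolding chart_def comp e c c' ..
qed

lemma wave_op_eq_0_extends:
  assumes sm: "smooth U" and reg: "\<And>p. p \<in> regular \<Longrightarrow> wave_op U p = 0" and p: "p \<in> interior_pts"
  shows "wave_op U p = 0"
proof (cases "f p = 0")
  case False
  then show ?thesis using p by (intro reg) (simp add: regular_interior)
next
  case True
  define y where "y j = p + inverse (real (Suc j)) *\<^sub>R axis (Some Rad) 1" for j
  have "(\<lambda>j. inverse (real (Suc j))) \<longlonglongrightarrow> 0" by (rule LIMSEQ_inverse_real_of_nat)
  then have "y \<longlonglongrightarrow> p + 0 *\<^sub>R axis (Some Rad) 1"
    unfolding y_def by (intro tendsto_intros)
  then have lim: "y \<longlonglongrightarrow> p" by simp
  have yr: "y j \<in> regular" for j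
  proof -
    have r: "rC (y j) = rC p + inverse (real (Suc j))" "thC (y j) = thC p" by (simp_all add: y_def axis_def)
    have "(rC p)\<^sup>2 < (rC (y j))\<^sup>2" unfolding r using p by (intro power_strict_mono) (auto simp: interior_pts_def)
    then have "f p < f (y j)" by (simp add: f_def r(2))
    with True p r show ?thesis by (auto simp: regular_interior interior_pts_def add_pos_pos)
  qed
  have "continuous_on interior_pts (wave_op U)"
    unfolding wave_op_flux[abs_def] by (intro continuous_intros C1_on_pd_continuous C1_on_flux sm)
  then have "isCont (wave_op U) p" using p open_interior continuous_on_eq_continuous_at by blast
  then have "(\<lambda>j. wave_op U (y j)) \<longlonglongrightarrow> wave_op U p" using lim by (rule isCont_tendsto_compose)
  moreover have "wave_op U (y j) = 0" for j by (rule reg[OF yr])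
  ultimately show ?thesis by (simp add: LIMSEQ_const_iff)
qed

lemma coord_solution_chart:
  assumes "smooth_wave_solution u"
  shows "coord_solution (u \<circ> chart)"
proof -
  obtain F where F: "smooth F" "\<And>m. m \<in> \<M> \<Longrightarrow> u m = F m" and box: "\<And>p. p \<in> regular \<Longrightarrow> box (u \<circ> chart) p = 0"
    using assms by (auto simp: smooth_wave_solution_def smooth_on_\<M>_def)
  define U where "U = u \<circ> chart"
  have "U = (\<lambda>p. F (chart p))" by (rule ext) (simp add: U_def F(2)[OF chart_in_\<M>])
  then have sm: "smooth U"
    using F(1) Ck_compose[OF smooth_chart_component] by (auto simp: smooth_def)
  have per: "periodic U" by (simp add: periodic_def U_def chart_periodic)
  have "wave_op U p = 0" if p: "p \<in> regular" for p
  proof -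
    have pi: "p \<in> interior_pts" using p by (simp add: regular_interior)
    have AA: "sqrt \<bar>det (g_matrix q)\<bar> * matrix_inv (g_matrix q) $ i $ j = AA q i j" if "q \<in> regular" for q i j
      using hf_pos[of q] by (simp add: det_g[OF that] g_matrix_inverse(3)[OF that] g_inv_def AA_def)
    have "pd i (\<lambda>q. \<Sum>j\<in>UNIV. sqrt \<bar>det (g_matrix q)\<bar> * matrix_inv (g_matrix q) $ i $ j * pd j U q) p = pd i (flux U i) p" for i
      by (rule pd_cong_open[OF open_regular p, symmetric])
        (simp_all add: flux_def AA C1_onD(1)[OF C1_on_flux[OF sm] pi])
    then have "box U p = 1 / sqrt \<bar>det (g_matrix p)\<bar> * wave_op U p"
      by (simp add: box_def wave_op_flux)
    moreover have "sqrt \<bar>det (g_matrix p)\<bar> \<noteq> 0" using det_g[OF p] wt_pos[OF p] hf_pos[of p] by simp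
    ultimately show ?thesis using box[OF p] by (simp add: U_def)
  qed
  then show ?thesis using wave_op_eq_0_extends[OF sm] sm per by (simp add: coord_solution_def U_def)
qed

section \<open>The energy currents\<close>

text \<open>The energy current of the multiplier \<open>d\<^sub>l\<close>.\<close>

definition current :: "(coords \<Rightarrow> real) \<Rightarrow> spatial option \<Rightarrow> spatial option \<Rightarrow> coords \<Rightarrow> real" where
  "current U l i q = flux U i q * pd l U q
     - (if i = l then (\<Sum>j\<in>UNIV. flux U j q * pd j U q) / 2 else 0)"

lemma C1_on_current: "smooth U \<Longrightarrow> C1_on interior_pts (current U l i)"
  unfolding current_def
  by (cases "i = l") (simp_all, (intro C1_on_diff C1_on_mult C1_on_flux C1_on_sum C1_on_divide C1_on_const
      smooth_C1_on[OF smooth_pd]; simp)+)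

lemma current_divergence:
  assumes U: "coord_solution U" and l: "l \<in> {None, Some Zed}" and p: "p \<in> interior_pts"
  shows "(\<Sum>i\<in>UNIV. pd i (current U l i) p) = 0"
proof -
  have sm: "smooth U" and wave: "wave_op U p = 0" using U p by (auto simp: coord_solution_def)
  have dU: "pd j U differentiable (at p)" for j by (rule smooth_differentiable[OF smooth_pd[OF sm]])
  have dF: "flux U j differentiable (at p)" for j by (rule C1_onD(1)[OF C1_on_flux[OF sm] p])
  define E where "E q = (\<Sum>j\<in>UNIV. flux U j q * pd j U q)" for q
  have dE: "E differentiable (at p)"
    unfolding E_def by (intro differentiable_sum ballI differentiable_mult dU dF) simp
  have A0: "pd l (\<lambda>q. AA q i j) p = 0" for i j
    by (rule pd_invariant_0[OF AA_differentiable[OF p]]) (use l in \<open>auto simp: AA_invariant\<close>)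
  define a b c where "a = (\<lambda>i. flux U i p)" and "b = (\<lambda>j. pd l (pd j U) p)" and "c = (\<lambda>j. pd j U p)"
  have plF: "pd l (flux U i) p = (\<Sum>j\<in>UNIV. AA p i j * b j)" for i
    by (simp add: pd_flux[OF sm p] A0 b_def)
  have aa: "a i = (\<Sum>j\<in>UNIV. AA p i j * c j)" for i by (simp add: a_def flux_def c_def)
  have "pd l E p = (\<Sum>j\<in>UNIV. a j * b j + pd l (flux U j) p * c j)"
    unfolding E_def a_def b_def c_def
    by (subst pd_sum) (simp_all add: pd_mult dU dF differentiable_mult)
  also have "\<dots> = (\<Sum>j\<in>UNIV. a j * b j) + (\<Sum>j\<in>UNIV. \<Sum>i\<in>UNIV. AA p j i * b i * c j)"
    by (simp add: sum.distrib plF sum_distrib_right)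
  also have "(\<Sum>j\<in>UNIV. \<Sum>i\<in>UNIV. AA p j i * b i * c j) = (\<Sum>i\<in>UNIV. \<Sum>j\<in>UNIV. AA p i j * c j * b i)"
    by (subst sum.swap) (simp add: AA_sym[of p] mult_ac)
  also have "\<dots> = (\<Sum>j\<in>UNIV. a j * b j)" by (simp add: aa sum_distrib_right)
  finally have plE: "pd l E p = 2 * (\<Sum>j\<in>UNIV. a j * b j)" by simp
  have "pd i (current U l i) p = a i * b i + pd i (flux U i) p * pd l U p - (if i = l then pd l E p / 2 else 0)" for i
  proof -
    have 1: "pd i (\<lambda>q. flux U i q * pd l U q) p = a i * b i + pd i (flux U i) p * pd l U p"
      using pd_mult[OF dF dU, of i i l] pd_commute[OF sm, of i l p] by (simp add: a_def b_def)
    show ?thesis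
    proof (cases "i = l")
      case True
      have "pd l (\<lambda>q. flux U l q * pd l U q + (- 1 / 2) * E q) p
         = pd l (\<lambda>q. flux U l q * pd l U q) p + pd l (\<lambda>q. (- 1 / 2) * E q) p"
        by (intro pd_add differentiable_mult dF dU dE differentiable_const)
      also have "pd l (\<lambda>q. (- 1 / 2) * E q) p = (- 1 / 2) * pd l E p"
        by (subst pd_mult) (simp_all add: dE pd_def dirderiv_def)
      finally show ?thesis using True 1 by (simp add: current_def[abs_def] E_def)
    qed (use 1 in \<open>simp add: current_def[abs_def]\<close>)
  qed
  then have "(\<Sum>i\<in>UNIV. pd i (current U l i) p)
     = (\<Sum>i\<in>UNIV. a i * b i) + wave_op U p * pd l U p - pd l E p / 2"
    by (simp add: sum.distrib sum_subtractf wave_op_flux sum_distrib_right)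
  then show ?thesis using plE wave by simp
qed

lemma periodic_current:
  assumes U: "smooth U" "periodic U" and p: "p \<in> interior_pts"
  shows "current U l i (p + (2 * pi) *\<^sub>R axis (Some Phi) 1) = current U l i p"
    "current U l i (p + (2 * pi) *\<^sub>R axis (Some Psi) 1) = current U l i p"
    "current U l i (p + (2 * pi * Rz) *\<^sub>R axis (Some Zed) 1) = current U l i p"
proof -
  have per: "periodic (pd j U)" for j using U by (rule periodic_pd)
  note P = per[unfolded periodic_def, rule_format]
  show "current U l i (p + (2 * pi) *\<^sub>R axis (Some Phi) 1) = current U l i p"
    "current U l i (p + (2 * pi) *\<^sub>R axis (Some Psi) 1) = current U l i p"
    "current U l i (p + (2 * pi * Rz) *\<^sub>R axis (Some Zed) 1) = current U l i p"
    using P by (simp_all add: current_def flux_def AA_invariant)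
qed

abbreviation du :: "(coords \<Rightarrow> real) \<Rightarrow> coords \<Rightarrow> spatial option \<Rightarrow> real" where
  "du U p \<equiv> (\<lambda>i. pd i U p)"

text \<open>\<open>c = 0\<close> and \<open>c = 1\<close> are the multipliers \<open>T\<close> and \<open>V = T + Z\<close>.\<close>

definition multiplier :: "real \<Rightarrow> (spatial option \<Rightarrow> real) \<Rightarrow> real" where
  "multiplier c \<xi> = \<xi> None + c * \<xi> (Some Zed)"

definition eX :: "real \<Rightarrow> coords \<Rightarrow> (spatial option \<Rightarrow> real) \<Rightarrow> real" where
  "eX c p \<xi> = eT p \<xi> + c * ((S p * (\<xi> None + \<xi> (Some Zed)) - Bu p \<xi>) * \<xi> (Some Zed))"

lemma eX_0: "eX 0 p \<xi> = eT p \<xi>" and eX_1: "eX 1 p \<xi> = eV p \<xi>"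
  by (simp_all add: eX_def eT_def eV_def power2_eq_square field_simps)

definition cur :: "real \<Rightarrow> (coords \<Rightarrow> real) \<Rightarrow> spatial option \<Rightarrow> coords \<Rightarrow> real" where
  "cur c U i q = current U None i q + c * current U (Some Zed) i q"

lemma flux_components:
  shows "flux U None p = wt p * (- S p * (pd None U p + pd (Some Zed) U p) + Bu p (du U p))"
    "flux U (Some Rad) p = wt p * (((rC p)\<^sup>2 + k) * pd (Some Rad) U p)"
    "flux U (Some Theta) p = wt p * pd (Some Theta) U p"
proof -
  have *: "flux U i p = wt p * (\<Sum>j\<in>UNIV. pd j U p * Hm p j i)" for i
    by (simp add: flux_def AA_def sum_distrib_left Hm_sym[of p i] mult_ac)
  show "flux U None p = wt p * (- S p * (pd None U p + pd (Some Zed) U p) + Bu p (du U p))"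
    unfolding * Hm_None_sum ..
  show "flux U (Some Rad) p = wt p * (((rC p)\<^sup>2 + k) * pd (Some Rad) U p)"
    "flux U (Some Theta) p = wt p * pd (Some Theta) U p"
    unfolding * sum_Hm by (simp_all add: Hdiag_def Vf_def Xf_def Yf_def)
qed

lemma flux_quadratic:
  assumes "p \<in> interior_pts"
  shows "(\<Sum>j\<in>UNIV. flux U j p * pd j U p) = wt p * (- S p * (pd None U p + pd (Some Zed) U p)\<^sup>2
      + 2 * (pd None U p + pd (Some Zed) U p) * Bu p (du U p) + Q0 p (du U p))"
proof -
  have *: "flux U i p = wt p * (\<Sum>j\<in>UNIV. pd j U p * Hm p j i)" for i
    by (simp add: flux_def AA_def sum_distrib_left Hm_sym[of p i] mult_ac)
  show ?thesis
    unfolding Hm_form[OF assms, of "du U p", symmetric] *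
    by (simp add: sum_distrib_left sum_distrib_right mult_ac)
qed

lemma cur_components:
  assumes "p \<in> interior_pts"
  shows "cur c U None p = - (wt p * eX c p (du U p))"
    "cur c U (Some Rad) p = wt p * (((rC p)\<^sup>2 + k) * (pd (Some Rad) U p * multiplier c (du U p)))"
    "cur c U (Some Theta) p = wt p * (pd (Some Theta) U p * multiplier c (du U p))"
proof -
  show "cur c U None p = - (wt p * eX c p (du U p))"
    unfolding cur_def current_def flux_quadratic[OF assms] flux_components(1) eX_def eT_def
    by (simp add: power2_eq_square field_simps)
  show "cur c U (Some Rad) p = wt p * (((rC p)\<^sup>2 + k) * (pd (Some Rad) U p * multiplier c (du U p)))"
    "cur c U (Some Theta) p = wt p * (pd (Some Theta) U p * multiplier c (du U p))"
    by (simp_all add: cur_def current_def flux_components multiplier_def algebra_simps)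
qed

lemma C1_on_cur: "smooth U \<Longrightarrow> C1_on interior_pts (cur c U i)"
  unfolding cur_def by (intro C1_on_add C1_on_mult C1_on_const C1_on_current)

lemma cur_divergence:
  assumes "coord_solution U" "p \<in> interior_pts"
  shows "(\<Sum>i\<in>UNIV. pd i (cur c U i) p) = 0"
proof -
  have d: "current U l i differentiable (at p)" for l i
    using assms by (intro C1_onD(1)[OF C1_on_current]) (auto simp: coord_solution_def)
  have "pd i (cur c U i) p = pd i (current U None i) p + c * pd i (current U (Some Zed) i) p" for i
  proof -
    have "pd i (cur c U i) p = pd i (current U None i) p + pd i (\<lambda>q. c * current U (Some Zed) i q) p"
      unfolding cur_def by (intro pd_add d differentiable_mult differentiable_const)
    also have "pd i (\<lambda>q. c * current U (Some Zed) i q) p = c * pd i (current U (Some Zed) i) p"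
      by (subst pd_mult) (simp_all add: d pd_def dirderiv_def)
    finally show ?thesis .
  qed
  then show ?thesis
    using current_divergence[OF assms(1) _ assms(2), of None] current_divergence[OF assms(1) _ assms(2), of "Some Zed"]
    by (simp add: sum.distrib flip: sum_distrib_left)
qed

lemma cur_periodic:
  assumes U: "smooth U" "periodic U" and p: "p \<in> interior_pts"
  shows "cur c U i (p + (2 * pi) *\<^sub>R axis (Some Phi) 1) = cur c U i p"
    "cur c U i (p + (2 * pi) *\<^sub>R axis (Some Psi) 1) = cur c U i p"
    "cur c U i (p + (2 * pi * Rz) *\<^sub>R axis (Some Zed) 1) = cur c U i p"
  using periodic_current[OF assms] by (simp_all add: cur_def)

definition corner :: "real \<Rightarrow> real \<Rightarrow> real \<Rightarrow> slice_coords" where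
  "corner r \<theta> s = (\<chi> j. case j of Rad \<Rightarrow> r | Theta \<Rightarrow> \<theta> | Phi \<Rightarrow> 2 * pi * s | Psi \<Rightarrow> 2 * pi * s | Zed \<Rightarrow> 2 * pi * Rz * s)"

lemma corner_nth [simp]: "corner r \<theta> s $ Rad = r" "corner r \<theta> s $ Theta = \<theta>"
  "corner r \<theta> s $ Phi = 2 * pi * s" "corner r \<theta> s $ Psi = 2 * pi * s" "corner r \<theta> s $ Zed = 2 * pi * Rz * s"
  by (simp_all add: corner_def)

lemma mem_corner_box:
  "x \<in> cbox (corner ra ta 0) (corner rb tb 1) \<longleftrightarrow>
     ra \<le> x $ Rad \<and> x $ Rad \<le> rb \<and> ta \<le> x $ Theta \<and> x $ Theta \<le> tb \<and>
     0 \<le> x $ Phi \<and> x $ Phi \<le> 2 * pi \<and> 0 \<le> x $ Psi \<and> x $ Psi \<le> 2 * pi \<and>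
     0 \<le> x $ Zed \<and> x $ Zed \<le> 2 * pi * Rz"
proof -
  have "(\<forall>i. P i) \<longleftrightarrow> P Rad \<and> P Theta \<and> P Phi \<and> P Psi \<and> P Zed" for P
    by (metis spatial.exhaust)
  then show ?thesis by (simp add: mem_box_cart)
qed

lemma box_interior:
  assumes "0 < ra" "0 < ta" "tb < pi / 2" "x \<in> cbox (corner ra ta 0) (corner rb tb 1)"
  shows "on_slice t x \<in> interior_pts"
  using assms by (auto simp: mem_corner_box interior_pts_def)

lemma continuous_on_slice_comp:
  "continuous_on interior_pts F \<Longrightarrow> (\<And>x. x \<in> K \<Longrightarrow> on_slice t x \<in> interior_pts) \<Longrightarrow>
    continuous_on K (\<lambda>x. F (on_slice t x))"
  by (rule continuous_on_compose2[OF _ continuous_on_slice']) auto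

lemma integral_divergence_component:
  assumes F: "C1_on interior_pts F" and ra: "0 < ra" "ra \<le> rb" and ta: "0 < ta" "ta \<le> tb" "tb < pi / 2"
    and per: "\<And>x. x \<in> cbox (corner ra ta 0) (corner rb tb 1) \<Longrightarrow> x $ j = corner ra ta 0 $ j \<Longrightarrow>
      F (on_slice t (x + (corner rb tb 1 $ j - corner ra ta 0 $ j) *\<^sub>R axis j 1)) = F (on_slice t x)"
  shows "integral (cbox (corner ra ta 0) (corner rb tb 1)) (\<lambda>x. pd (Some j) F (on_slice t x)) = 0"
proof (rule integral_partial_derivative_eq_0[where F = "\<lambda>x. F (on_slice t x)" and e = "axis j 1"])
  let ?K = "cbox (corner ra ta 0) (corner rb tb 1)"
  have int: "on_slice t x \<in> interior_pts" if "x \<in> ?K" for x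
    using box_interior[OF ra(1) ta(1,3) that] .
  show "continuous_on ?K (\<lambda>x. pd (Some j) F (on_slice t x))"
    by (rule continuous_on_slice_comp[OF C1_on_pd_continuous[OF F] int])
  show "axis j 1 \<in> (Basis :: slice_coords set)" by simp
  show "corner ra ta 0 \<bullet> axis j 1 \<le> corner rb tb 1 \<bullet> axis j 1"
    using ra ta Rz_pos by (cases j) (simp_all add: inner_axis)
  show "((\<lambda>s. F (on_slice t (x + s *\<^sub>R axis j 1))) has_real_derivative pd (Some j) F (on_slice t x)) (at 0)"
    if "x \<in> ?K" for x
    unfolding on_slice_add by (rule pd_line[OF C1_onD(1)[OF F int[OF that]]])
  show "F (on_slice t (x + (corner rb tb 1 \<bullet> axis j 1 - corner ra ta 0 \<bullet> axis j 1) *\<^sub>R axis j 1)) = F (on_slice t x)"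
    if "x \<in> ?K" "x \<bullet> axis j 1 = corner ra ta 0 \<bullet> axis j 1" for x
    using per[OF that(1)] that(2) by (simp add: inner_axis)
qed

definition cut_rate :: "real \<Rightarrow> (coords \<Rightarrow> real) \<Rightarrow> (coords \<Rightarrow> real) \<Rightarrow> coords \<Rightarrow> real" where
  "cut_rate c \<kappa> U p = wt p * (pd None \<kappa> p * eX c p (du U p)
     - pd (Some Rad) \<kappa> p * (((rC p)\<^sup>2 + k) * (pd (Some Rad) U p * multiplier c (du U p)))
     - pd (Some Theta) \<kappa> p * (pd (Some Theta) U p * multiplier c (du U p)))"

lemma energy_derivative:
  assumes U: "coord_solution U" and \<kappa>: "C1_on interior_pts \<kappa>"
    and inv: "\<And>q s l. l \<in> {Phi, Psi, Zed} \<Longrightarrow> \<kappa> (q + s *\<^sub>R axis (Some l) 1) = \<kappa> q"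
    and ra: "0 < ra" "ra \<le> rb" and ta: "0 < ta" "ta \<le> tb" "tb < pi / 2"
    and bd: "\<And>x. x $ Rad = ra \<or> x $ Rad = rb \<or> x $ Theta = ta \<or> x $ Theta = tb \<Longrightarrow> \<kappa> (on_slice t x) = 0"
  defines "K \<equiv> cbox (corner ra ta 0) (corner rb tb 1)"
  shows "((\<lambda>t. integral K (\<lambda>x. \<kappa> (on_slice t x) * (wt (on_slice t x) * eX c (on_slice t x) (du U (on_slice t x)))))
    has_real_derivative
      integral K (\<lambda>x. cut_rate c \<kappa> U (on_slice t x))) (at t)"
proof -
  have sm: "smooth U" and per: "periodic U" using U by (auto simp: coord_solution_def)
  define F where "F i q = \<kappa> q * cur c U i q" for i q
  have C1: "C1_on interior_pts (F i)" for i unfolding F_def by (intro C1_on_mult \<kappa> C1_on_cur sm)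
  have int: "on_slice t x \<in> interior_pts" if "x \<in> K" for x t
    using box_interior[OF ra(1) ta(1,3)] that by (simp add: K_def)
  have cont: "continuous_on K (\<lambda>x. G (on_slice t x))" if "continuous_on interior_pts G" for G t
    by (rule continuous_on_slice_comp[OF that int])
  have dF: "F i differentiable (at (on_slice t x))" if "x \<in> K" for i x t
    by (rule C1_onD(1)[OF C1 int[OF that]])
  have "((\<lambda>t. integral K (\<lambda>x. F None (on_slice t x))) has_real_derivative
      integral K (\<lambda>x. pd None (F None) (on_slice t x))) (at t within UNIV)"
    unfolding K_def
  proof (rule leibniz_rule_field_derivative)
    fix s x assume "x \<in> cbox (corner ra ta 0) (corner rb tb 1)"
    then have "x \<in> K" by (simp add: K_def)
    from pd_line[OF dF[OF this, of None s], of None]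
    have "((\<lambda>h. F None (on_slice (s + h) x)) has_real_derivative pd None (F None) (on_slice s x)) (at 0)"
      by (simp only: on_slice_add_time)
    then have "((\<lambda>h. F None (on_slice (h + s) x)) has_real_derivative pd None (F None) (on_slice s x)) (at 0)"
      by (simp only: add.commute)
    then show "((\<lambda>s. F None (on_slice s x)) has_real_derivative pd None (F None) (on_slice s x)) (at s within UNIV)"
      using DERIV_shift[of "\<lambda>s. F None (on_slice s x)" _ 0 s] by simp
  next
    fix s show "(\<lambda>x. F None (on_slice s x)) integrable_on cbox (corner ra ta 0) (corner rb tb 1)"
      using cont[OF C1_on_continuous[OF C1]] unfolding K_def by (rule integrable_continuous)
  next
    show "continuous_on (UNIV \<times> cbox (corner ra ta 0) (corner rb tb 1)) (\<lambda>(s, x). pd None (F None) (on_slice s x))"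
    proof -
      have "(\<lambda>p. on_slice (fst p) (snd p)) ` (UNIV \<times> K) \<subseteq> interior_pts" using int by auto
      then show ?thesis
        using continuous_on_compose2[OF C1_on_pd_continuous[OF C1[of None], of None] continuous_on_slice[of "UNIV \<times> K"]]
        unfolding K_def case_prod_beta by blast
    qed
  qed auto
  then have "((\<lambda>t. - integral K (\<lambda>x. F None (on_slice t x))) has_real_derivative
      - integral K (\<lambda>x. pd None (F None) (on_slice t x))) (at t)" by (intro DERIV_minus) simp
  moreover have "- integral K (\<lambda>x. F None (on_slice s x)) =
     integral K (\<lambda>x. \<kappa> (on_slice s x) * (wt (on_slice s x) * eX c (on_slice s x) (du U (on_slice s x))))" for s
    unfolding integral_neg[symmetric]
    by (intro integral_cong) (simp add: F_def cur_components[OF int])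
  moreover have "- integral K (\<lambda>x. pd None (F None) (on_slice t x)) =
      integral K (\<lambda>x. cut_rate c \<kappa> U (on_slice t x))"
  proof -
    have z: "integral K (\<lambda>x. pd (Some j) (F (Some j)) (on_slice t x)) = 0" for j
      unfolding K_def
    proof (rule integral_divergence_component[OF C1 ra ta])
      fix x assume x: "x \<in> cbox (corner ra ta 0) (corner rb tb 1)" "x $ j = corner ra ta 0 $ j"
      have xi: "on_slice t x \<in> interior_pts" using x int by (simp add: K_def)
      have "F (Some j) (on_slice t (x + (corner rb tb 1 $ j - corner ra ta 0 $ j) *\<^sub>R axis j 1)) = F (Some j) (on_slice t x)"
      proof (cases "j = Rad \<or> j = Theta")
        case True
        let ?y = "x + (corner rb tb 1 $ j - corner ra ta 0 $ j) *\<^sub>R axis j 1"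
        from True x have "\<kappa> (on_slice t x) = 0" "\<kappa> (on_slice t ?y) = 0"
          using bd[of x] bd[of ?y] by (auto simp: axis_def)
        then show ?thesis by (simp add: F_def)
      next
        case False
        then consider "j = Phi" | "j = Psi" | "j = Zed" using spatial.exhaust by blast
        then show ?thesis
          by cases (simp_all add: on_slice_add F_def inv cur_periodic[OF sm per xi])
      qed
      then show "F (Some j) (on_slice t (x + (corner rb tb 1 $ j - corner ra ta 0 $ j) *\<^sub>R axis j 1)) = F (Some j) (on_slice t x)" .
    qed
    have ig: "(\<lambda>x. pd i (F i) (on_slice t x)) integrable_on K" for i
      using cont[OF C1_on_pd_continuous[OF C1]] unfolding K_def by (rule integrable_continuous)
    have "integral K (\<lambda>x. \<Sum>i\<in>UNIV. pd i (F i) (on_slice t x))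
       = (\<Sum>i\<in>UNIV. integral K (\<lambda>x. pd i (F i) (on_slice t x)))"
      by (intro integral_sum ig) simp
    also have "\<dots> = integral K (\<lambda>x. pd None (F None) (on_slice t x))"
      unfolding sum_option z by simp
    finally have "- integral K (\<lambda>x. pd None (F None) (on_slice t x))
      = integral K (\<lambda>x. - (\<Sum>i\<in>UNIV. pd i (F i) (on_slice t x)))"
      by simp
    also have "\<dots> = integral K (\<lambda>x. cut_rate c \<kappa> U (on_slice t x))"
    proof (rule integral_cong)
      fix x assume x: "x \<in> K"
      define q where "q = on_slice t x"
      have q: "q \<in> interior_pts" using int[OF x] by (simp add: q_def)
      have d\<kappa>: "\<kappa> differentiable (at q)" by (rule C1_onD(1)[OF \<kappa> q])
      have "pd i (F i) q = \<kappa> q * pd i (cur c U i) q + pd i \<kappa> q * cur c U i q" for i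
        unfolding F_def by (rule pd_mult[OF d\<kappa> C1_onD(1)[OF C1_on_cur[OF sm] q]])
      then have "(\<Sum>i\<in>UNIV. pd i (F i) q) = \<kappa> q * (\<Sum>i\<in>UNIV. pd i (cur c U i) q) + (\<Sum>i\<in>UNIV. pd i \<kappa> q * cur c U i q)"
        by (simp add: sum.distrib sum_distrib_left)
      also have "\<dots> = (\<Sum>i\<in>UNIV. pd i \<kappa> q * cur c U i q)" using cur_divergence[OF U q] by simp
      also have "\<dots> = pd None \<kappa> q * cur c U None q + pd (Some Rad) \<kappa> q * cur c U (Some Rad) q
          + pd (Some Theta) \<kappa> q * cur c U (Some Theta) q"
        unfolding sum_coords using pd_invariant_0[OF d\<kappa> inv] by simp
      finally show "- (\<Sum>i\<in>UNIV. pd i (F i) (on_slice t x)) = cut_rate c \<kappa> U (on_slice t x)"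
        unfolding q_def[symmetric] cut_rate_def cur_components[OF q] by (simp add: algebra_simps)
    qed
    finally show ?thesis .
  qed
  ultimately show ?thesis by simp
qed

end

section \<open>Cutoff functions\<close>

lemma DERIV_pos_part_sq: "((\<lambda>y::real. (max 0 y)\<^sup>2) has_real_derivative 2 * max 0 y) (at y)"
proof -
  consider "y > 0" | "y < 0" | "y = 0" by linarith
  then show ?thesis
  proof cases
    case 1
    have "((\<lambda>y. y\<^sup>2) has_real_derivative 2 * y) (at y)" by (auto intro!: derivative_eq_intros)
    then have "((\<lambda>y. (max 0 y)\<^sup>2) has_real_derivative 2 * y) (at y)"
      by (rule has_field_derivative_transform_within_open[of _ _ _ "{0<..}"]) (use 1 in auto)
    then show ?thesis using 1 by simp
  next
    case 2
    have "((\<lambda>y. 0) has_real_derivative 0) (at y)" by simp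
    then have "((\<lambda>y. (max 0 y)\<^sup>2) has_real_derivative 0) (at y)"
      by (rule has_field_derivative_transform_within_open[of _ _ _ "{..<0}"]) (use 2 in auto)
    then show ?thesis using 2 by simp
  next
    case 3
    have "((\<lambda>h::real. (max 0 h)\<^sup>2 / h) \<longlongrightarrow> 0) (at 0)"
    proof (rule Lim_null_comparison[where g = "\<lambda>h. \<bar>h\<bar>"])
      show "\<forall>\<^sub>F h in at 0. norm ((max 0 h)\<^sup>2 / h) \<le> \<bar>h :: real\<bar>"
        by (intro always_eventually allI) (auto simp: max_def power2_eq_square)
      show "((\<lambda>h::real. \<bar>h\<bar>) \<longlongrightarrow> 0) (at 0)"
        using tendsto_rabs[OF tendsto_ident_at[of 0 UNIV]] by simp
    qed
    then show ?thesis using 3 by (simp add: DERIV_def)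
  qed
qed

definition beta :: "real \<Rightarrow> real" where
  "beta y = (max 0 (y + 2))\<^sup>2 / ((max 0 (y + 2))\<^sup>2 + (max 0 (- 1 - y))\<^sup>2)"

definition dbeta :: "real \<Rightarrow> real" where
  "dbeta y = (2 * max 0 (y + 2) * (max 0 (- 1 - y))\<^sup>2 + (max 0 (y + 2))\<^sup>2 * (2 * max 0 (- 1 - y)))
     / ((max 0 (y + 2))\<^sup>2 + (max 0 (- 1 - y))\<^sup>2)\<^sup>2"

lemma beta_denominator: "(max 0 (y + 2))\<^sup>2 + (max 0 (- 1 - y))\<^sup>2 > (0::real)"
proof (cases "y + 2 > 0")
  case True
  then show ?thesis by (intro add_pos_nonneg) auto
next
  case False
  then show ?thesis by (intro add_nonneg_pos) auto
qed

lemma DERIV_beta: "(beta has_real_derivative dbeta y) (at y)"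
proof -
  have 1: "((\<lambda>y. (max 0 (y + 2))\<^sup>2) has_real_derivative 2 * max 0 (y + 2) * 1) (at y)"
    by (rule DERIV_chain2[OF DERIV_pos_part_sq]) (auto intro!: derivative_eq_intros)
  have 2: "((\<lambda>y. (max 0 (- 1 - y))\<^sup>2) has_real_derivative 2 * max 0 (- 1 - y) * (- 1)) (at y)"
    by (rule DERIV_chain2[OF DERIV_pos_part_sq]) (auto intro!: derivative_eq_intros)
  have nz: "(max 0 (y + 2))\<^sup>2 + (max 0 (- 1 - y))\<^sup>2 \<noteq> 0" using beta_denominator[of y] by (metis less_irrefl)
  show ?thesis
    unfolding beta_def[abs_def]
    by (rule DERIV_cong[OF DERIV_divide[OF 1 DERIV_add[OF 1 2] nz]])
      (simp add: dbeta_def power2_eq_square algebra_simps)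
qed

lemma continuous_dbeta: "continuous_on A dbeta"
proof -
  have "(max 0 (y + 2))\<^sup>2 + (max 0 (- 1 - y))\<^sup>2 \<noteq> (0::real)" for y using beta_denominator[of y] by (metis less_irrefl)
  then show ?thesis unfolding dbeta_def[abs_def] by (intro continuous_intros) auto
qed

lemma continuous_beta: "continuous_on A beta"
  using DERIV_beta by (meson DERIV_isCont continuous_at_imp_continuous_on)

lemma beta_range: "0 \<le> beta y" "beta y \<le> 1"
  using beta_denominator[of y] by (auto simp: beta_def divide_simps)

lemma beta_0: "y \<le> - 2 \<Longrightarrow> beta y = 0" and beta_1: "- 1 \<le> y \<Longrightarrow> beta y = 1"
  by (simp_all add: beta_def)

lemma dbeta_nonneg: "0 \<le> dbeta y"
  unfolding dbeta_def by (intro divide_nonneg_nonneg add_nonneg_nonneg mult_nonneg_nonneg) auto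

lemma dbeta_support: "dbeta y \<noteq> 0 \<Longrightarrow> - 2 \<le> y \<and> y \<le> - 1"
  by (auto simp: dbeta_def max_def split: if_splits)

lemma dbeta_bounded: "\<exists>B>0. \<forall>y. dbeta y \<le> B"
proof -
  have "bounded (dbeta ` {-2..-1})"
    by (intro compact_imp_bounded compact_continuous_image continuous_dbeta) simp
  then obtain B where "\<forall>z\<in>dbeta ` {-2..-1}. norm z \<le> B" and B0: "B > 0"
    by (auto simp: bounded_pos)
  then have B: "\<And>y. y \<in> {-2..-1} \<Longrightarrow> \<bar>dbeta y\<bar> \<le> B" by auto
  have "dbeta y \<le> B" for y
    using B[of y] B0 dbeta_support[of y] by (cases "dbeta y = 0") auto
  with B0 show ?thesis by blast
qed

lemma C1_on_beta: "C1_on A F \<Longrightarrow> C1_on A (\<lambda>x. beta (F x))"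
  by (rule C1_on_comp_real[where \<phi> = beta and \<phi>' = dbeta]) (auto intro: DERIV_beta continuous_dbeta)

lemma beta_limit: "\<delta> > 0 \<Longrightarrow> \<delta> * \<bar>y\<bar> \<le> 1 \<Longrightarrow> beta (\<delta> * y) = 1"
proof (rule beta_1)
  assume a: "\<delta> > 0" "\<delta> * \<bar>y\<bar> \<le> 1"
  have "\<delta> * - y \<le> \<delta> * \<bar>y\<bar>" using a by (intro mult_left_mono) auto
  with a show "- 1 \<le> \<delta> * y" by simp
qed

context three_charge_microstate
begin

text \<open>
  The logarithmic scale makes \<open>r \<partial>\<^sub>r\<close> and \<open>sin \<theta> cos \<theta> \<partial>\<^sub>\<theta>\<close> of the cutoffs uniformly small, so that no
  boundary terms arise at \<open>r = 0\<close>, \<open>\<theta> = 0\<close> and \<open>\<theta> = \<pi>/2\<close>.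
\<close>

definition log_tan :: "coords \<Rightarrow> real" where
  "log_tan p = ln (sin (thC p) / cos (thC p))"

definition cutT :: "real \<Rightarrow> coords \<Rightarrow> real" where
  "cutT \<delta> p = beta (\<delta> * log_tan p) * beta (- (\<delta> * log_tan p))"

definition cutR :: "real \<Rightarrow> coords \<Rightarrow> real" where
  "cutR \<delta> p = beta (\<delta> * ln (rC p))"

definition cutO :: "real \<Rightarrow> real \<Rightarrow> coords \<Rightarrow> real" where
  "cutO L \<Lambda> p = beta (- ((rC p + \<Lambda> * tC p) / L))"

definition cutoff :: "real \<Rightarrow> real \<Rightarrow> real \<Rightarrow> coords \<Rightarrow> real" where
  "cutoff \<delta> L \<Lambda> p = cutR \<delta> p * cutT \<delta> p * cutO L \<Lambda> p"

lemma C1_on_cuts: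
  "C1_on interior_pts (cutT \<delta>)" "C1_on interior_pts (cutR \<delta>)" "C1_on interior_pts (cutO L \<Lambda>)"
  "C1_on interior_pts (\<lambda>p. beta (- (\<delta> * ln (rC p))))"
proof -
  have lt: "C1_on interior_pts log_tan"
    unfolding log_tan_def[abs_def]
    by (intro C1_on_ln C1_on_divide C1_on_sin C1_on_cos C1_on_nth) (auto dest: interior_nz intro!: divide_pos_pos)
  have lr: "C1_on interior_pts (\<lambda>p. ln (rC p))"
    by (intro C1_on_ln C1_on_nth) (auto dest: interior_nz)
  show "C1_on interior_pts (cutT \<delta>)"
    unfolding cutT_def[abs_def] by (intro C1_on_mult C1_on_beta C1_on_minus C1_on_const lt)
  show "C1_on interior_pts (cutR \<delta>)"
    unfolding cutR_def[abs_def] by (intro C1_on_mult C1_on_beta C1_on_const lr)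
  show "C1_on interior_pts (\<lambda>p. beta (- (\<delta> * ln (rC p))))"
    by (intro C1_on_beta C1_on_minus C1_on_mult C1_on_const lr)
  have "C1_on interior_pts (\<lambda>p. beta (- ((rC p + \<Lambda> * tC p) * (1 / L))))"
    by (intro C1_on_beta C1_on_minus C1_on_mult C1_on_add C1_on_const C1_on_nth)
  then show "C1_on interior_pts (cutO L \<Lambda>)" by (simp add: cutO_def[abs_def])
qed

lemma C1_on_cutoff: "C1_on interior_pts (cutoff \<delta> L \<Lambda>)"
  unfolding cutoff_def[abs_def] by (intro C1_on_mult C1_on_cuts)

lemma cut_range:
  "0 \<le> cutT \<delta> p" "cutT \<delta> p \<le> 1" "0 \<le> cutR \<delta> p" "cutR \<delta> p \<le> 1" "0 \<le> cutO L \<Lambda> p" "cutO L \<Lambda> p \<le> 1"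
  unfolding cutT_def cutR_def cutO_def by (simp_all add: beta_range mult_le_one)

lemma cutoff_range: "0 \<le> cutoff \<delta> L \<Lambda> p" "cutoff \<delta> L \<Lambda> p \<le> 1"
  unfolding cutoff_def by (simp_all add: cut_range mult_le_one)

lemma DERIV_log_tan_line:
  assumes "p \<in> interior_pts"
  shows "((\<lambda>s. log_tan (p + s *\<^sub>R axis (Some Theta) 1)) has_real_derivative 1 / (sin (thC p) * cos (thC p))) (at 0)"
proof -
  have sc: "(sin (thC p))\<^sup>2 + (cos (thC p))\<^sup>2 = 1" by simp
  have "((\<lambda>s. ln (sin (thC p + s) / cos (thC p + s))) has_real_derivative
     (cos (thC p) * cos (thC p) + sin (thC p) * sin (thC p)) / (cos (thC p) * cos (thC p)) / (sin (thC p) / cos (thC p))) (at 0)"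
    using interior_nz[OF assms] by (auto intro!: derivative_eq_intros)
  moreover have "cos (thC p) * cos (thC p) + sin (thC p) * sin (thC p) = 1"
    using sc by (simp add: power2_eq_square)
  ultimately show ?thesis using interior_nz[OF assms] by (simp add: log_tan_def axis_def mult.commute)
qed

lemma pd_cutT:
  assumes "p \<in> interior_pts"
  shows "pd (Some Theta) (cutT \<delta>) p =
    (dbeta (\<delta> * log_tan p) * beta (- (\<delta> * log_tan p)) - beta (\<delta> * log_tan p) * dbeta (- (\<delta> * log_tan p))) * (\<delta> / (sin (thC p) * cos (thC p)))"
    "pd (Some Rad) (cutT \<delta>) p = 0" "pd None (cutT \<delta>) p = 0"
proof -
  let ?d = "1 / (sin (thC p) * cos (thC p))"
  have d: "cutT \<delta> differentiable (at p)" by (rule C1_onD(1)[OF C1_on_cuts(1) assms])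
  have 1: "((\<lambda>s. beta (\<delta> * log_tan (p + s *\<^sub>R axis (Some Theta) 1))) has_real_derivative dbeta (\<delta> * log_tan p) * (\<delta> * ?d)) (at 0)"
    by (rule DERIV_chain2[of beta]) (use DERIV_beta[of "\<delta> * log_tan p"] DERIV_cmult[OF DERIV_log_tan_line[OF assms]] in auto)
  have 2: "((\<lambda>s. beta (- (\<delta> * log_tan (p + s *\<^sub>R axis (Some Theta) 1)))) has_real_derivative dbeta (- (\<delta> * log_tan p)) * (- (\<delta> * ?d))) (at 0)"
    by (rule DERIV_chain2[of beta]) (use DERIV_beta[of "- (\<delta> * log_tan p)"] DERIV_minus[OF DERIV_cmult[OF DERIV_log_tan_line[OF assms]]] in auto)
  show "pd (Some Theta) (cutT \<delta>) p =
    (dbeta (\<delta> * log_tan p) * beta (- (\<delta> * log_tan p)) - beta (\<delta> * log_tan p) * dbeta (- (\<delta> * log_tan p))) * (\<delta> / (sin (thC p) * cos (thC p)))"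
    by (rule pd_eqI[OF d]) (use DERIV_mult[OF 1 2] in \<open>simp add: cutT_def algebra_simps\<close>)
  show "pd (Some Rad) (cutT \<delta>) p = 0" "pd None (cutT \<delta>) p = 0"
    by (rule pd_invariant_0[OF d]; simp add: cutT_def log_tan_def axis_def)+
qed

lemma DERIV_ln_r_line:
  "p \<in> interior_pts \<Longrightarrow> ((\<lambda>s. ln (rC (p + s *\<^sub>R axis (Some Rad) 1))) has_real_derivative 1 / rC p) (at 0)"
  using interior_nz[of p] by (auto intro!: derivative_eq_intros simp: axis_def)

lemma pd_cutR:
  assumes "p \<in> interior_pts"
  shows "pd (Some Rad) (cutR \<delta>) p = dbeta (\<delta> * ln (rC p)) * (\<delta> / rC p)"
    "pd (Some Theta) (cutR \<delta>) p = 0" "pd None (cutR \<delta>) p = 0"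
    "pd (Some Rad) (\<lambda>p. beta (- (\<delta> * ln (rC p)))) p = - (dbeta (- (\<delta> * ln (rC p))) * (\<delta> / rC p))"
proof -
  have d: "cutR \<delta> differentiable (at p)" "(\<lambda>p. beta (- (\<delta> * ln (rC p)))) differentiable (at p)"
    by (rule C1_onD(1)[OF C1_on_cuts(2) assms] C1_onD(1)[OF C1_on_cuts(4) assms])+
  have 1: "((\<lambda>s. beta (\<delta> * ln (rC (p + s *\<^sub>R axis (Some Rad) 1)))) has_real_derivative dbeta (\<delta> * ln (rC p)) * (\<delta> * (1 / rC p))) (at 0)"
    by (rule DERIV_chain2[of beta]) (use DERIV_beta[of "\<delta> * ln (rC p)"] DERIV_cmult[OF DERIV_ln_r_line[OF assms]] in auto)
  show "pd (Some Rad) (cutR \<delta>) p = dbeta (\<delta> * ln (rC p)) * (\<delta> / rC p)"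
    by (rule pd_eqI[OF d(1)]) (use 1 in \<open>simp add: cutR_def\<close>)
  have 2: "((\<lambda>s. beta (- (\<delta> * ln (rC (p + s *\<^sub>R axis (Some Rad) 1))))) has_real_derivative dbeta (- (\<delta> * ln (rC p))) * (- (\<delta> * (1 / rC p)))) (at 0)"
    by (rule DERIV_chain2[of beta]) (use DERIV_beta[of "- (\<delta> * ln (rC p))"] DERIV_minus[OF DERIV_cmult[OF DERIV_ln_r_line[OF assms]]] in auto)
  show "pd (Some Rad) (\<lambda>p. beta (- (\<delta> * ln (rC p)))) p = - (dbeta (- (\<delta> * ln (rC p))) * (\<delta> / rC p))"
    by (rule pd_eqI[OF d(2)]) (use 2 in simp)
  show "pd (Some Theta) (cutR \<delta>) p = 0" "pd None (cutR \<delta>) p = 0"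
    by (rule pd_invariant_0[OF d(1)]; simp add: cutR_def axis_def)+
qed

lemma pd_cutO:
  assumes "p \<in> interior_pts"
  shows "pd (Some Rad) (cutO L \<Lambda>) p = dbeta (- ((rC p + \<Lambda> * tC p) / L)) * (- (1 / L))"
    "pd None (cutO L \<Lambda>) p = dbeta (- ((rC p + \<Lambda> * tC p) / L)) * (- (\<Lambda> / L))"
    "pd (Some Theta) (cutO L \<Lambda>) p = 0"
proof -
  have d: "cutO L \<Lambda> differentiable (at p)" by (rule C1_onD(1)[OF C1_on_cuts(3) assms])
  have "((\<lambda>s. - ((rC p + s + \<Lambda> * tC p) / L)) has_real_derivative - (1 / L)) (at 0)"
    by (auto intro!: derivative_eq_intros simp: divide_inverse)
  then have "((\<lambda>s. beta (- ((rC p + s + \<Lambda> * tC p) / L))) has_real_derivative dbeta (- ((rC p + \<Lambda> * tC p) / L)) * (- (1 / L))) (at 0)"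
    by (rule DERIV_chain2[of beta, rotated]) (use DERIV_beta in auto)
  then show "pd (Some Rad) (cutO L \<Lambda>) p = dbeta (- ((rC p + \<Lambda> * tC p) / L)) * (- (1 / L))"
    by (intro pd_eqI[OF d]) (simp add: cutO_def axis_def)
  have "((\<lambda>s. - ((rC p + \<Lambda> * (tC p + s)) / L)) has_real_derivative - (\<Lambda> / L)) (at 0)"
    by (auto intro!: derivative_eq_intros simp: divide_inverse)
  then have "((\<lambda>s. beta (- ((rC p + \<Lambda> * (tC p + s)) / L))) has_real_derivative dbeta (- ((rC p + \<Lambda> * tC p) / L)) * (- (\<Lambda> / L))) (at 0)"
    by (rule DERIV_chain2[of beta, rotated]) (use DERIV_beta in auto)
  then show "pd None (cutO L \<Lambda>) p = dbeta (- ((rC p + \<Lambda> * tC p) / L)) * (- (\<Lambda> / L))"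
    by (intro pd_eqI[OF d]) (simp add: cutO_def axis_def)
  show "pd (Some Theta) (cutO L \<Lambda>) p = 0"
    by (rule pd_invariant_0[OF d]) (simp add: cutO_def axis_def)
qed

lemma pd_cutoff:
  assumes p: "p \<in> interior_pts"
  shows "pd None (cutoff \<delta> L \<Lambda>) p = cutR \<delta> p * cutT \<delta> p * pd None (cutO L \<Lambda>) p"
    "pd (Some Rad) (cutoff \<delta> L \<Lambda>) p =
       cutR \<delta> p * cutT \<delta> p * pd (Some Rad) (cutO L \<Lambda>) p + pd (Some Rad) (cutR \<delta>) p * cutT \<delta> p * cutO L \<Lambda> p"
    "pd (Some Theta) (cutoff \<delta> L \<Lambda>) p = cutR \<delta> p * pd (Some Theta) (cutT \<delta>) p * cutO L \<Lambda> p"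
proof -
  have d: "cutT \<delta> differentiable (at p)" "cutR \<delta> differentiable (at p)" "cutO L \<Lambda> differentiable (at p)"
    by (rule C1_onD(1)[OF C1_on_cuts(1) p] C1_onD(1)[OF C1_on_cuts(2) p] C1_onD(1)[OF C1_on_cuts(3) p])+
  have "pd i (cutoff \<delta> L \<Lambda>) p = cutR \<delta> p * cutT \<delta> p * pd i (cutO L \<Lambda>) p
     + (cutR \<delta> p * pd i (cutT \<delta>) p + pd i (cutR \<delta>) p * cutT \<delta> p) * cutO L \<Lambda> p" for i
    unfolding cutoff_def[abs_def] by (simp add: pd_mult d differentiable_mult)
  then show "pd None (cutoff \<delta> L \<Lambda>) p = cutR \<delta> p * cutT \<delta> p * pd None (cutO L \<Lambda>) p"
    "pd (Some Rad) (cutoff \<delta> L \<Lambda>) p =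
       cutR \<delta> p * cutT \<delta> p * pd (Some Rad) (cutO L \<Lambda>) p + pd (Some Rad) (cutR \<delta>) p * cutT \<delta> p * cutO L \<Lambda> p"
    "pd (Some Theta) (cutoff \<delta> L \<Lambda>) p = cutR \<delta> p * pd (Some Theta) (cutT \<delta>) p * cutO L \<Lambda> p"
    by (simp_all add: pd_cutT[OF p] pd_cutR[OF p] pd_cutO(3)[OF p])
qed

definition kbox :: "real \<Rightarrow> real \<Rightarrow> slice_coords set" where
  "kbox \<delta> rb = cbox (corner (exp (- 2 / \<delta>)) (arctan (exp (- 2 / \<delta>))) 0) (corner rb (arctan (exp (2 / \<delta>))) 1)"

definition Ecut :: "real \<Rightarrow> real \<Rightarrow> real \<Rightarrow> real \<Rightarrow> (coords \<Rightarrow> real) \<Rightarrow> real \<Rightarrow> real" where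
  "Ecut \<delta> L \<Lambda> c U t = integral (kbox \<delta> (2 * L)) (\<lambda>x. cutoff \<delta> L \<Lambda> (on_slice t x) *
     (wt (on_slice t x) * eX c (on_slice t x) (du U (on_slice t x))))"

lemma theta_faces:
  assumes "\<delta> > 0" "thC p = arctan (exp (- 2 / \<delta>)) \<or> thC p = arctan (exp (2 / \<delta>))"
  shows "cutT \<delta> p = 0"
proof -
  have "log_tan p = ln (tan (thC p))" by (simp only: log_tan_def tan_def)
  then have "\<delta> * log_tan p = - 2 \<or> \<delta> * log_tan p = 2"
    using assms by (auto simp: tan_arctan)
  then show ?thesis by (auto simp: cutT_def beta_0)
qed

lemma kbox_angles: "0 < arctan (exp (- 2 / \<delta>))" "arctan (exp (2 / \<delta>)) < pi / 2"
  "\<delta> > 0 \<Longrightarrow> arctan (exp (- 2 / \<delta>)) \<le> arctan (exp (2 / \<delta>))"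
  using arctan_ubound by (auto simp: arctan_le_iff divide_right_mono)

lemma kbox_interior: "x \<in> kbox \<delta> rb \<Longrightarrow> on_slice t x \<in> interior_pts"
  unfolding kbox_def by (rule box_interior) (use kbox_angles[of \<delta>] in auto)

lemma Ecut_derivative_bound:
  assumes U: "coord_solution U" and \<Lambda>: "0 \<le> \<Lambda>" and t: "0 \<le> t" "t \<le> t1"
    and flux: "\<And>p \<xi>. p \<in> interior_pts \<Longrightarrow> R0 \<le> rC p \<Longrightarrow>
      ((rC p)\<^sup>2 + k) * \<bar>\<xi> (Some Rad) * multiplier c \<xi>\<bar> \<le> \<Lambda> * eX c p \<xi>"
    and L: "1 \<le> L" "R0 + \<Lambda> * t1 \<le> L" and \<delta>: "\<delta> > 0"
    and B: "\<And>y. dbeta y \<le> B" "0 \<le> B"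
    and M: "\<And>x. x \<in> kbox \<delta> (2 * L) \<Longrightarrow> (let q = on_slice t x in ((rC q)\<^sup>2 + k) * \<bar>pd (Some Rad) U q * multiplier c (du U q)\<bar>
      + rC q * \<bar>pd (Some Theta) U q * multiplier c (du U q)\<bar>) \<le> M" "0 \<le> M"
    and V: "measure lborel (kbox \<delta> (2 * L)) \<le> Vol"
  shows "\<exists>D \<le> 2 * \<delta> * B * M * Vol. (Ecut \<delta> L \<Lambda> c U has_real_derivative D) (at t)"
proof -
  define ra ta tb where "ra = exp (- 2 / \<delta>)" and "ta = arctan (exp (- 2 / \<delta>))" and "tb = arctan (exp (2 / \<delta>))"
  have ra: "0 < ra" "ra \<le> 2 * L"
  proof -
    show "0 < ra" by (simp add: ra_def)
    have "ra \<le> 1" using \<delta> by (simp add: ra_def)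
    then show "ra \<le> 2 * L" using L by simp
  qed
  have ta: "0 < ta" "ta \<le> tb" "tb < pi / 2" using kbox_angles[of \<delta>] \<delta> by (simp_all add: ta_def tb_def)
  have K: "kbox \<delta> (2 * L) = cbox (corner ra ta 0) (corner (2 * L) tb 1)"
    by (simp add: kbox_def ra_def ta_def tb_def)
  define q where "q = on_slice t"
  define D where "D x = cut_rate c (cutoff \<delta> L \<Lambda>) U (q x)" for x
  have "(Ecut \<delta> L \<Lambda> c U has_real_derivative integral (kbox \<delta> (2 * L)) D) (at t)"
    unfolding Ecut_def[abs_def] K D_def q_def
  proof (rule energy_derivative[OF U C1_on_cutoff _ ra ta])
    show "cutoff \<delta> L \<Lambda> (p + s *\<^sub>R axis (Some l) 1) = cutoff \<delta> L \<Lambda> p" if "l \<in> {Phi, Psi, Zed}" for p s l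
      using that by (auto simp: cutoff_def cutR_def cutT_def cutO_def log_tan_def axis_def)
    fix x assume "x $ Rad = ra \<or> x $ Rad = 2 * L \<or> x $ Theta = ta \<or> x $ Theta = tb"
    moreover have "cutR \<delta> (on_slice t x) = 0" if "x $ Rad = ra"
      using that \<delta> by (simp add: cutR_def ra_def beta_0)
    moreover have "cutO L \<Lambda> (on_slice t x) = 0" if "x $ Rad = 2 * L"
    proof -
      have "(2 * L + \<Lambda> * t) / L \<ge> 2" using L \<Lambda> t by (simp add: field_simps)
      then show ?thesis using that by (simp add: cutO_def beta_0)
    qed
    moreover have "cutT \<delta> (on_slice t x) = 0" if "x $ Theta = ta \<or> x $ Theta = tb"
      by (rule theta_faces[OF \<delta>]) (use that in \<open>auto simp: ta_def tb_def\<close>)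
    ultimately show "cutoff \<delta> L \<Lambda> (on_slice t x) = 0" by (auto simp: cutoff_def)
  qed
  moreover have "integral (kbox \<delta> (2 * L)) D \<le> 2 * \<delta> * B * M * Vol"
  proof -
    have bound: "D x \<le> 2 * \<delta> * B * M" if x: "x \<in> kbox \<delta> (2 * L)" for x
    proof -
      define p where "p = q x"
      have p: "p \<in> interior_pts" using kbox_interior[OF x] by (simp add: p_def q_def)
      note nz = interior_nz[OF p]
      define F Gt where "F = ((rC p)\<^sup>2 + k) * (pd (Some Rad) U p * multiplier c (du U p))"
        and "Gt = pd (Some Theta) U p * multiplier c (du U p)"
      have aF: "\<bar>F\<bar> = ((rC p)\<^sup>2 + k) * \<bar>pd (Some Rad) U p * multiplier c (du U p)\<bar>"
        using rk_pos[of p] by (simp add: F_def abs_mult)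
      have FM: "\<bar>F\<bar> + rC p * \<bar>Gt\<bar> \<le> M"
        using M(1)[OF x] by (simp add: aF Gt_def p_def q_def Let_def)
      define b where "b = dbeta (- ((rC p + \<Lambda> * tC p) / L))"
      have b0: "b \<ge> 0" by (simp add: b_def dbeta_nonneg)
      have tp: "tC p = t" by (simp add: p_def q_def)
      have T1: "wt p * (pd None (cutoff \<delta> L \<Lambda>) p * eX c p (du U p)) - wt p * (cutR \<delta> p * cutT \<delta> p * pd (Some Rad) (cutO L \<Lambda>) p * F) \<le> 0"
      proof -
        have "b * (\<Lambda> * eX c p (du U p) - F) \<ge> 0"
        proof (cases "b = 0")
          case False
          then have "- ((rC p + \<Lambda> * tC p) / L) \<le> - 1" unfolding b_def using dbeta_support by blast
          then have "L \<le> rC p + \<Lambda> * t" using L by (simp add: tp field_simps)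
          moreover have "\<Lambda> * t \<le> \<Lambda> * t1" using \<Lambda> t by (intro mult_left_mono)
          ultimately have "R0 \<le> rC p" using L by linarith
          from flux[OF p this, of "du U p"] have "F \<le> \<Lambda> * eX c p (du U p)" unfolding aF[symmetric] by linarith
          then show ?thesis using b0 by simp
        qed simp
        moreover have "0 \<le> wt p * (cutR \<delta> p * cutT \<delta> p) / L"
          using nz cut_range(1,3) L
          by (intro mult_nonneg_nonneg divide_nonneg_nonneg) (auto simp: wt_def)
        ultimately have "0 \<le> wt p * (cutR \<delta> p * cutT \<delta> p) / L * (b * (\<Lambda> * eX c p (du U p) - F))"
          by (rule mult_nonneg_nonneg[rotated])
        then show ?thesis
          unfolding pd_cutoff[OF p] pd_cutO[OF p] b_def[symmetric] by (simp add: algebra_simps)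
      qed
      have T2: "- (wt p * (pd (Some Rad) (cutR \<delta>) p * cutT \<delta> p * cutO L \<Lambda> p * F)) \<le> \<delta> * B * \<bar>F\<bar>"
      proof -
        let ?a = "(sin (thC p) * cos (thC p)) * cutT \<delta> p * cutO L \<Lambda> p"
        have "wt p * (pd (Some Rad) (cutR \<delta>) p * cutT \<delta> p * cutO L \<Lambda> p * F) = ?a * (\<delta> * dbeta (\<delta> * ln (rC p))) * F"
          unfolding pd_cutR[OF p] using nz by (simp add: wt_def)
        then have "- (wt p * (pd (Some Rad) (cutR \<delta>) p * cutT \<delta> p * cutO L \<Lambda> p * F))
          \<le> \<bar>?a * (\<delta> * dbeta (\<delta> * ln (rC p))) * F\<bar>" by linarith
        also have "\<dots> = ?a * (\<delta> * dbeta (\<delta> * ln (rC p))) * \<bar>F\<bar>"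
          using nz cut_range dbeta_nonneg \<delta> by (simp add: abs_mult)
        also have "\<dots> \<le> 1 * (\<delta> * B) * \<bar>F\<bar>"
          using nz cut_range dbeta_nonneg \<delta> B by (intro mult_right_mono mult_mono mult_le_one mult_nonneg_nonneg) auto
        finally show ?thesis by simp
      qed
      have T3: "- (wt p * (pd (Some Theta) (cutoff \<delta> L \<Lambda>) p * Gt)) \<le> \<delta> * B * (2 * (rC p * \<bar>Gt\<bar>))"
      proof -
        let ?d = "dbeta (\<delta> * log_tan p) * beta (- (\<delta> * log_tan p)) - beta (\<delta> * log_tan p) * dbeta (- (\<delta> * log_tan p))"
        let ?a = "cutR \<delta> p * cutO L \<Lambda> p"
        have "\<bar>?d\<bar> \<le> \<bar>dbeta (\<delta> * log_tan p) * beta (- (\<delta> * log_tan p))\<bar> + \<bar>beta (\<delta> * log_tan p) * dbeta (- (\<delta> * log_tan p))\<bar>"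
          by (rule abs_triangle_ineq4)
        also have "\<dots> \<le> B * 1 + 1 * B"
          using B beta_range dbeta_nonneg unfolding abs_mult by (intro add_mono mult_mono) auto
        finally have d: "\<bar>?d\<bar> \<le> 2 * B" by simp
        have "wt p * (pd (Some Theta) (cutoff \<delta> L \<Lambda>) p * Gt) = ?a * (\<delta> * ?d) * (rC p * Gt)"
          unfolding pd_cutoff[OF p] pd_cutT[OF p] using nz by (simp add: wt_def)
        then have "- (wt p * (pd (Some Theta) (cutoff \<delta> L \<Lambda>) p * Gt)) \<le> \<bar>?a * (\<delta> * ?d) * (rC p * Gt)\<bar>" by linarith
        also have "\<dots> = ?a * (\<delta> * \<bar>?d\<bar>) * (rC p * \<bar>Gt\<bar>)"
          using nz cut_range \<delta> by (simp add: abs_mult)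
        also have "\<dots> \<le> 1 * (\<delta> * (2 * B)) * (rC p * \<bar>Gt\<bar>)"
          using nz cut_range \<delta> B d by (intro mult_right_mono mult_mono mult_le_one mult_nonneg_nonneg) auto
        finally show ?thesis by (simp add: mult_ac)
      qed
      have "D x = (wt p * (pd None (cutoff \<delta> L \<Lambda>) p * eX c p (du U p)) - wt p * (cutR \<delta> p * cutT \<delta> p * pd (Some Rad) (cutO L \<Lambda>) p * F))
         + - (wt p * (pd (Some Rad) (cutR \<delta>) p * cutT \<delta> p * cutO L \<Lambda> p * F))
         + - (wt p * (pd (Some Theta) (cutoff \<delta> L \<Lambda>) p * Gt))"
        unfolding D_def cut_rate_def p_def[symmetric] F_def[symmetric] Gt_def[symmetric] pd_cutoff(2)[OF p]
        by (simp add: algebra_simps)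
      also have "\<dots> \<le> 0 + \<delta> * B * \<bar>F\<bar> + \<delta> * B * (2 * (rC p * \<bar>Gt\<bar>))" by (intro add_mono T1 T2 T3)
      also have "\<dots> \<le> \<delta> * B * (2 * M)"
      proof -
        have "\<bar>F\<bar> + 2 * (rC p * \<bar>Gt\<bar>) \<le> 2 * M" using FM by linarith
        then have "\<delta> * B * (\<bar>F\<bar> + 2 * (rC p * \<bar>Gt\<bar>)) \<le> \<delta> * B * (2 * M)" using \<delta> B by (intro mult_left_mono) auto
        then show ?thesis by (simp add: distrib_left)
      qed
      finally show ?thesis by simp
    qed
    have C1D: "continuous_on (kbox \<delta> (2 * L)) D"
    proof -
      have cc: "continuous_on (kbox \<delta> (2 * L)) (\<lambda>x. G (q x))" if "continuous_on interior_pts G" for G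
        unfolding q_def by (rule continuous_on_slice_comp[OF that kbox_interior])
      have sm: "smooth U" using U by (simp add: coord_solution_def)
      have "continuous_on (kbox \<delta> (2 * L)) (\<lambda>x. pd None (cutoff \<delta> L \<Lambda>) (q x) * - cur c U None (q x)
         - pd (Some Rad) (cutoff \<delta> L \<Lambda>) (q x) * cur c U (Some Rad) (q x)
         - pd (Some Theta) (cutoff \<delta> L \<Lambda>) (q x) * cur c U (Some Theta) (q x))"
        by (intro continuous_intros cc C1_on_pd_continuous C1_on_cutoff C1_on_continuous[OF C1_on_cur[OF sm]])
      moreover have "D x = pd None (cutoff \<delta> L \<Lambda>) (q x) * - cur c U None (q x)
         - pd (Some Rad) (cutoff \<delta> L \<Lambda>) (q x) * cur c U (Some Rad) (q x)
         - pd (Some Theta) (cutoff \<delta> L \<Lambda>) (q x) * cur c U (Some Theta) (q x)" if "x \<in> kbox \<delta> (2 * L)" for x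
        unfolding D_def cut_rate_def q_def cur_components[OF kbox_interior[OF that]] by (simp add: algebra_simps)
      ultimately show ?thesis by (simp cong: continuous_on_cong)
    qed
    have "integral (kbox \<delta> (2 * L)) D \<le> integral (kbox \<delta> (2 * L)) (\<lambda>_. 2 * \<delta> * B * M)"
      using C1D bound unfolding K by (intro integral_le integrable_continuous integrable_const) auto
    also have "\<dots> = measure lborel (kbox \<delta> (2 * L)) * (2 * \<delta> * B * M)" by (simp add: K)
    also have "\<dots> \<le> Vol * (2 * \<delta> * B * M)" using V \<delta> B M(2) by (intro mult_right_mono) auto
    finally show ?thesis by (simp add: mult_ac)
  qed
  ultimately show ?thesis by blast
qed

lemma Ecut_le:
  assumes U: "coord_solution U" and \<Lambda>: "0 \<le> \<Lambda>" and t: "0 \<le> t"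
    and flux: "\<And>p \<xi>. p \<in> interior_pts \<Longrightarrow> R0 \<le> rC p \<Longrightarrow>
      ((rC p)\<^sup>2 + k) * \<bar>\<xi> (Some Rad) * multiplier c \<xi>\<bar> \<le> \<Lambda> * eX c p \<xi>"
    and L: "1 \<le> L" "R0 + \<Lambda> * t \<le> L" and \<epsilon>: "\<epsilon> > 0"
  shows "\<exists>\<delta>0>0. \<forall>\<delta>. 0 < \<delta> \<longrightarrow> \<delta> < \<delta>0 \<longrightarrow> Ecut \<delta> L \<Lambda> c U t \<le> Ecut \<delta> L \<Lambda> c U 0 + \<epsilon>"
proof -
  have sm: "smooth U" using U by (simp add: coord_solution_def)
  obtain B where B: "B > 0" "\<And>y. dbeta y \<le> B" using dbeta_bounded by blast
  define W where "W = cbox (corner 0 0 0) (corner (2 * L) (pi / 2) 1)"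
  define Vol where "Vol = measure lborel W"
  have Vol: "Vol \<ge> 0" by (simp add: Vol_def)
  define H where "H q = ((rC q)\<^sup>2 + k) * \<bar>pd (Some Rad) U q * multiplier c (du U q)\<bar>
      + rC q * \<bar>pd (Some Theta) U q * multiplier c (du U q)\<bar>" for q
  have "continuous_on UNIV H"
    unfolding H_def multiplier_def by (intro continuous_intros smooth_continuous[OF smooth_pd[OF sm]])
  then have "continuous_on ({0..t} \<times> W) (\<lambda>x. H (case x of (s, y) \<Rightarrow> on_slice s y))"
    by (rule continuous_on_compose2[OF _ continuous_on_slice]) auto
  then have "bounded ((\<lambda>x. H (case x of (s, y) \<Rightarrow> on_slice s y)) ` ({0..t} \<times> W))"
    by (intro compact_imp_bounded compact_continuous_image compact_Times) (auto simp: W_def)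
  then obtain M where "\<forall>y\<in>(\<lambda>x. H (case x of (s, y) \<Rightarrow> on_slice s y)) ` ({0..t} \<times> W). norm y \<le> M" "M > 0"
    by (auto simp: bounded_pos)
  then have Mb: "\<And>z. z \<in> (\<lambda>x. H (case x of (s, y) \<Rightarrow> on_slice s y)) ` ({0..t} \<times> W) \<Longrightarrow> norm z \<le> M" and M0: "M > 0"
    by auto
  have M: "H (on_slice s y) \<le> M" if "s \<in> {0..t}" "y \<in> W" for s y
    using Mb[OF rev_image_eqI[of "(s, y)"], of "H (on_slice s y)"] that by simp
  have kW: "kbox \<delta> (2 * L) \<subseteq> W" for \<delta>
  proof
    fix x assume "x \<in> kbox \<delta> (2 * L)"
    moreover have "0 < exp (- 2 / \<delta>)" by simp
    ultimately show "x \<in> W"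
      using kbox_angles[of \<delta>] unfolding kbox_def W_def mem_corner_box by linarith
  qed
  define A where "A = t * (2 * B * M * Vol)"
  have A: "A \<ge> 0" using t B M0 Vol by (simp add: A_def)
  show ?thesis
  proof (intro exI[of _ "\<epsilon> / (A + 1)"] conjI allI impI)
    show "\<epsilon> / (A + 1) > 0" using \<epsilon> A by simp
    fix \<delta> :: real assume \<delta>: "0 < \<delta>" "\<delta> < \<epsilon> / (A + 1)"
    have der: "\<exists>D \<le> 2 * \<delta> * B * M * Vol. (Ecut \<delta> L \<Lambda> c U has_real_derivative D) (at s)" if s: "0 \<le> s" "s \<le> t" for s
    proof (rule Ecut_derivative_bound[OF U \<Lambda> s flux L \<delta>(1) B(2)])
      show "measure lborel (kbox \<delta> (2 * L)) \<le> Vol"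
        unfolding Vol_def using kW[of \<delta>] unfolding kbox_def W_def by (rule content_subset)
      fix x assume "x \<in> kbox \<delta> (2 * L)"
      then have "H (on_slice s x) \<le> M" using M[of s x] kW[of \<delta>] s by auto
      then show "(let q = on_slice s x in ((rC q)\<^sup>2 + k) * \<bar>pd (Some Rad) U q * multiplier c (du U q)\<bar>
        + rC q * \<bar>pd (Some Theta) U q * multiplier c (du U q)\<bar>) \<le> M"
        by (simp add: H_def Let_def)
    qed (use B M0 in auto)
    have "Ecut \<delta> L \<Lambda> c U t - Ecut \<delta> L \<Lambda> c U 0 \<le> t * (2 * \<delta> * B * M * Vol)"
    proof (cases "t = 0")
      case False
      then have t0: "0 < t" using t by simp
      obtain D where D: "\<And>s. 0 \<le> s \<Longrightarrow> s \<le> t \<Longrightarrow> D s \<le> 2 * \<delta> * B * M * Vol \<and> (Ecut \<delta> L \<Lambda> c U has_real_derivative D s) (at s)"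
        using der by metis
      from MVT2[OF t0, of "Ecut \<delta> L \<Lambda> c U" D] D
      obtain z where z: "0 < z" "z < t" "Ecut \<delta> L \<Lambda> c U t - Ecut \<delta> L \<Lambda> c U 0 = (t - 0) * D z" by blast
      have "D z \<le> 2 * \<delta> * B * M * Vol" using D[of z] z by simp
      then show ?thesis unfolding z(3) using t0 by simp
    qed simp
    also have "\<dots> = \<delta> * A" by (simp add: A_def)
    also have "\<dots> \<le> \<delta> * (A + 1)" using \<delta> by simp
    also have "\<dots> < \<epsilon>" using \<delta>(2) A by (simp add: pos_less_divide_eq)
    finally show "Ecut \<delta> L \<Lambda> c U t \<le> Ecut \<delta> L \<Lambda> c U 0 + \<epsilon>" by simp
  qed
qed

section \<open>Integrals over a slice\<close>

definition Dom :: "slice_coords set" where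
  "Dom = {x. 0 < x $ Rad \<and> 0 < x $ Theta \<and> x $ Theta < pi / 2 \<and> 0 \<le> x $ Phi \<and> x $ Phi \<le> 2 * pi \<and>
     0 \<le> x $ Psi \<and> x $ Psi \<le> 2 * pi \<and> 0 \<le> x $ Zed \<and> x $ Zed \<le> 2 * pi * Rz}"

definition SI :: "real \<Rightarrow> (coords \<Rightarrow> real) \<Rightarrow> ennreal" where
  "SI t F = (\<integral>\<^sup>+x. ennreal (F (on_slice t x)) * indicator Dom x \<partial>lborel)"

lemma Dom_interior: "x \<in> Dom \<Longrightarrow> on_slice t x \<in> interior_pts"
  by (simp add: Dom_def interior_pts_def)

lemma Dom_borel [measurable]: "Dom \<in> sets borel"
proof -
  have "Dom = {x. 0 < x $ Rad} \<inter> {x. 0 < x $ Theta} \<inter> {x. x $ Theta < pi / 2} \<inter> {x. 0 \<le> x $ Phi} \<inter>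
     {x. x $ Phi \<le> 2 * pi} \<inter> {x. 0 \<le> x $ Psi} \<inter> {x. x $ Psi \<le> 2 * pi} \<inter> {x. 0 \<le> x $ Zed} \<inter> {x. x $ Zed \<le> 2 * pi * Rz}"
    by (auto simp: Dom_def)
  also have "\<dots> \<in> sets borel"
    by (intro sets.Int borel_open borel_closed open_Collect_less closed_Collect_le continuous_intros)
  finally show ?thesis .
qed

lemma SI_measurable:
  assumes "continuous_on interior_pts F"
  shows "(\<lambda>x. ennreal (F (on_slice t x)) * indicator Dom x) \<in> borel_measurable lborel"
proof -
  have "continuous_on Dom (\<lambda>x. F (on_slice t x))"
    by (rule continuous_on_slice_comp[OF assms Dom_interior])
  then have "(\<lambda>x. indicator Dom x *\<^sub>R F (on_slice t x)) \<in> borel_measurable borel"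
    by (rule borel_measurable_continuous_on_indicator[OF Dom_borel])
  then have "(\<lambda>x. ennreal (indicator Dom x *\<^sub>R F (on_slice t x))) \<in> borel_measurable lborel" by simp
  moreover have "ennreal (indicator Dom x *\<^sub>R F (on_slice t x)) = ennreal (F (on_slice t x)) * indicator Dom x" for x
    by (simp split: split_indicator)
  ultimately show ?thesis by simp
qed

lemma SI_mono: "(\<And>p. p \<in> interior_pts \<Longrightarrow> F p \<le> Ga p) \<Longrightarrow> SI t F \<le> SI t Ga"
  unfolding SI_def
  by (intro nn_integral_mono) (auto split: split_indicator intro!: ennreal_leI dest: Dom_interior)

lemma SI_add:
  assumes "continuous_on interior_pts F" "continuous_on interior_pts Ga"
    "\<And>p. p \<in> interior_pts \<Longrightarrow> 0 \<le> F p" "\<And>p. p \<in> interior_pts \<Longrightarrow> 0 \<le> Ga p"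
  shows "SI t (\<lambda>p. F p + Ga p) = SI t F + SI t Ga"
proof -
  have "SI t (\<lambda>p. F p + Ga p) = (\<integral>\<^sup>+x. ennreal (F (on_slice t x)) * indicator Dom x + ennreal (Ga (on_slice t x)) * indicator Dom x \<partial>lborel)"
    unfolding SI_def
    by (intro nn_integral_cong) (use assms(3,4) Dom_interior in \<open>auto split: split_indicator\<close>)
  then show ?thesis
    unfolding SI_def using SI_measurable[OF assms(1)] SI_measurable[OF assms(2)] by (simp add: nn_integral_add)
qed

lemma SI_cmult:
  assumes "continuous_on interior_pts F" "0 \<le> c" "\<And>p. p \<in> interior_pts \<Longrightarrow> 0 \<le> F p"
  shows "SI t (\<lambda>p. c * F p) = ennreal c * SI t F"
proof -
  have "SI t (\<lambda>p. c * F p) = (\<integral>\<^sup>+x. ennreal c * (ennreal (F (on_slice t x)) * indicator Dom x) \<partial>lborel)"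
    unfolding SI_def
    by (intro nn_integral_cong) (use assms(2,3) Dom_interior in \<open>auto simp: ennreal_mult split: split_indicator\<close>)
  then show ?thesis unfolding SI_def using SI_measurable[OF assms(1)] by (simp add: nn_integral_cmult)
qed

lemma nn_integral_box:
  fixes F :: "'a::euclidean_space \<Rightarrow> real"
  assumes F: "continuous_on (cbox a b) F" "\<And>x. x \<in> cbox a b \<Longrightarrow> 0 \<le> F x"
  shows "(\<integral>\<^sup>+x. ennreal (F x) * indicator (cbox a b) x \<partial>lborel) = ennreal (integral (cbox a b) F)"
proof -
  have int: "integrable lborel (\<lambda>x. indicator (cbox a b) x *\<^sub>R F x)"
    using F(1) by (intro borel_integrable_compact) auto
  have "(\<integral>\<^sup>+x. ennreal (F x) * indicator (cbox a b) x \<partial>lborel)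
      = (\<integral>\<^sup>+x. ennreal (indicator (cbox a b) x *\<^sub>R F x) \<partial>lborel)"
    by (intro nn_integral_cong) (simp split: split_indicator)
  also have "\<dots> = ennreal (\<integral>x. indicator (cbox a b) x *\<^sub>R F x \<partial>lborel)"
    by (rule nn_integral_eq_integral[OF int]) (use F(2) in \<open>auto split: split_indicator\<close>)
  also have "(\<integral>x. indicator (cbox a b) x *\<^sub>R F x \<partial>lborel) = integral (cbox a b) F"
    using set_borel_integral_eq_integral(2)[of "cbox a b" F] int
    by (simp add: set_integrable_def set_lebesgue_integral_def)
  finally show ?thesis .
qed

lemma kbox_Dom: "kbox \<delta> rb \<subseteq> Dom"
proof
  fix x assume "x \<in> kbox \<delta> rb"
  moreover have "0 < exp (- 2 / \<delta>)" by simp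
  ultimately show "x \<in> Dom"
    using kbox_angles(1,2)[of \<delta>] unfolding kbox_def Dom_def mem_corner_box mem_Collect_eq by linarith
qed

lemma box_integral_le_SI:
  assumes Ga: "continuous_on interior_pts Ga" "\<And>p. p \<in> interior_pts \<Longrightarrow> 0 \<le> Ga p"
    and \<kappa>: "continuous_on interior_pts \<kappa>" "\<And>p. 0 \<le> \<kappa> p" "\<And>p. \<kappa> p \<le> 1"
  shows "ennreal (integral (kbox \<delta> rb) (\<lambda>x. \<kappa> (on_slice t x) * Ga (on_slice t x))) \<le> SI t Ga"
proof -
  have "continuous_on (kbox \<delta> rb) (\<lambda>x. \<kappa> (on_slice t x) * Ga (on_slice t x))"
    by (rule continuous_on_slice_comp[OF continuous_on_mult[OF \<kappa>(1) Ga(1)] kbox_interior])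
  then have "ennreal (integral (kbox \<delta> rb) (\<lambda>x. \<kappa> (on_slice t x) * Ga (on_slice t x)))
    = (\<integral>\<^sup>+x. ennreal (\<kappa> (on_slice t x) * Ga (on_slice t x)) * indicator (kbox \<delta> rb) x \<partial>lborel)"
    using Ga(2)[OF kbox_interior] \<kappa>(2) unfolding kbox_def
    by (intro nn_integral_box[symmetric]) auto
  also have "\<dots> \<le> SI t Ga"
    unfolding SI_def
  proof (intro nn_integral_mono)
    fix x
    show "ennreal (\<kappa> (on_slice t x) * Ga (on_slice t x)) * indicator (kbox \<delta> rb) x \<le> ennreal (Ga (on_slice t x)) * indicator Dom x"
    proof (cases "x \<in> kbox \<delta> rb")
      case True
      then have "x \<in> Dom" using kbox_Dom by blast
      moreover have "\<kappa> (on_slice t x) * Ga (on_slice t x) \<le> 1 * Ga (on_slice t x)"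
        using Ga(2)[OF kbox_interior[OF True]] \<kappa>(3) by (intro mult_right_mono)
      ultimately show ?thesis using True by (simp add: ennreal_leI)
    qed simp
  qed
  finally show ?thesis .
qed

lemma SI_le_limit:
  fixes b :: "nat \<Rightarrow> real"
  assumes Ga: "continuous_on interior_pts Ga" "\<And>p. p \<in> interior_pts \<Longrightarrow> 0 \<le> Ga p"
    and \<kappa>: "\<And>j. continuous_on interior_pts (\<kappa> j)" "\<And>j p. 0 \<le> \<kappa> j p"
    and ev: "\<And>x. x \<in> Dom \<Longrightarrow> \<forall>\<^sub>F j in sequentially. x \<in> kbox (\<delta> j) (rb j) \<and> \<kappa> j (on_slice t x) = 1"
    and le: "\<And>j. integral (kbox (\<delta> j) (rb j)) (\<lambda>x. \<kappa> j (on_slice t x) * Ga (on_slice t x)) \<le> b j"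
    and b: "b \<longlonglongrightarrow> b0"
  shows "SI t Ga \<le> ennreal b0"
proof -
  define A where "A j x = ennreal (\<kappa> j (on_slice t x) * Ga (on_slice t x)) * indicator (kbox (\<delta> j) (rb j)) x" for j x
  have cont: "continuous_on (kbox (\<delta> j) (rb j)) (\<lambda>x. \<kappa> j (on_slice t x) * Ga (on_slice t x))" for j
    by (rule continuous_on_slice_comp[OF continuous_on_mult[OF \<kappa>(1) Ga(1)] kbox_interior])
  have meas: "A j \<in> borel_measurable lborel" for j
  proof -
    have "kbox (\<delta> j) (rb j) \<in> sets borel" by (simp add: kbox_def)
    from borel_measurable_continuous_on_indicator[OF this cont]
    have "(\<lambda>x. ennreal (indicator (kbox (\<delta> j) (rb j)) x *\<^sub>R (\<kappa> j (on_slice t x) * Ga (on_slice t x)))) \<in> borel_measurable lborel"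
      by simp
    moreover have "ennreal (indicator (kbox (\<delta> j) (rb j)) x *\<^sub>R (\<kappa> j (on_slice t x) * Ga (on_slice t x))) = A j x" for x
      by (simp add: A_def split: split_indicator)
    ultimately show ?thesis by simp
  qed
  have "SI t Ga \<le> (\<integral>\<^sup>+x. liminf (\<lambda>j. A j x) \<partial>lborel)"
    unfolding SI_def
  proof (intro nn_integral_mono)
    fix x
    show "ennreal (Ga (on_slice t x)) * indicator Dom x \<le> liminf (\<lambda>j. A j x)"
    proof (cases "x \<in> Dom")
      case True
      have "\<forall>\<^sub>F j in sequentially. ennreal (Ga (on_slice t x)) \<le> A j x"
        using ev[OF True] by eventually_elim (simp add: A_def)
      then show ?thesis using True by (simp add: Liminf_bounded)
    qed simp
  qed
  also have "\<dots> \<le> liminf (\<lambda>j. \<integral>\<^sup>+x. A j x \<partial>lborel)"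
    by (rule nn_integral_liminf[OF meas])
  also have "\<dots> \<le> liminf (\<lambda>j. ennreal (b j))"
  proof (intro Liminf_mono always_eventually allI)
    fix j
    have "(\<integral>\<^sup>+x. A j x \<partial>lborel) = ennreal (integral (kbox (\<delta> j) (rb j)) (\<lambda>x. \<kappa> j (on_slice t x) * Ga (on_slice t x)))"
      unfolding A_def using cont[of j] Ga(2)[OF kbox_interior] \<kappa>(2) unfolding kbox_def
      by (intro nn_integral_box) auto
    also have "\<dots> \<le> ennreal (b j)" by (intro ennreal_leI le)
    finally show "(\<integral>\<^sup>+x. A j x \<partial>lborel) \<le> ennreal (b j)" .
  qed
  also have "liminf (\<lambda>j. ennreal (b j)) = ennreal b0"
    using tendsto_ennrealI[OF b] by (intro lim_imp_Liminf) simp_all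
  finally show ?thesis .
qed

lemma mem_kbox_cuts:
  assumes x: "x \<in> Dom" and \<delta>: "0 < \<delta>" "\<delta> * \<bar>ln (x $ Rad)\<bar> \<le> 1" "\<delta> * \<bar>log_tan (on_slice t x)\<bar> \<le> 1" and rb: "x $ Rad \<le> rb"
  shows "x \<in> kbox \<delta> rb" "cutR \<delta> (on_slice t x) = 1" "cutT \<delta> (on_slice t x) = 1"
proof -
  define r \<theta> l where "r = x $ Rad" and "\<theta> = x $ Theta" and "l = ln (tan \<theta>)"
  have r: "r > 0" and \<theta>: "0 < \<theta>" "\<theta> < pi / 2" using x by (auto simp: Dom_def r_def \<theta>_def)
  have l: "log_tan (on_slice t x) = l" by (simp add: log_tan_def l_def \<theta>_def tan_def)
  have tan: "tan \<theta> > 0" using \<theta> by (simp add: tan_gt_zero)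
  have "- 2 / \<delta> \<le> ln r" "- 2 / \<delta> \<le> l" "l \<le> 2 / \<delta>"
  proof -
    have "\<bar>ln r\<bar> \<le> 1 / \<delta>" "\<bar>l\<bar> \<le> 1 / \<delta>" using \<delta> by (simp_all add: r_def l field_simps)
    moreover have "1 / \<delta> \<le> 2 / \<delta>" using \<delta> by (simp add: divide_right_mono)
    ultimately show "- 2 / \<delta> \<le> ln r" "- 2 / \<delta> \<le> l" "l \<le> 2 / \<delta>" by auto
  qed
  then have "exp (- 2 / \<delta>) \<le> exp (ln r)" "exp (- 2 / \<delta>) \<le> exp l" "exp l \<le> exp (2 / \<delta>)" by (simp_all only: exp_le_cancel_iff)
  then have e: "exp (- 2 / \<delta>) \<le> r" "exp (- 2 / \<delta>) \<le> tan \<theta>" "tan \<theta> \<le> exp (2 / \<delta>)"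
    using r tan by (simp_all add: l_def)
  have at: "arctan (tan \<theta>) = \<theta>" using \<theta> by (intro arctan_tan) auto
  have "arctan (exp (- 2 / \<delta>)) \<le> \<theta>" "\<theta> \<le> arctan (exp (2 / \<delta>))"
    using e(2,3) at by (metis arctan_le_iff)+
  then show "x \<in> kbox \<delta> rb"
    using x e rb unfolding kbox_def mem_corner_box Dom_def r_def \<theta>_def by auto
  show "cutR \<delta> (on_slice t x) = 1"
    unfolding cutR_def using beta_limit[OF \<delta>(1,2)] by simp
  show "cutT \<delta> (on_slice t x) = 1"
    unfolding cutT_def using beta_limit[OF \<delta>(1), of "log_tan (on_slice t x)"] beta_limit[OF \<delta>(1), of "- log_tan (on_slice t x)"] \<delta>(3)
    by simp
qed

lemma eventually_small:
  assumes "\<And>j. 0 < \<delta> j" "\<And>j. \<delta> j \<le> 1 / real (Suc j)"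
  shows "\<forall>\<^sub>F j in sequentially. \<delta> j * \<bar>y\<bar> \<le> (1::real)"
proof -
  obtain J where J: "\<bar>y\<bar> \<le> real J" using real_arch_simple by blast
  have "\<delta> j * \<bar>y\<bar> \<le> 1" if "J \<le> j" for j
  proof -
    have "\<delta> j * \<bar>y\<bar> \<le> (1 / real (Suc j)) * real (Suc j)"
      using assms(2)[of j] assms(1)[of j] J that by (intro mult_mono) auto
    then show ?thesis by simp
  qed
  then show ?thesis by (auto simp: eventually_sequentially)
qed

lemma energy_transport:
  assumes U: "coord_solution U" and \<Lambda>: "0 \<le> \<Lambda>" and t: "0 \<le> t"
    and flux: "\<And>p \<xi>. p \<in> interior_pts \<Longrightarrow> R0 \<le> rC p \<Longrightarrow>
      ((rC p)\<^sup>2 + k) * \<bar>\<xi> (Some Rad) * multiplier c \<xi>\<bar> \<le> \<Lambda> * eX c p \<xi>"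
    and Ga: "continuous_on interior_pts Ga" "\<And>p. p \<in> interior_pts \<Longrightarrow> 0 \<le> Ga p"
    and H: "continuous_on interior_pts H" "\<And>p. p \<in> interior_pts \<Longrightarrow> 0 \<le> H p"
    and G0: "continuous_on interior_pts G0" "\<And>p. p \<in> interior_pts \<Longrightarrow> 0 \<le> G0 p"
    and lower: "\<And>p. p \<in> interior_pts \<Longrightarrow> Ga p \<le> wt p * eX c p (du U p) + H p"
    and upper: "\<And>p. p \<in> interior_pts \<Longrightarrow> wt p * eX c p (du U p) \<le> G0 p"
  shows "SI t Ga \<le> SI 0 G0 + SI t H"
proof (cases "SI 0 G0 + SI t H = \<infinity>")
  case False
  then have fin: "SI 0 G0 \<noteq> \<infinity>" "SI t H \<noteq> \<infinity>" by auto
  define g0 h0 where "g0 = enn2real (SI 0 G0)" and "h0 = enn2real (SI t H)"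
  have gh: "SI 0 G0 = ennreal g0" "SI t H = ennreal h0" "g0 \<ge> 0" "h0 \<ge> 0"
    using fin by (auto simp: g0_def h0_def less_top)
  define L where "L j = max 1 (R0 + \<Lambda> * t) + real j" for j :: nat
  have L: "1 \<le> L j" "R0 + \<Lambda> * t \<le> L j" for j by (auto simp: L_def)
  have "\<exists>\<delta>0>0. \<forall>\<delta>. 0 < \<delta> \<longrightarrow> \<delta> < \<delta>0 \<longrightarrow> Ecut \<delta> (L j) \<Lambda> c U t \<le> Ecut \<delta> (L j) \<Lambda> c U 0 + 1 / real (Suc j)" for j
    by (rule Ecut_le[OF U \<Lambda> t flux L]) auto
  then obtain \<delta>0 where \<delta>0: "\<And>j. \<delta>0 j > 0" "\<And>j \<delta>. 0 < \<delta> \<Longrightarrow> \<delta> < \<delta>0 j \<Longrightarrow>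
      Ecut \<delta> (L j) \<Lambda> c U t \<le> Ecut \<delta> (L j) \<Lambda> c U 0 + 1 / real (Suc j)" by metis
  define \<delta> where "\<delta> j = min (\<delta>0 j / 2) (1 / real (Suc j))" for j
  have \<delta>: "0 < \<delta> j" "\<delta> j \<le> 1 / real (Suc j)" "\<delta> j < \<delta>0 j" for j using \<delta>0(1)[of j] by (auto simp: \<delta>_def)
  define \<kappa> where "\<kappa> j = cutoff (\<delta> j) (L j) \<Lambda>" for j
  have \<kappa>: "continuous_on interior_pts (\<kappa> j)" "0 \<le> \<kappa> j p" "\<kappa> j p \<le> 1" for j p
    unfolding \<kappa>_def by (rule C1_on_continuous[OF C1_on_cutoff] cutoff_range)+
  have sm: "smooth U" using U by (simp add: coord_solution_def)
  define E where "E p = wt p * eX c p (du U p)" for p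
  have contE: "continuous_on interior_pts E"
  proof -
    have "continuous_on interior_pts (\<lambda>p. - cur c U None p)"
      by (intro continuous_intros C1_on_continuous[OF C1_on_cur[OF sm]])
    moreover have "- cur c U None p = E p" if "p \<in> interior_pts" for p
      using cur_components(1)[OF that] by (simp add: E_def)
    ultimately show ?thesis by (simp cong: continuous_on_cong)
  qed
  have int: "(\<lambda>x. \<kappa> j (on_slice s x) * F (on_slice s x)) integrable_on kbox \<delta>' rb" if "continuous_on interior_pts F" for F j s \<delta>' rb
    using continuous_on_slice_comp[OF continuous_on_mult[OF \<kappa>(1) that] kbox_interior] unfolding kbox_def
    by (rule integrable_continuous)
  have "SI t Ga \<le> ennreal (g0 + h0)"
  proof (rule SI_le_limit[OF Ga \<kappa>(1,2)])
    show "integral (kbox (\<delta> j) (2 * L j)) (\<lambda>x. \<kappa> j (on_slice t x) * Ga (on_slice t x)) \<le> g0 + h0 + 1 / real (Suc j)" for j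
    proof -
      let ?K = "kbox (\<delta> j) (2 * L j)"
      have 1: "integral ?K (\<lambda>x. \<kappa> j (on_slice 0 x) * G0 (on_slice 0 x)) \<le> g0"
        using box_integral_le_SI[OF G0 \<kappa>, of "\<delta> j" "2 * L j" j 0] gh by simp
      have 2: "integral ?K (\<lambda>x. \<kappa> j (on_slice t x) * H (on_slice t x)) \<le> h0"
        using box_integral_le_SI[OF H \<kappa>, of "\<delta> j" "2 * L j" j t] gh by simp
      have "integral ?K (\<lambda>x. \<kappa> j (on_slice t x) * Ga (on_slice t x))
        \<le> integral ?K (\<lambda>x. \<kappa> j (on_slice t x) * E (on_slice t x) + \<kappa> j (on_slice t x) * H (on_slice t x))"
      proof (intro integral_le integrable_add int Ga H contE)
        fix x assume "x \<in> ?K"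
        then have "Ga (on_slice t x) \<le> E (on_slice t x) + H (on_slice t x)"
          unfolding E_def by (intro lower kbox_interior)
        then show "\<kappa> j (on_slice t x) * Ga (on_slice t x) \<le> \<kappa> j (on_slice t x) * E (on_slice t x) + \<kappa> j (on_slice t x) * H (on_slice t x)"
          using mult_left_mono[OF _ \<kappa>(2)] by (metis distrib_left)
      qed
      also have "\<dots> = Ecut (\<delta> j) (L j) \<Lambda> c U t + integral ?K (\<lambda>x. \<kappa> j (on_slice t x) * H (on_slice t x))"
        by (subst integral_add[OF int[OF contE] int[OF H(1)]]) (simp add: Ecut_def \<kappa>_def E_def)
      also have "\<dots> \<le> Ecut (\<delta> j) (L j) \<Lambda> c U 0 + 1 / real (Suc j) + h0"
        using \<delta>0(2)[OF \<delta>(1,3)] 2 by (intro add_mono)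
      also have "Ecut (\<delta> j) (L j) \<Lambda> c U 0 \<le> integral ?K (\<lambda>x. \<kappa> j (on_slice 0 x) * G0 (on_slice 0 x))"
      proof -
        have "integral ?K (\<lambda>x. \<kappa> j (on_slice 0 x) * E (on_slice 0 x)) \<le> integral ?K (\<lambda>x. \<kappa> j (on_slice 0 x) * G0 (on_slice 0 x))"
        proof (intro integral_le int contE G0)
          fix x assume "x \<in> ?K"
          then have "E (on_slice 0 x) \<le> G0 (on_slice 0 x)" unfolding E_def by (intro upper kbox_interior)
          then show "\<kappa> j (on_slice 0 x) * E (on_slice 0 x) \<le> \<kappa> j (on_slice 0 x) * G0 (on_slice 0 x)"
            by (intro mult_left_mono \<kappa>)
        qed
        then show ?thesis by (simp add: Ecut_def \<kappa>_def E_def)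
      qed
      finally show ?thesis using 1 by simp
    qed
    have "(\<lambda>j. g0 + h0 + 1 / real (Suc j)) \<longlonglongrightarrow> g0 + h0 + 0"
      using LIMSEQ_inverse_real_of_nat by (intro tendsto_add tendsto_const) (simp add: inverse_eq_divide)
    then show "(\<lambda>j. g0 + h0 + 1 / real (Suc j)) \<longlonglongrightarrow> g0 + h0" by simp
    fix x assume x: "x \<in> Dom"
    obtain J where J: "\<bar>x $ Rad\<bar> + \<bar>\<Lambda> * t\<bar> \<le> real J" using real_arch_simple by blast
    have "\<forall>\<^sub>F j in sequentially. J \<le> j" by (rule eventually_ge_at_top)
    with eventually_small[of \<delta> "ln (x $ Rad)", OF \<delta>(1,2)] eventually_small[of \<delta> "log_tan (on_slice t x)", OF \<delta>(1,2)]
    show "\<forall>\<^sub>F j in sequentially. x \<in> kbox (\<delta> j) (2 * L j) \<and> \<kappa> j (on_slice t x) = 1"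
    proof eventually_elim
      case (elim j)
      have Lj: "\<bar>x $ Rad\<bar> + \<bar>\<Lambda> * t\<bar> \<le> L j" using J elim(3) by (simp add: L_def)
      have "x $ Rad \<le> 2 * L j" using Lj L(1)[of j] by linarith
      note c = mem_kbox_cuts[OF x \<delta>(1) elim(1,2) this]
      have "(x $ Rad + \<Lambda> * t) / L j \<le> 1" using Lj L(1)[of j] by (simp add: field_simps)
      then have "cutO (L j) \<Lambda> (on_slice t x) = 1" by (simp add: cutO_def beta_1)
      with c show ?case by (simp add: \<kappa>_def cutoff_def)
    qed
  qed
  then show ?thesis using gh by (simp add: ennreal_plus)
next
  case True
  then show ?thesis by (metis ennreal_top_eq_mult_iff infinity_ennreal_def top_greatest)
qed

end

lemma ennreal_finite_mono: "a \<le> b \<Longrightarrow> b \<noteq> \<infinity> \<Longrightarrow> a \<noteq> \<infinity>" for a b :: ennreal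
  by (auto simp: top_unique)

lemma ennreal_finite_cmult: "a \<le> ennreal c * b \<Longrightarrow> b \<noteq> \<infinity> \<Longrightarrow> a \<noteq> \<infinity>" for a b :: ennreal
  by (erule ennreal_finite_mono) (simp add: ennreal_mult_eq_top_iff)

context three_charge_microstate
begin

lemma continuous_wt: "continuous_on A wt"
  unfolding wt_def[abs_def] by (intro continuous_intros)

lemma wt_nonneg: "p \<in> interior_pts \<Longrightarrow> 0 \<le> wt p"
  using interior_nz[of p] by (simp add: wt_def)

lemma continuous_S: "continuous_on A S"
proof -
  have "\<eta> * ((rC p)\<^sup>2 + k) \<noteq> 0" for p using rk_pos[of p] basic_pos by auto
  then show ?thesis unfolding S_def[abs_def] by (intro continuous_intros f_continuous) auto
qed

lemma continuous_densities:
  assumes "smooth U"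
  shows "continuous_on interior_pts (\<lambda>p. Q0 p (du U p))" "continuous_on interior_pts (\<lambda>p. eV p (du U p))"
    "continuous_on interior_pts (\<lambda>p. NN p (du U p))"
proof -
  have c: "continuous_on interior_pts (pd i U)" for i
    by (rule smooth_continuous[OF smooth_pd[OF assms]])
  have nz: "rC p \<noteq> 0" "sin (thC p) \<noteq> 0" "cos (thC p) \<noteq> 0" "(rC p)\<^sup>2 + k \<noteq> 0" "S p \<noteq> 0"
    if "p \<in> interior_pts" for p using interior_nz[OF that] rk_pos[of p] S_pos[of p] by auto
  have B: "continuous_on interior_pts (\<lambda>p. Bu p (du U p))"
    unfolding Bu_def Xu_def by (intro continuous_intros f_continuous c) (auto simp: nz)
  show Q: "continuous_on interior_pts (\<lambda>p. Q0 p (du U p))"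
    unfolding Q0_def Xu_def by (intro continuous_intros c) (auto simp: nz)
  show "continuous_on interior_pts (\<lambda>p. eV p (du U p))"
    unfolding eV_def by (intro continuous_intros Q c continuous_S) auto
  show "continuous_on interior_pts (\<lambda>p. NN p (du U p))"
    unfolding NN_def Mu_def by (intro continuous_intros Q B c continuous_S) (auto simp: nz)
qed

section \<open>The Hardy inequality\<close>

lemma hardy:
  assumes W: "smooth W" and fin: "SI t (\<lambda>p. wt p * (W p)\<^sup>2) \<noteq> \<infinity>"
  shows "SI t (\<lambda>p. wt p * (W p)\<^sup>2) \<le> SI t (\<lambda>p. wt p * (((rC p)\<^sup>2 + k) * (pd (Some Rad) W p)\<^sup>2))"
proof (cases "SI t (\<lambda>p. wt p * (((rC p)\<^sup>2 + k) * (pd (Some Rad) W p)\<^sup>2)) = \<infinity>")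
  case False
  define Wd Hd where "Wd p = wt p * (W p)\<^sup>2" and "Hd p = wt p * (((rC p)\<^sup>2 + k) * (pd (Some Rad) W p)\<^sup>2)" for p
  define w0 h0 where "w0 = enn2real (SI t Wd)" and "h0 = enn2real (SI t Hd)"
  have wh: "SI t Wd = ennreal w0" "SI t Hd = ennreal h0" "w0 \<ge> 0" "h0 \<ge> 0"
    using fin False by (auto simp: w0_def h0_def Wd_def[abs_def] Hd_def[abs_def] less_top)
  obtain B where B: "B > 0" "\<And>y. dbeta y \<le> B" using dbeta_bounded by blast
  have Wc: "continuous_on interior_pts Wd"
    unfolding Wd_def by (intro continuous_intros continuous_wt smooth_continuous W)
  have Hc: "continuous_on interior_pts Hd"
    unfolding Hd_def by (intro continuous_intros continuous_wt smooth_continuous smooth_pd W)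
  have W0: "0 \<le> Wd p" if "p \<in> interior_pts" for p using wt_nonneg[OF that] by (simp add: Wd_def)
  have H0: "0 \<le> Hd p" if "p \<in> interior_pts" for p using wt_nonneg[OF that] rk_pos[of p] by (simp add: Hd_def)
  define \<delta> where "\<delta> j = 1 / real (Suc j)" for j
  have \<delta>: "0 < \<delta> j" "\<delta> j \<le> 1 / real (Suc j)" for j by (auto simp: \<delta>_def)
  define cX where "cX j p = beta (- (\<delta> j * ln (rC p)))" for j p
  define \<kappa> where "\<kappa> j p = cutR (\<delta> j) p * cX j p * cutT (\<delta> j) p" for j p
  have C1\<kappa>: "C1_on interior_pts (\<kappa> j)" for j
    unfolding \<kappa>_def cX_def by (intro C1_on_mult C1_on_cuts)
  have cX: "0 \<le> cX j p" "cX j p \<le> 1" for j p by (simp_all add: cX_def beta_range)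
  have \<kappa>: "continuous_on interior_pts (\<kappa> j)" "0 \<le> \<kappa> j p" "\<kappa> j p \<le> 1" for j p
    using C1_on_continuous[OF C1\<kappa>[of j]] by (simp_all add: \<kappa>_def cut_range cX mult_le_one)
  have int: "(\<lambda>x. F (on_slice t x)) integrable_on kbox \<delta>' rb" if "continuous_on interior_pts F" for F :: "coords \<Rightarrow> real" and \<delta>' rb
  proof -
    have "continuous_on (kbox \<delta>' rb) (\<lambda>x. F (on_slice t x))"
      by (rule continuous_on_slice_comp[OF that kbox_interior])
    then show ?thesis unfolding kbox_def by (rule integrable_continuous)
  qed
  have "SI t Wd \<le> ennreal h0"
  proof (rule SI_le_limit[OF Wc W0 \<kappa>(1,2)])
    fix j
    let ?K = "kbox (\<delta> j) (exp (2 / \<delta> j))"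
    define M where "M p = (rC p)\<^sup>2 * (sin (thC p) * cos (thC p)) * (W p)\<^sup>2" for p
    have C1M: "C1_on interior_pts M"
      unfolding M_def by (intro C1_on_mult C1_on_power C1_on_sin C1_on_cos C1_on_nth smooth_C1_on W)
    define F where "F p = \<kappa> j p * M p" for p
    have C1F: "C1_on interior_pts F" unfolding F_def by (intro C1_on_mult C1\<kappa> C1M)
    have K: "?K = cbox (corner (exp (- 2 / \<delta> j)) (arctan (exp (- 2 / \<delta> j))) 0) (corner (exp (2 / \<delta> j)) (arctan (exp (2 / \<delta> j))) 1)"
      by (simp add: kbox_def)
    have div0: "integral ?K (\<lambda>x. pd (Some Rad) F (on_slice t x)) = 0"
      unfolding K
    proof (rule integral_divergence_component[OF C1F])
      show "exp (- 2 / \<delta> j) \<le> exp (2 / \<delta> j)" using \<delta>(1)[of j] by (simp add: divide_right_mono)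
      show "arctan (exp (- 2 / \<delta> j)) \<le> arctan (exp (2 / \<delta> j))" by (rule kbox_angles(3)[OF \<delta>(1)])
      fix x assume "x $ Rad = corner (exp (- 2 / \<delta> j)) (arctan (exp (- 2 / \<delta> j))) 0 $ Rad"
      then have 1: "x $ Rad = exp (- 2 / \<delta> j)" by simp
      let ?y = "x + (corner (exp (2 / \<delta> j)) (arctan (exp (2 / \<delta> j))) 1 $ Rad - corner (exp (- 2 / \<delta> j)) (arctan (exp (- 2 / \<delta> j))) 0 $ Rad) *\<^sub>R axis Rad 1"
      have 2: "?y $ Rad = exp (2 / \<delta> j)" using 1 by (simp add: axis_def)
      have "cutR (\<delta> j) (on_slice t x) = 0" using 1 \<delta>(1)[of j] by (simp add: cutR_def beta_0)
      moreover have "cX j (on_slice t ?y) = 0" using 2 \<delta>(1)[of j] by (simp add: cX_def beta_0 del: vector_add_component)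
      ultimately show "F (on_slice t ?y) = F (on_slice t x)" by (simp add: F_def \<kappa>_def)
    qed (use kbox_angles in auto)
    have point: "\<kappa> j p * Wd p \<le> \<kappa> j p * Hd p + \<delta> j * B * Wd p + pd (Some Rad) F p" if p: "p \<in> interior_pts" for p
    proof -
      note nz = interior_nz[OF p]
      have dM: "M differentiable (at p)" and d\<kappa>: "\<kappa> j differentiable (at p)" and dW: "W differentiable (at p)"
        by (rule C1_onD(1)[OF C1M p] C1_onD(1)[OF C1\<kappa> p] smooth_differentiable[OF W])+
      define Wr where "Wr = pd (Some Rad) W p"
      have pM: "pd (Some Rad) M p = 2 * Wd p + 2 * (rC p)\<^sup>2 * (sin (thC p) * cos (thC p)) * (W p * Wr)"
      proof (rule pd_eqI[OF dM])
        have "((\<lambda>s. W (p + s *\<^sub>R axis (Some Rad) 1)) has_real_derivative Wr) (at 0)"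
          unfolding Wr_def by (rule pd_line[OF dW])
        then show "((\<lambda>s. M (p + s *\<^sub>R axis (Some Rad) 1)) has_real_derivative
            2 * Wd p + 2 * (rC p)\<^sup>2 * (sin (thC p) * cos (thC p)) * (W p * Wr)) (at 0)"
          unfolding M_def
          by (auto intro!: derivative_eq_intros simp: axis_def Wd_def wt_def power2_eq_square algebra_simps)
      qed
      have dR: "cutR (\<delta> j) differentiable (at p)" and dX: "cX j differentiable (at p)" and dT: "cutT (\<delta> j) differentiable (at p)"
        unfolding cX_def
        by (rule C1_onD(1)[OF C1_on_cuts(2) p] C1_onD(1)[OF C1_on_cuts(4) p] C1_onD(1)[OF C1_on_cuts(1) p])+
      have pX: "pd (Some Rad) (cX j) p = - (dbeta (- (\<delta> j * ln (rC p))) * (\<delta> j / rC p))"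
        unfolding cX_def by (rule pd_cutR(4)[OF p])
      have p\<kappa>: "pd (Some Rad) (\<kappa> j) p = (cutR (\<delta> j) p * pd (Some Rad) (cX j) p + pd (Some Rad) (cutR (\<delta> j)) p * cX j p) * cutT (\<delta> j) p"
        unfolding \<kappa>_def by (simp add: pd_mult dR dX dT differentiable_mult pd_cutT(2)[OF p])
      have rM: "M p = rC p * Wd p" by (simp add: M_def Wd_def wt_def power2_eq_square)
      have "pd (Some Rad) (\<kappa> j) p * M p =
        cutT (\<delta> j) p * \<delta> j * Wd p * (dbeta (\<delta> j * ln (rC p)) * cX j p - cutR (\<delta> j) p * dbeta (- (\<delta> j * ln (rC p))))"
        unfolding p\<kappa> pX pd_cutR(1)[OF p] rM using nz by (simp add: field_simps)
      also have "\<dots> \<ge> cutT (\<delta> j) p * \<delta> j * Wd p * (0 - 1 * B)"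
        using cut_range \<delta>(1)[of j] W0[OF p] cX dbeta_nonneg B
        by (intro mult_left_mono diff_mono mult_mono mult_nonneg_nonneg) (auto intro: less_imp_le)
      finally have "- (cutT (\<delta> j) p * (\<delta> j * B * Wd p)) \<le> pd (Some Rad) (\<kappa> j) p * M p" by (simp add: mult_ac)
      moreover have "cutT (\<delta> j) p * (\<delta> j * B * Wd p) \<le> 1 * (\<delta> j * B * Wd p)"
        using cut_range(2) \<delta>(1)[of j] B W0[OF p] by (intro mult_right_mono) (auto simp: less_imp_le)
      ultimately have k1: "- (\<delta> j * B * Wd p) \<le> pd (Some Rad) (\<kappa> j) p * M p" by linarith
      have k2: "- (Wd p + Hd p) \<le> 2 * (rC p)\<^sup>2 * (sin (thC p) * cos (thC p)) * (W p * Wr)"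
      proof -
        have "0 \<le> (W p + rC p * Wr)\<^sup>2" by simp
        then have "- ((W p)\<^sup>2 + (rC p)\<^sup>2 * Wr\<^sup>2) \<le> 2 * rC p * (W p * Wr)"
          by (simp add: power2_eq_square algebra_simps)
        moreover have "(rC p)\<^sup>2 * Wr\<^sup>2 \<le> ((rC p)\<^sup>2 + k) * Wr\<^sup>2"
          using basic_pos by (intro mult_right_mono) auto
        ultimately have "- ((W p)\<^sup>2 + ((rC p)\<^sup>2 + k) * Wr\<^sup>2) \<le> 2 * rC p * (W p * Wr)" by linarith
        from mult_left_mono[OF this wt_nonneg[OF p]] show ?thesis
          by (simp add: Wd_def Hd_def Wr_def wt_def power2_eq_square algebra_simps)
      qed
      have "pd (Some Rad) F p = \<kappa> j p * pd (Some Rad) M p + pd (Some Rad) (\<kappa> j) p * M p"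
        unfolding F_def by (rule pd_mult[OF d\<kappa> dM])
      moreover have "\<kappa> j p * (Wd p - Hd p) \<le> \<kappa> j p * pd (Some Rad) M p"
        using k2 unfolding pM by (intro mult_left_mono \<kappa>) linarith
      ultimately show ?thesis using k1 by (simp add: algebra_simps)
    qed
    have i1: "integral ?K (\<lambda>x. \<kappa> j (on_slice t x) * Hd (on_slice t x)) \<le> h0"
      using box_integral_le_SI[OF Hc H0 \<kappa>, of "\<delta> j" "exp (2 / \<delta> j)" j t] wh by simp
    have i2: "integral ?K (\<lambda>x. Wd (on_slice t x)) \<le> w0"
      using box_integral_le_SI[OF Wc W0, of "\<lambda>_. 1" "\<delta> j" "exp (2 / \<delta> j)" t] wh by simp
    have n1: "(\<lambda>x. \<kappa> j (on_slice t x) * Wd (on_slice t x)) integrable_on ?K"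
      "(\<lambda>x. \<kappa> j (on_slice t x) * Hd (on_slice t x)) integrable_on ?K"
      "(\<lambda>x. \<delta> j * B * Wd (on_slice t x)) integrable_on ?K" "(\<lambda>x. pd (Some Rad) F (on_slice t x)) integrable_on ?K"
      using int[OF continuous_on_mult[OF \<kappa>(1) Wc]] int[OF continuous_on_mult[OF \<kappa>(1) Hc]]
        int[OF continuous_on_mult_left[OF Wc]] int[OF C1_on_pd_continuous[OF C1F]] by auto
    have "integral ?K (\<lambda>x. \<kappa> j (on_slice t x) * Wd (on_slice t x))
      \<le> integral ?K (\<lambda>x. \<kappa> j (on_slice t x) * Hd (on_slice t x) + \<delta> j * B * Wd (on_slice t x) + pd (Some Rad) F (on_slice t x))"
      by (intro integral_le integrable_add n1 point kbox_interior)
    also have "\<dots> = integral ?K (\<lambda>x. \<kappa> j (on_slice t x) * Hd (on_slice t x)) + \<delta> j * B * integral ?K (\<lambda>x. Wd (on_slice t x))"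
      by (simp add: integral_add integrable_add n1 div0)
    also have "\<dots> \<le> h0 + \<delta> j * B * w0"
      using i1 i2 \<delta>(1)[of j] B by (intro add_mono mult_left_mono) (auto simp: less_imp_le)
    finally show "integral ?K (\<lambda>x. \<kappa> j (on_slice t x) * Wd (on_slice t x)) \<le> h0 + \<delta> j * B * w0" .
  next
    have "(\<lambda>j. h0 + \<delta> j * B * w0) \<longlonglongrightarrow> h0 + 0 * B * w0"
      unfolding \<delta>_def using LIMSEQ_inverse_real_of_nat by (intro tendsto_intros) (simp add: inverse_eq_divide)
    then show "(\<lambda>j. h0 + \<delta> j * B * w0) \<longlonglongrightarrow> h0" by simp
  next
    fix x assume x: "x \<in> Dom"
    from eventually_small[of \<delta> "ln (x $ Rad)", OF \<delta>] eventually_small[of \<delta> "log_tan (on_slice t x)", OF \<delta>]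
    show "\<forall>\<^sub>F j in sequentially. x \<in> kbox (\<delta> j) (exp (2 / \<delta> j)) \<and> \<kappa> j (on_slice t x) = 1"
    proof eventually_elim
      case (elim j)
      have r: "x $ Rad > 0" using x by (simp add: Dom_def)
      have "\<bar>ln (x $ Rad)\<bar> \<le> 1 / \<delta> j" using elim(1) \<delta>(1)[of j] by (simp add: field_simps)
      moreover have "1 / \<delta> j \<le> 2 / \<delta> j" using \<delta>(1)[of j] by (simp add: divide_right_mono)
      ultimately have "exp (ln (x $ Rad)) \<le> exp (2 / \<delta> j)" by (simp only: exp_le_cancel_iff)
      then have "x $ Rad \<le> exp (2 / \<delta> j)" using r by simp
      note c = mem_kbox_cuts[OF x \<delta>(1) elim(1,2) this]
      have "cX j (on_slice t x) = 1"
        using beta_limit[OF \<delta>(1), of j "- ln (x $ Rad)"] elim(1) by (simp add: cX_def)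
      with c show ?case by (simp add: \<kappa>_def)
    qed
  qed
  then show ?thesis using wh by (simp add: Wd_def[abs_def] Hd_def[abs_def])
qed simp

section \<open>Energy estimates\<close>

lemma SI_eV_le:
  assumes U: "coord_solution U" and t: "0 \<le> t"
  shows "SI t (\<lambda>p. wt p * eV p (du U p)) \<le> SI 0 (\<lambda>p. wt p * eV p (du U p))"
proof -
  have sm: "smooth U" using U by (simp add: coord_solution_def)
  obtain C where C: "C \<ge> 0" "\<And>p \<xi>. ((rC p)\<^sup>2 + k) * \<bar>\<xi> (Some Rad) * (\<xi> None + \<xi> (Some Zed))\<bar> \<le> C * eV p \<xi>"
    using eV_flux by blast
  have c: "continuous_on interior_pts (\<lambda>p. wt p * eV p (du U p))"
    by (intro continuous_intros continuous_wt continuous_densities sm)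
  have n: "0 \<le> wt p * eV p (du U p)" if "p \<in> interior_pts" for p
    using wt_nonneg[OF that] eV_nonneg by simp
  have "SI t (\<lambda>p. wt p * eV p (du U p)) \<le> SI 0 (\<lambda>p. wt p * eV p (du U p)) + SI t (\<lambda>_. 0)"
    by (rule energy_transport[OF U C(1) t, of 0 1]) (use C(2) c n in \<open>auto simp: multiplier_def eX_1\<close>)
  then show ?thesis by (simp add: SI_def)
qed

lemma SI_NN_le:
  "\<exists>K\<ge>0. \<exists>b R. continuous_on interior_pts b \<and> (\<forall>p. 0 \<le> b p \<and> b p \<le> 1) \<and> (\<forall>p. 2 * R \<le> rC p \<longrightarrow> b p = 0) \<and>
     (\<forall>U t. coord_solution U \<longrightarrow> 0 \<le> t \<longrightarrow>
       SI t (\<lambda>p. wt p * NN p (du U p)) \<le> ennreal K * (SI 0 (\<lambda>p. wt p * NN p (du U p))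
         + SI t (\<lambda>p. wt p * (eV p (du U p) + b p * ((pd (Some Phi) U p)\<^sup>2 + (pd (Some Psi) U p)\<^sup>2)))))"
proof -
  obtain C c R where C: "C \<ge> 0" and c: "c > 0" and R: "R > 0" and
    eT: "\<And>p \<xi>. p \<in> interior_pts \<Longrightarrow> \<bar>eT p \<xi>\<bar> \<le> C * NN p \<xi>"
      "\<And>p \<xi>. p \<in> interior_pts \<Longrightarrow> R \<le> rC p \<Longrightarrow> c * NN p \<xi> \<le> eT p \<xi>"
    using eT_bounds by blast
  obtain Cf where Cf: "Cf \<ge> 0" "\<And>p \<xi>. ((rC p)\<^sup>2 + k) * \<bar>\<xi> (Some Rad) * \<xi> None\<bar> \<le> Cf * NN p \<xi>"
    using eT_flux by blast
  obtain Ci where Ci: "Ci \<ge> 0" "\<And>p \<xi>. p \<in> interior_pts \<Longrightarrow> rC p \<le> R \<Longrightarrow> NN p \<xi> \<le> Ci * (eV p \<xi> + (\<xi> (Some Phi))\<^sup>2 + (\<xi> (Some Psi))\<^sup>2)"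
    using NN_le_inner by blast
  define b where "b p = beta (- (rC p / R))" for p :: coords
  have b: "continuous_on interior_pts b"
    unfolding b_def by (intro continuous_on_compose2[OF continuous_beta[of UNIV]] continuous_intros) (use R in auto)
  have b01: "0 \<le> b p" "b p \<le> 1" for p by (simp_all add: b_def beta_range)
  have b0: "b p = 0" if "2 * R \<le> rC p" for p using that R by (simp add: b_def beta_0 field_simps)
  have b1: "b p = 1" if "rC p \<le> R" for p using that R by (simp add: b_def beta_1 field_simps)
  define C2 where "C2 = (c + C) * Ci"
  have C2: "C2 \<ge> 0" using c C Ci by (simp add: C2_def)
  define K where "K = max C C2 / c"
  have K: "K \<ge> 0" using C c by (simp add: K_def)
  have main: "SI t (\<lambda>p. wt p * NN p (du U p)) \<le> ennreal K * (SI 0 (\<lambda>p. wt p * NN p (du U p))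
         + SI t (\<lambda>p. wt p * (eV p (du U p) + b p * ((pd (Some Phi) U p)\<^sup>2 + (pd (Some Psi) U p)\<^sup>2))))"
    if U: "coord_solution U" and t: "0 \<le> t" for U t
  proof -
    have sm: "smooth U" using U by (simp add: coord_solution_def)
    define Nw Hw where "Nw p = wt p * NN p (du U p)"
      and "Hw p = wt p * (eV p (du U p) + b p * ((pd (Some Phi) U p)\<^sup>2 + (pd (Some Psi) U p)\<^sup>2))" for p
    have cN: "continuous_on interior_pts Nw"
      unfolding Nw_def by (intro continuous_intros continuous_wt continuous_densities sm)
    have cH: "continuous_on interior_pts Hw"
      unfolding Hw_def by (intro continuous_intros continuous_wt continuous_densities sm b smooth_continuous smooth_pd)
    have N0: "0 \<le> Nw p" if "p \<in> interior_pts" for p using wt_nonneg[OF that] NN_parts(3) by (simp add: Nw_def)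
    have H0: "0 \<le> Hw p" if "p \<in> interior_pts" for p
      unfolding Hw_def using wt_nonneg[OF that] eV_nonneg b01 by (intro mult_nonneg_nonneg add_nonneg_nonneg) auto
    have fl: "((rC p)\<^sup>2 + k) * \<bar>\<xi> (Some Rad) * multiplier 0 \<xi>\<bar> \<le> Cf / c * eX 0 p \<xi>" if p: "p \<in> interior_pts" "R \<le> rC p" for p \<xi>
    proof -
      have "Cf * NN p \<xi> = Cf / c * (c * NN p \<xi>)" using c by simp
      also have "\<dots> \<le> Cf / c * eT p \<xi>" using eT(2)[OF p, of \<xi>] Cf c by (intro mult_left_mono) auto
      finally show ?thesis using Cf(2)[of p \<xi>] by (simp add: eX_0 multiplier_def)
    qed
    have "SI t (\<lambda>p. c * Nw p) \<le> SI 0 (\<lambda>p. C * Nw p) + SI t (\<lambda>p. C2 * Hw p)"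
    proof (rule energy_transport[OF U _ t fl])
      show "0 \<le> Cf / c" using Cf c by simp
      show "continuous_on interior_pts (\<lambda>p. c * Nw p)" "continuous_on interior_pts (\<lambda>p. C * Nw p)"
        "continuous_on interior_pts (\<lambda>p. C2 * Hw p)" by (intro continuous_intros cN cH)+
      fix p assume p: "p \<in> interior_pts"
      show "0 \<le> c * Nw p" "0 \<le> C * Nw p" "0 \<le> C2 * Hw p" using N0[OF p] H0[OF p] c C C2 by simp_all
      have "eT p (du U p) \<le> C * NN p (du U p)" using eT(1)[OF p, of "du U p"] by linarith
      from mult_left_mono[OF this wt_nonneg[OF p]]
      show "wt p * eX 0 p (du U p) \<le> C * Nw p" by (simp add: eX_0 Nw_def mult_ac)
      have "c * NN p (du U p) \<le> eT p (du U p) + C2 * (eV p (du U p) + b p * ((pd (Some Phi) U p)\<^sup>2 + (pd (Some Psi) U p)\<^sup>2))"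
      proof (cases "R \<le> rC p")
        case True
        have "0 \<le> C2 * (eV p (du U p) + b p * ((pd (Some Phi) U p)\<^sup>2 + (pd (Some Psi) U p)\<^sup>2))"
          using C2 eV_nonneg b01 by (intro mult_nonneg_nonneg add_nonneg_nonneg) auto
        with eT(2)[OF p True, of "du U p"] show ?thesis by linarith
      next
        case False
        then have r: "rC p \<le> R" by simp
        have "c * NN p (du U p) - eT p (du U p) \<le> (c + C) * NN p (du U p)"
          using eT(1)[OF p, of "du U p"] by (simp add: distrib_right)
        also have "\<dots> \<le> (c + C) * (Ci * (eV p (du U p) + (pd (Some Phi) U p)\<^sup>2 + (pd (Some Psi) U p)\<^sup>2))"
          using Ci(2)[OF p r, of "du U p"] c C by (intro mult_left_mono) auto
        finally show ?thesis using b1[OF r] by (simp add: C2_def mult.assoc add.assoc)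
      qed
      from mult_left_mono[OF this wt_nonneg[OF p]]
      show "c * Nw p \<le> wt p * eX 0 p (du U p) + C2 * Hw p"
        by (simp add: eX_0 Nw_def Hw_def distrib_left mult_ac)
    qed
    then have 1: "ennreal c * SI t Nw \<le> ennreal C * SI 0 Nw + ennreal C2 * SI t Hw"
      using SI_cmult[OF cN less_imp_le[OF c] N0] SI_cmult[OF cN C N0] SI_cmult[OF cH C2 H0] by simp
    have "SI t Nw = ennreal (1 / c) * (ennreal c * SI t Nw)"
      using c by (simp add: mult.assoc[symmetric] flip: ennreal_mult)
    also have "\<dots> \<le> ennreal (1 / c) * (ennreal C * SI 0 Nw + ennreal C2 * SI t Hw)"
      by (intro mult_left_mono 1) simp
    also have "\<dots> \<le> ennreal (1 / c) * (ennreal (max C C2) * SI 0 Nw + ennreal (max C C2) * SI t Hw)"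
      by (intro mult_left_mono add_mono mult_right_mono ennreal_leI) auto
    also have "\<dots> = ennreal (1 / c) * ennreal (max C C2) * (SI 0 Nw + SI t Hw)"
      by (simp add: distrib_left mult.assoc)
    also have "ennreal (1 / c) * ennreal (max C C2) = ennreal K"
      using c C by (subst ennreal_mult[symmetric]) (auto simp: K_def)
    finally show ?thesis by (simp add: Nw_def[abs_def] Hw_def[abs_def])
  qed
  show ?thesis
    using K b b01 b0 main by blast
qed

lemma SI_compact_finite:
  assumes W: "continuous_on UNIV W" and b: "\<And>p. 0 \<le> b p \<and> b p \<le> 1" "\<And>p. 2 * R \<le> rC p \<Longrightarrow> b p = 0"
  shows "SI t (\<lambda>p. wt p * (b p * \<bar>W p\<bar>)) \<noteq> \<infinity>"
proof -
  define D where "D = cbox (corner 0 0 0) (corner (2 * R) (pi / 2) 1)"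
  have "bounded ((\<lambda>x. wt (on_slice t x) * \<bar>W (on_slice t x)\<bar>) ` D)"
  proof (intro compact_imp_bounded compact_continuous_image continuous_intros)
    show "continuous_on D (\<lambda>x. wt (on_slice t x))" "continuous_on D (\<lambda>x. W (on_slice t x))"
      by (rule continuous_on_compose2[OF continuous_wt[of UNIV] continuous_on_slice'] continuous_on_compose2[OF W continuous_on_slice']; simp)+
  qed (simp add: D_def)
  then obtain M where M: "\<And>x. x \<in> D \<Longrightarrow> \<bar>wt (on_slice t x) * \<bar>W (on_slice t x)\<bar>\<bar> \<le> M" by (auto simp: bounded_iff)
  have "SI t (\<lambda>p. wt p * (b p * \<bar>W p\<bar>)) \<le> (\<integral>\<^sup>+x. ennreal M * indicator D x \<partial>lborel)"
    unfolding SI_def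
  proof (intro nn_integral_mono)
    fix x
    show "ennreal (wt (on_slice t x) * (b (on_slice t x) * \<bar>W (on_slice t x)\<bar>)) * indicator Dom x \<le> ennreal M * indicator D x"
    proof (cases "x \<in> Dom \<and> x $ Rad \<le> 2 * R")
      case True
      then have D: "x \<in> D" unfolding D_def mem_corner_box Dom_def by auto
      have "wt (on_slice t x) * (b (on_slice t x) * \<bar>W (on_slice t x)\<bar>) \<le> wt (on_slice t x) * (1 * \<bar>W (on_slice t x)\<bar>)"
        using wt_nonneg[OF Dom_interior, of x t] True b(1) by (intro mult_left_mono mult_right_mono) auto
      then have "wt (on_slice t x) * (b (on_slice t x) * \<bar>W (on_slice t x)\<bar>) \<le> M" using M[OF D] by simp
      then show ?thesis using D True by (simp add: ennreal_leI)
    next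
      case False
      then show ?thesis using b(2)[of "on_slice t x"] by (cases "x \<in> Dom") auto
    qed
  qed
  also have "\<dots> = ennreal M * emeasure lborel D" by (subst nn_integral_cmult_indicator) (auto simp: D_def)
  also have "\<dots> < \<infinity>" by (simp add: D_def ennreal_mult_less_top emeasure_lborel_cbox_finite[unfolded infinity_ennreal_def])
  finally show ?thesis by simp
qed

lemma SI_estimate:
  "\<exists>K\<ge>0. \<forall>U t. coord_solution U \<longrightarrow> 0 \<le> t \<longrightarrow>
     SI t (\<lambda>p. wt p * NN p (du U p)) \<le> ennreal K * (SI 0 (\<lambda>p. wt p * NN p (du U p))
       + SI 0 (\<lambda>p. wt p * NN p (du (pd (Some Phi) U) p)) + SI 0 (\<lambda>p. wt p * NN p (du (pd (Some Psi) U) p)))"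
proof -
  obtain K b R where K: "K \<ge> 0" and b: "continuous_on interior_pts b" "\<And>p. 0 \<le> b p \<and> b p \<le> 1" "\<And>p. 2 * R \<le> rC p \<Longrightarrow> b p = 0"
    and T: "\<And>U t. coord_solution U \<Longrightarrow> 0 \<le> t \<Longrightarrow>
       SI t (\<lambda>p. wt p * NN p (du U p)) \<le> ennreal K * (SI 0 (\<lambda>p. wt p * NN p (du U p))
         + SI t (\<lambda>p. wt p * (eV p (du U p) + b p * ((pd (Some Phi) U p)\<^sup>2 + (pd (Some Psi) U p)\<^sup>2))))"
    using SI_NN_le by blast
  obtain Ce where Ce: "Ce \<ge> 0" "\<And>p \<xi>. p \<in> interior_pts \<Longrightarrow> eV p \<xi> \<le> Ce * NN p \<xi>" using eV_le_NN by blast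
  obtain Cm where Cm: "Cm \<ge> 0" "\<And>p \<xi>. p \<in> interior_pts \<Longrightarrow> (\<xi> (Some Phi))\<^sup>2 \<le> Cm * Mu p \<xi>"
    "\<And>p \<xi>. p \<in> interior_pts \<Longrightarrow> (\<xi> (Some Psi))\<^sup>2 \<le> Cm * Mu p \<xi>" using Mu_coercive by blast
  define NI EI WI where "NI U t = SI t (\<lambda>p. wt p * NN p (du U p))" and "EI U t = SI t (\<lambda>p. wt p * eV p (du U p))"
    and "WI W t = SI t (\<lambda>p. wt p * (W p)\<^sup>2)" for U W t
  have EN: "EI U t \<le> ennreal Ce * NI U 0" if U: "coord_solution U" and t: "0 \<le> t" for U t
  proof -
    have sm: "smooth U" using U by (simp add: coord_solution_def)
    have "EI U t \<le> EI U 0" unfolding EI_def by (rule SI_eV_le[OF U t])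
    also have "\<dots> \<le> SI 0 (\<lambda>p. Ce * (wt p * NN p (du U p)))"
      unfolding EI_def
    proof (rule SI_mono)
      fix p assume p: "p \<in> interior_pts"
      show "wt p * eV p (du U p) \<le> Ce * (wt p * NN p (du U p))"
        using mult_left_mono[OF Ce(2)[OF p] wt_nonneg[OF p]] by (simp add: mult_ac)
    qed
    also have "\<dots> = ennreal Ce * NI U 0"
      unfolding NI_def
      by (intro SI_cmult continuous_intros continuous_wt continuous_densities sm Ce mult_nonneg_nonneg wt_nonneg NN_parts)
    finally show ?thesis .
  qed
  have est: "NI U t \<le> ennreal (K * (1 + 2 * Ce)) * (NI U 0 + NI (pd (Some Phi) U) 0 + NI (pd (Some Psi) U) 0)"
    if U: "coord_solution U" and t: "0 \<le> t" for U t
  proof (cases "NI U 0 = \<infinity>")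
    case False
    have sm: "smooth U" using U by (simp add: coord_solution_def)
    define P where "P l = pd (Some l) U" for l
    have solP: "coord_solution (P l)" if "l \<in> {Phi, Psi}" for l
      unfolding P_def by (rule coord_solution_pd[OF U]) (use that in auto)
    have smP: "smooth (P l)" for l unfolding P_def by (rule smooth_pd[OF sm])
    have cE: "continuous_on interior_pts (\<lambda>p. wt p * eV p (du U p))"
      by (intro continuous_intros continuous_wt continuous_densities sm)
    have nE: "0 \<le> wt p * eV p (du U p)" if "p \<in> interior_pts" for p
      using wt_nonneg[OF that] eV_nonneg by simp
    have cW: "continuous_on interior_pts (\<lambda>p. wt p * (P l p)\<^sup>2)" for l
      by (intro continuous_intros continuous_wt smooth_continuous smP)
    have nW: "0 \<le> wt p * (P l p)\<^sup>2" if "p \<in> interior_pts" for p l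
      using wt_nonneg[OF that] by simp
    have finE: "EI U t \<noteq> \<infinity>"
      using EN[OF U t] False by (rule ennreal_finite_cmult)
    have finT: "SI t (\<lambda>p. wt p * (eV p (du U p) + b p * ((P Phi p)\<^sup>2 + (P Psi p)\<^sup>2))) \<noteq> \<infinity>"
    proof -
      have "SI t (\<lambda>p. wt p * (eV p (du U p) + b p * ((P Phi p)\<^sup>2 + (P Psi p)\<^sup>2)))
        = EI U t + SI t (\<lambda>p. wt p * (b p * ((P Phi p)\<^sup>2 + (P Psi p)\<^sup>2)))"
        unfolding EI_def distrib_left[of "wt _" "eV _ _"]
        by (intro SI_add cE nE continuous_intros continuous_wt b(1) smooth_continuous smP)
          (use wt_nonneg b(2) in auto)
      moreover have "SI t (\<lambda>p. wt p * (b p * \<bar>(P Phi p)\<^sup>2 + (P Psi p)\<^sup>2\<bar>)) \<noteq> \<infinity>"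
        by (rule SI_compact_finite[OF _ b(2,3)]) (intro continuous_intros smooth_continuous smP)
      ultimately show ?thesis using finE by simp
    qed
    have finN: "NI U t \<noteq> \<infinity>"
    proof -
      have "NI U t \<le> ennreal K * (NI U 0 + SI t (\<lambda>p. wt p * (eV p (du U p) + b p * ((P Phi p)\<^sup>2 + (P Psi p)\<^sup>2))))"
        unfolding NI_def P_def by (rule T[OF U t])
      moreover have "\<dots> \<noteq> \<infinity>" using False finT by (simp add: ennreal_mult_eq_top_iff)
      ultimately show ?thesis by (rule ennreal_finite_mono)
    qed
    have WP: "WI (P l) t \<le> ennreal (2 * Ce) * NI (P l) 0" if l: "l \<in> {Phi, Psi}" for l
    proof -
      have "WI (P l) t \<le> SI t (\<lambda>p. Cm * (wt p * NN p (du U p)))"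
        unfolding WI_def
      proof (rule SI_mono)
        fix p assume p: "p \<in> interior_pts"
        have "(P l p)\<^sup>2 \<le> Cm * Mu p (du U p)"
          using Cm(2,3)[OF p, of "du U p"] l by (auto simp: P_def)
        also have "\<dots> \<le> Cm * NN p (du U p)" using Cm(1) by (intro mult_left_mono NN_parts)
        finally show "wt p * (P l p)\<^sup>2 \<le> Cm * (wt p * NN p (du U p))"
          using mult_left_mono[OF _ wt_nonneg[OF p]] by (metis mult.left_commute)
      qed
      also have "\<dots> = ennreal Cm * NI U t"
        unfolding NI_def
        by (intro SI_cmult continuous_intros continuous_wt continuous_densities sm Cm mult_nonneg_nonneg wt_nonneg NN_parts)
      finally have "WI (P l) t \<noteq> \<infinity>"
        using finN by (rule ennreal_finite_cmult)
      then have "WI (P l) t \<le> SI t (\<lambda>p. wt p * (((rC p)\<^sup>2 + k) * (pd (Some Rad) (P l) p)\<^sup>2))"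
        unfolding WI_def by (rule hardy[OF smP])
      also have "\<dots> \<le> SI t (\<lambda>p. 2 * (wt p * eV p (du (P l) p)))"
      proof (rule SI_mono)
        fix p assume p: "p \<in> interior_pts"
        have "((rC p)\<^sup>2 + k) * (pd (Some Rad) (P l) p)\<^sup>2 \<le> 2 * eV p (du (P l) p)"
          using Q0_parts(3)[of p "du (P l) p"] Q0_le_eV(1)[of p "du (P l) p"] by linarith
        from mult_left_mono[OF this wt_nonneg[OF p]]
        show "wt p * (((rC p)\<^sup>2 + k) * (pd (Some Rad) (P l) p)\<^sup>2) \<le> 2 * (wt p * eV p (du (P l) p))"
          by (simp add: mult_ac)
      qed
      also have "\<dots> = ennreal 2 * EI (P l) t"
        unfolding EI_def
        by (intro SI_cmult continuous_intros continuous_wt continuous_densities smP mult_nonneg_nonneg wt_nonneg eV_nonneg) auto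
      also have "\<dots> \<le> ennreal 2 * (ennreal Ce * NI (P l) 0)"
        by (intro mult_left_mono EN solP l t) simp
      also have "\<dots> = ennreal (2 * Ce) * NI (P l) 0"
        using Ce by (simp add: ennreal_mult mult.assoc)
      finally show ?thesis .
    qed
    have "SI t (\<lambda>p. wt p * (eV p (du U p) + b p * ((P Phi p)\<^sup>2 + (P Psi p)\<^sup>2)))
      \<le> SI t (\<lambda>p. wt p * eV p (du U p) + (wt p * (P Phi p)\<^sup>2 + wt p * (P Psi p)\<^sup>2))"
    proof (rule SI_mono)
      fix p assume p: "p \<in> interior_pts"
      have "b p * ((P Phi p)\<^sup>2 + (P Psi p)\<^sup>2) \<le> 1 * ((P Phi p)\<^sup>2 + (P Psi p)\<^sup>2)"
        using b(2) by (intro mult_right_mono) auto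
      then have "eV p (du U p) + b p * ((P Phi p)\<^sup>2 + (P Psi p)\<^sup>2) \<le> eV p (du U p) + ((P Phi p)\<^sup>2 + (P Psi p)\<^sup>2)" by simp
      from mult_left_mono[OF this wt_nonneg[OF p]]
      show "wt p * (eV p (du U p) + b p * ((P Phi p)\<^sup>2 + (P Psi p)\<^sup>2)) \<le> wt p * eV p (du U p) + (wt p * (P Phi p)\<^sup>2 + wt p * (P Psi p)\<^sup>2)"
        by (simp add: distrib_left)
    qed
    also have "\<dots> = EI U t + (WI (P Phi) t + WI (P Psi) t)"
    proof -
      have "SI t (\<lambda>p. wt p * (P Phi p)\<^sup>2 + wt p * (P Psi p)\<^sup>2) = WI (P Phi) t + WI (P Psi) t"
        unfolding WI_def by (rule SI_add[OF cW cW nW nW])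
      moreover have "SI t (\<lambda>p. wt p * eV p (du U p) + (wt p * (P Phi p)\<^sup>2 + wt p * (P Psi p)\<^sup>2))
        = EI U t + SI t (\<lambda>p. wt p * (P Phi p)\<^sup>2 + wt p * (P Psi p)\<^sup>2)"
        unfolding EI_def by (rule SI_add[OF cE continuous_on_add[OF cW cW] nE add_nonneg_nonneg[OF nW nW]])
      ultimately show ?thesis by simp
    qed
    also have "\<dots> \<le> ennreal Ce * NI U 0 + (ennreal (2 * Ce) * NI (P Phi) 0 + ennreal (2 * Ce) * NI (P Psi) 0)"
      by (intro add_mono EN U t WP) auto
    finally have 1: "SI t (\<lambda>p. wt p * (eV p (du U p) + b p * ((P Phi p)\<^sup>2 + (P Psi p)\<^sup>2)))
      \<le> ennreal Ce * NI U 0 + (ennreal (2 * Ce) * NI (P Phi) 0 + ennreal (2 * Ce) * NI (P Psi) 0)" .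
    have "NI U t \<le> ennreal K * (NI U 0 + SI t (\<lambda>p. wt p * (eV p (du U p) + b p * ((P Phi p)\<^sup>2 + (P Psi p)\<^sup>2))))"
      unfolding NI_def P_def by (rule T[OF U t])
    also have "\<dots> \<le> ennreal K * (NI U 0 + (ennreal Ce * NI U 0 + (ennreal (2 * Ce) * NI (P Phi) 0 + ennreal (2 * Ce) * NI (P Psi) 0)))"
      by (intro mult_left_mono add_left_mono 1) simp
    also have "\<dots> \<le> ennreal K * (ennreal (1 + 2 * Ce) * (NI U 0 + NI (P Phi) 0 + NI (P Psi) 0))"
    proof (intro mult_left_mono)
      have a: "NI U 0 + ennreal Ce * NI U 0 \<le> ennreal (1 + 2 * Ce) * NI U 0"
      proof -
        have "NI U 0 + ennreal Ce * NI U 0 = ennreal (1 + Ce) * NI U 0"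
          using Ce by (simp add: ennreal_plus distrib_right)
        also have "\<dots> \<le> ennreal (1 + 2 * Ce) * NI U 0" using Ce by (intro mult_right_mono ennreal_leI) auto
        finally show ?thesis .
      qed
      have c: "ennreal (2 * Ce) * x \<le> ennreal (1 + 2 * Ce) * x" for x
        by (intro mult_right_mono ennreal_leI) auto
      show "NI U 0 + (ennreal Ce * NI U 0 + (ennreal (2 * Ce) * NI (P Phi) 0 + ennreal (2 * Ce) * NI (P Psi) 0))
        \<le> ennreal (1 + 2 * Ce) * (NI U 0 + NI (P Phi) 0 + NI (P Psi) 0)"
        using add_mono[OF a add_mono[OF c[of "NI (P Phi) 0"] c[of "NI (P Psi) 0"]]]
        by (simp only: distrib_left add.assoc)
    qed simp
    also have "\<dots> = ennreal (K * (1 + 2 * Ce)) * (NI U 0 + NI (P Phi) 0 + NI (P Psi) 0)"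
      using K Ce by (simp add: ennreal_mult mult.assoc)
    finally show ?thesis by (simp add: P_def)
  next
    case True
    then show ?thesis
    proof (cases "K = 0")
      case True
      then show ?thesis using T[OF U t] by (simp add: NI_def)
    next
      case False
      then have pos: "0 < K * (1 + 2 * Ce)" using K Ce by simp
      define a where "a = ennreal (K * (1 + 2 * Ce))"
      have "a \<noteq> 0" unfolding a_def ennreal_eq_0_iff using pos by linarith
      then have "a * (NI U 0 + NI (pd (Some Phi) U) 0 + NI (pd (Some Psi) U) 0) = top"
        using \<open>NI U 0 = \<infinity>\<close> by (simp add: ennreal_mult_eq_top_iff)
      then show ?thesis by (simp add: a_def)
    qed
  qed
  have "K * (1 + 2 * Ce) \<ge> 0" using K Ce by simp
  then show ?thesis using est unfolding NI_def by blast
qed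

section \<open>Comparison with the slice integral\<close>

lemma slice_domain_Dom: "slice_domain \<subseteq> Dom"
  by (auto simp: slice_domain_def Dom_def regular_def)

lemma slice_domain_regular: "x \<in> slice_domain \<Longrightarrow> on_slice t x \<in> regular"
  by (auto simp: slice_domain_def regular_def f_def)

lemma negligible_coordinate_hyperplane: "negligible {x :: real ^ 'n::finite. x $ j = a}"
  using negligible_standard_hyperplane[of "axis j 1 :: real ^ 'n" a] by (simp add: inner_axis)

lemma negligible_f_zero: "negligible {x. 0 < x $ Rad \<and> f (on_slice 0 x) = 0}"
proof -
  define c where "c x = - (k * \<nu> (on_slice 0 x))" for x
  define A where "A = {x :: slice_coords. x $ Rad = 0 \<and> 0 < c x}"
  define E where "E x = x + sqrt (c x) *\<^sub>R axis Rad 1" for x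
  have "negligible A"
    by (rule negligible_subset[OF negligible_coordinate_hyperplane[of Rad 0]]) (auto simp: A_def)
  moreover have "E differentiable_on A"
    unfolding differentiable_on_def
  proof
    fix x assume x: "x \<in> A"
    have nth: "C1_on UNIV (\<lambda>x :: slice_coords. x $ Theta)"
      by (rule Ck_C1_on[OF Ck_bounded_linear[OF bounded_linear_vec_nth]])
    have "C1_on UNIV c"
      unfolding c_def \<nu>_def on_slice_nth
      by (intro C1_on_minus C1_on_mult C1_on_diff C1_on_const C1_on_power C1_on_cos C1_on_sin nth)
    then have "c differentiable (at x)" by (rule C1_onD(1)) simp
    moreover have "(sqrt has_real_derivative inverse (sqrt (c x)) / 2) (at (c x))"
      by (rule DERIV_real_sqrt) (use x in \<open>simp add: A_def\<close>)
    ultimately have "(\<lambda>x. sqrt (c x)) differentiable (at x)" by (rule frechet_derivative_comp_real(1))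
    then have "E differentiable (at x)"
      unfolding E_def by (intro differentiable_add differentiable_ident differentiable_scaleR differentiable_const)
    then show "E differentiable (at x within A)" by (rule differentiable_at_withinI)
  qed
  ultimately have "negligible (E ` A)" by (intro negligible_differentiable_image_negligible) auto
  moreover have "{x. 0 < x $ Rad \<and> f (on_slice 0 x) = 0} \<subseteq> E ` A"
  proof
    fix x assume "x \<in> {x. 0 < x $ Rad \<and> f (on_slice 0 x) = 0}"
    then have x: "0 < x $ Rad" "f (on_slice 0 x) = 0" by auto
    define y where "y = x - (x $ Rad) *\<^sub>R axis Rad 1"
    have "c y = c x" by (simp add: c_def \<nu>_def y_def axis_def)
    moreover have cx: "c x = (x $ Rad)\<^sup>2" using x(2) by (simp add: f_eq c_def)
    ultimately have "y \<in> A" "E y = x" using x(1) by (auto simp: A_def y_def E_def axis_def)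
    then show "x \<in> E ` A" by blast
  qed
  ultimately show ?thesis by (rule negligible_subset)
qed

lemma AE_slice_domain: "AE x in lborel. x \<in> Dom \<longrightarrow> x \<in> slice_domain"
proof -
  define Z where "Z = {x \<in> Dom. f (on_slice 0 x) = 0} \<union> {x. x $ Phi = 2 * pi} \<union> {x. x $ Psi = 2 * pi} \<union> {x. x $ Zed = 2 * pi * Rz}"
  have "closed {x. f (on_slice 0 x) = 0}"
    by (intro closed_Collect_eq continuous_intros continuous_on_compose2[OF f_continuous[of UNIV] continuous_on_slice']) auto
  then have "{x. f (on_slice 0 x) = 0} \<in> sets borel" by (rule borel_closed)
  moreover have "{x \<in> Dom. f (on_slice 0 x) = 0} = Dom \<inter> {x. f (on_slice 0 x) = 0}" by auto
  moreover have "{x :: slice_coords. x $ j = a} \<in> sets borel" for j a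
    by (intro borel_closed closed_Collect_eq continuous_intros)
  ultimately have Zb: "Z \<in> sets borel" unfolding Z_def by (intro sets.Un) auto
  have "negligible Z"
    unfolding Z_def
  proof (intro negligible_Un negligible_coordinate_hyperplane)
    show "negligible {x \<in> Dom. f (on_slice 0 x) = 0}"
      by (rule negligible_subset[OF negligible_f_zero]) (auto simp: Dom_def)
  qed
  then have "Z \<in> null_sets lborel"
    using Zb by (simp add: negligible_iff_null_sets null_sets_completion_iff)
  moreover have "{x \<in> space lborel. \<not> (x \<in> Dom \<longrightarrow> x \<in> slice_domain)} \<subseteq> Z"
    by (auto simp: Z_def Dom_def slice_domain_def regular_def)
  ultimately show ?thesis by (intro AE_I'[of Z]) auto
qed

lemma energy_boundedness:
  "\<exists>C>0. \<forall>U t. coord_solution U \<longrightarrow> 0 \<le> t \<longrightarrow>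
     slice_integral t (grad_sq U) \<le> ennreal C * slice_integral 0
       (\<lambda>p. grad_sq U p + grad_sq (pd (Some Phi) U) p + grad_sq (pd (Some Psi) U) p)"
proof -
  obtain K where K: "K \<ge> 0" and est: "\<And>U t. coord_solution U \<Longrightarrow> 0 \<le> t \<Longrightarrow>
     SI t (\<lambda>p. wt p * NN p (du U p)) \<le> ennreal K * (SI 0 (\<lambda>p. wt p * NN p (du U p))
       + SI 0 (\<lambda>p. wt p * NN p (du (pd (Some Phi) U) p)) + SI 0 (\<lambda>p. wt p * NN p (du (pd (Some Psi) U) p)))"
    using SI_estimate by blast
  obtain C where C: "C > 0" and D: "\<And>p U. p \<in> regular \<Longrightarrow> U differentiable (at p) \<Longrightarrow>
     grad_sq U p * dvol_density p \<le> C * (wt p * NN p (du U p))"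
     "\<And>p U. p \<in> regular \<Longrightarrow> U differentiable (at p) \<Longrightarrow> wt p * NN p (du U p) \<le> C * (grad_sq U p * dvol_density p)"
    using grad_sq_dvol_bounds by blast
  have "slice_integral t (grad_sq U) \<le> ennreal (C * K * C + 1) * slice_integral 0
       (\<lambda>p. grad_sq U p + grad_sq (pd (Some Phi) U) p + grad_sq (pd (Some Psi) U) p)"
    if U: "coord_solution U" and t: "0 \<le> t" for U t
  proof -
    have sm: "smooth U" using U by (simp add: coord_solution_def)
    define P where "P l = pd (Some l) U" for l
    have smP: "smooth (P l)" for l unfolding P_def by (rule smooth_pd[OF sm])
    define Nw where "Nw W p = wt p * NN p (du W p)" for W p
    have cN: "continuous_on interior_pts (Nw W)" if "smooth W" for W
      unfolding Nw_def by (intro continuous_intros continuous_wt continuous_densities that)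
    have N0: "0 \<le> Nw W p" if "p \<in> interior_pts" for W p
      using wt_nonneg[OF that] NN_parts(3) by (simp add: Nw_def)
    define I0 where "I0 = slice_integral 0 (\<lambda>p. grad_sq U p + grad_sq (P Phi) p + grad_sq (P Psi) p)"
    have "slice_integral t (grad_sq U) \<le> SI t (\<lambda>p. C * Nw U p)"
      unfolding slice_integral_def SI_def
    proof (intro nn_integral_mono)
      fix x
      show "ennreal (grad_sq U (on_slice t x) * dvol_density (on_slice t x)) * indicator slice_domain x
        \<le> ennreal (C * Nw U (on_slice t x)) * indicator Dom x"
      proof (cases "x \<in> slice_domain")
        case True
        then show ?thesis
          using slice_domain_Dom D(1)[OF slice_domain_regular[OF True] smooth_differentiable[OF sm], of t]
          by (auto simp: Nw_def intro!: ennreal_leI)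
      qed simp
    qed
    also have "\<dots> = ennreal C * SI t (Nw U)" by (rule SI_cmult[OF cN[OF sm] less_imp_le[OF C] N0])
    also have "\<dots> \<le> ennreal C * (ennreal K * (SI 0 (Nw U) + SI 0 (Nw (P Phi)) + SI 0 (Nw (P Psi))))"
      unfolding Nw_def P_def by (intro mult_left_mono est U t) simp
    also have "SI 0 (Nw U) + SI 0 (Nw (P Phi)) + SI 0 (Nw (P Psi)) = SI 0 (\<lambda>p. Nw U p + Nw (P Phi) p + Nw (P Psi) p)"
    proof -
      have "SI 0 (\<lambda>p. Nw U p + Nw (P Phi) p) = SI 0 (Nw U) + SI 0 (Nw (P Phi))"
        by (rule SI_add[OF cN[OF sm] cN[OF smP] N0 N0])
      moreover have "SI 0 (\<lambda>p. Nw U p + Nw (P Phi) p + Nw (P Psi) p) = SI 0 (\<lambda>p. Nw U p + Nw (P Phi) p) + SI 0 (Nw (P Psi))"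
        by (rule SI_add[OF continuous_on_add[OF cN[OF sm] cN[OF smP]] cN[OF smP] add_nonneg_nonneg[OF N0 N0] N0])
      ultimately show ?thesis by simp
    qed
    also have "SI 0 (\<lambda>p. Nw U p + Nw (P Phi) p + Nw (P Psi) p) \<le> ennreal C * I0"
    proof -
      define F where "F p = Nw U p + Nw (P Phi) p + Nw (P Psi) p" for p
      have cF: "continuous_on interior_pts F"
        unfolding F_def by (intro continuous_on_add cN sm smP)
      have F0: "0 \<le> F p" if "p \<in> interior_pts" for p
        unfolding F_def by (intro add_nonneg_nonneg N0 that)
      have "SI 0 (\<lambda>p. 1 / C * F p) \<le> (\<integral>\<^sup>+x. ennreal (1 / C * F (on_slice 0 x)) * indicator slice_domain x \<partial>lborel)"
        unfolding SI_def
        by (rule nn_integral_mono_AE) (use AE_slice_domain in \<open>eventually_elim, auto split: split_indicator\<close>)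
      also have "\<dots> \<le> I0"
        unfolding I0_def slice_integral_def
      proof (intro nn_integral_mono)
        fix x
        show "ennreal (1 / C * F (on_slice 0 x)) * indicator slice_domain x \<le> ennreal ((grad_sq U (on_slice 0 x) + grad_sq (P Phi) (on_slice 0 x)
           + grad_sq (P Psi) (on_slice 0 x)) * dvol_density (on_slice 0 x)) * indicator slice_domain x"
        proof (cases "x \<in> slice_domain")
          case True
          note reg = slice_domain_regular[OF True, of 0]
          have "F (on_slice 0 x) \<le> C * ((grad_sq U (on_slice 0 x) + grad_sq (P Phi) (on_slice 0 x) + grad_sq (P Psi) (on_slice 0 x)) * dvol_density (on_slice 0 x))"
            using add_mono[OF add_mono[OF D(2)[OF reg smooth_differentiable[OF sm]] D(2)[OF reg smooth_differentiable[OF smP[of Phi]]]]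
              D(2)[OF reg smooth_differentiable[OF smP[of Psi]]]]
            by (simp add: F_def Nw_def algebra_simps)
          then have "1 / C * F (on_slice 0 x) \<le> (grad_sq U (on_slice 0 x) + grad_sq (P Phi) (on_slice 0 x) + grad_sq (P Psi) (on_slice 0 x)) * dvol_density (on_slice 0 x)"
            using C by (simp add: field_simps)
          then show ?thesis using True by (simp add: ennreal_leI)
        qed simp
      qed
      finally have "ennreal (1 / C) * SI 0 F \<le> I0"
        using SI_cmult[OF cF _ F0, of "1 / C" 0] C by simp
      then have "ennreal C * (ennreal (1 / C) * SI 0 F) \<le> ennreal C * I0" by (rule mult_left_mono) simp
      moreover have "ennreal C * (ennreal (1 / C) * SI 0 F) = SI 0 F"
        using C by (simp add: mult.assoc[symmetric] flip: ennreal_mult)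
      ultimately show ?thesis by (simp add: F_def[abs_def])
    qed
    finally have "slice_integral t (grad_sq U) \<le> ennreal C * (ennreal K * (ennreal C * I0))"
      by (simp add: mult_left_mono)
    also have "\<dots> = ennreal (C * K * C) * I0"
      using C K by (simp add: ennreal_mult mult.assoc)
    also have "\<dots> \<le> ennreal (C * K * C + 1) * I0"
      by (intro mult_right_mono ennreal_leI) auto
    finally show ?thesis by (simp add: I0_def P_def)
  qed
  moreover have "0 < C * K * C + 1" using C K by (simp add: add_nonneg_pos)
  ultimately show ?thesis by blast
qed

end

theorem theorem4p15:
  fixes Q1 Q2 Rz :: real and n :: nat
  assumes "three_charge_microstate Q1 Q2 Rz n"
  shows "\<exists>C::real. C > 0 \<and>
    (\<forall>u :: ambient \<Rightarrow> real.
       three_charge_microstate.smooth_wave_solution Q1 Q2 Rz n u \<longrightarrow>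
       compactly_supported_data u \<longrightarrow>
       (let U = u \<circ> three_charge_microstate.chart Rz n;
            D = three_charge_microstate.grad_sq Q1 Q2 Rz n;
            I = three_charge_microstate.slice_integral Q1 Q2 Rz n
        in \<forall>t\<ge>0. I t (D U) \<le>
             ennreal C * I 0 (\<lambda>p. D U p + D (pd (Some Phi) U) p + D (pd (Some Psi) U) p)))"
proof -
  interpret three_charge_microstate Q1 Q2 Rz n by (rule assms)
  show ?thesis
    using energy_boundedness coord_solution_chart unfolding Let_def by meson
qed

end
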